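(* Let $\mathbb{B}^3$ be the open unit ball of $\mathbb{R}^3$ and let $u$ be a bounded real-valued harmonic function on $\mathbb{B}^3$. Then for every $x\in\mathbb{B}^3\setminus\{0\}$, with $\rho=|x|$, $$|\nabla u(x)|\le \frac{1}{\rho^2}\left(\frac{(1+\frac{1}{3}\rho^2)^{\frac{3}{2}}}{1-\rho^2}-1\right)\sup_{|y|<1}|u(y)|,$$ and this inequality is sharp, i.e. for each such $x$ the constant on the right is the smallest constant $C$ for which $|\nabla u(x)|\le C\sup_{|y|<1}|u(y)|$ holds for all bounded harmonic $u$ on $\mathbb{B}^3$. *)

theory Defs
  imports "HOL-Analysis.Analysis"
begin

definition partial :: "3 \<Rightarrow> (real^3 \<Rightarrow> real) \<Rightarrow> real^3 \<Rightarrow> real" where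
  "partial i f x = frechet_derivative f (at x) (axis i 1)"

definition grad :: "(real^3 \<Rightarrow> real) \<Rightarrow> real^3 \<Rightarrow> real^3" where
  "grad f x = (\<chi> i. partial i f x)"

definition laplacian :: "(real^3 \<Rightarrow> real) \<Rightarrow> real^3 \<Rightarrow> real" where
  "laplacian f x = (\<Sum>i\<in>UNIV. partial i (partial i f) x)"

definition harmonic_on :: "(real^3) set \<Rightarrow> (real^3 \<Rightarrow> real) \<Rightarrow> bool" where
  "harmonic_on S f \<longleftrightarrow>
     (\<forall>x\<in>S. f differentiable (at x)) \<and>
     (\<forall>i. \<forall>x\<in>S. partial i f differentiable (at x)) \<and>
     (\<forall>i j. continuous_on S (partial j (partial i f))) \<and>
     (\<forall>x\<in>S. laplacian f x = 0)"

end

theory Submission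
  imports Defs
begin

text \<open>
  Write \<open>\<rho> = norm x\<close> and \<open>Y = sqrt (1 + \<rho>^2 / 3)\<close>; the sharp constant is
  \<open>(Y + 2)^2 / (3 * (Y + 1)) / (1 - \<rho>^2)\<close>.
  For the upper bound, a Kelvin transform \<open>v\<close> of \<open>u\<close> maps the ball to itself and \<open>0\<close> to \<open>x\<close>.
  Then \<open>\<bar>v \<eta>\<bar> \<le> sup \<bar>u\<bar> * \<rho> / norm (\<eta> - x)\<close> on the unit sphere, and the mean value properties
  of \<open>v\<close> and of its gradient at the origin express each component of the gradient of \<open>u\<close> at
  \<open>x\<close> as a spherical mean of \<open>v\<close> against an affine function. So everything reduces to the integral of
  \<open>\<bar>3 * (\<eta> \<bullet> l) + x \<bullet> l\<bar> / norm (\<eta> + x)\<close> over the sphere, for a unit vector \<open>l\<close>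
  (after \<open>\<eta> \<mapsto> -\<eta>\<close>), which has to be
  maximal for \<open>l\<close> parallel to \<open>x\<close>. The integrand without absolute value integrates to zero, so
  the absolute value may be replaced by twice the positive part, which keeps away from the point
  \<open>\<eta>\<close> nearest to \<open>-x\<close>. The mean over circles around \<open>l\<close> is bounded by inverse square roots of
  linear functions of \<open>\<eta> \<bullet> l\<close>, whose integrals are elementary, and a polynomial inequality remains.
  For sharpness, the Poisson integral of \<open>1\<close> on a suitable cap around \<open>x / \<rho>\<close> and \<open>-1\<close> on its
  complement attains the bound; on the axis of the cap it has a closed form.
\<close>

section \<open>Flux and mean values over spheres\<close>

text \<open>Two facts shape the estimate. First, the affine weight is the combination of the two
  mean value identities in which the value \<open>u x\<close> cancels. Applied to the constant
  function 1, the same identity says that the weight integrates to zero against the Kelvin transform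
  of 1, and this transform times sup |u| is the majorant of |v|. Second, the constant is sharp, so
  every inequality on the way has to become an equality for radial l. For other l the circle means
  are complete elliptic integrals. They are replaced by a combination, with weights 1/4 and 3/4, of
  inverse square roots of two linear functions which coincide in the radial case. The remaining
  deficit is of first order in a parameter \<open>d\<close> that vanishes exactly for radial l, so
  the polynomial inequalities are handled by splitting off a factor \<open>d\<close>. The boundary
  of the cap in the sharpness part is the circle on which the radial derivative at \<open>x\<close>
  of the Poisson kernel changes sign.\<close>

lemma blinear_continuous_on:
  fixes D :: "'a::topological_space \<Rightarrow> 'b::euclidean_space \<Rightarrow> 'c::real_normed_vector"
  assumes lin: "\<And>y. y \<in> S \<Longrightarrow> linear (D y)"
    and cont: "\<And>h. continuous_on S (\<lambda>y. D y h)"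
    and f: "continuous_on T f" "f ` T \<subseteq> S" and g: "continuous_on T g"
  shows "continuous_on T (\<lambda>t. D (f t) (g t))"
proof -
  \<comment> \<open>Expanding the argument along the basis reduces everything to continuity for a
    fixed direction, the only continuity that is asked of second derivatives below.\<close>
  have "continuous_on T (\<lambda>t. D (f t) b)" for b
    using continuous_on_compose2[OF cont f] .
  then have "continuous_on T (\<lambda>t. \<Sum>b\<in>Basis. (g t \<bullet> b) *\<^sub>R D (f t) b)"
    using g by (intro continuous_intros)
  moreover have "(\<Sum>b\<in>Basis. (g t \<bullet> b) *\<^sub>R D (f t) b) = D (f t) (g t)" if "t \<in> T" for t
  proof -
    have "linear (D (f t))" using lin f(2) that by auto
    then have "D (f t) (\<Sum>b\<in>Basis. (g t \<bullet> b) *\<^sub>R b) = (\<Sum>b\<in>Basis. (g t \<bullet> b) *\<^sub>R D (f t) b)"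
      by (simp add: linear_sum linear_scale)
    then show ?thesis by (simp add: euclidean_representation)
  qed
  ultimately show ?thesis by (simp cong: continuous_on_cong)
qed

text \<open>The frame is a parameter because the polar axis \<open>e1\<close> is chosen differently
  in the two halves of the proof: along a reflected gradient for the estimate, along
  \<open>x\<close> for sharpness.\<close>

locale orthonormal_frame =
  fixes e1 e2 e3 :: "real^3"
  assumes unit: "e1 \<bullet> e1 = 1" "e2 \<bullet> e2 = 1" "e3 \<bullet> e3 = 1"
    and orth: "e1 \<bullet> e2 = 0" "e1 \<bullet> e3 = 0" "e2 \<bullet> e3 = 0"
begin

lemma orth': "e2 \<bullet> e1 = 0" "e3 \<bullet> e1 = 0" "e3 \<bullet> e2 = 0"
  using orth by (simp_all add: inner_commute)

lemma distinct: "e1 \<noteq> e2" "e1 \<noteq> e3" "e2 \<noteq> e3"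
  using unit orth by auto

lemma expand: "x = (x \<bullet> e1) *\<^sub>R e1 + (x \<bullet> e2) *\<^sub>R e2 + (x \<bullet> e3) *\<^sub>R e3"
proof -
  have pw: "pairwise orthogonal {e1, e2, e3}"
    using orth orth' by (auto simp: pairwise_def orthogonal_def)
  have "0 \<notin> {e1, e2, e3}" using unit by auto
  then have "independent {e1, e2, e3}" using pw pairwise_orthogonal_independent by blast
  moreover have "card {e1, e2, e3} = 3" using distinct by simp
  ultimately have "UNIV \<subseteq> span {e1, e2, e3}"
    by (intro card_ge_dim_independent) (auto simp: dim_UNIV)
  then have "(\<Sum>i\<in>{e1, e2, e3}. (x \<bullet> i) *\<^sub>R i) = x"
    using pw unit by (intro orthonormal_basis_expand) (auto simp: norm_eq_1)
  then show ?thesis using distinct by (simp add: add.assoc)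
qed

lemma inner_expand: "x \<bullet> y = (x \<bullet> e1) * (y \<bullet> e1) + (x \<bullet> e2) * (y \<bullet> e2) + (x \<bullet> e3) * (y \<bullet> e3)"
proof -
  have "x \<bullet> y = ((x \<bullet> e1) *\<^sub>R e1 + (x \<bullet> e2) *\<^sub>R e2 + (x \<bullet> e3) *\<^sub>R e3) \<bullet> y"
    using expand[of x] by simp
  also have "\<dots> = (x \<bullet> e1) * (e1 \<bullet> y) + (x \<bullet> e2) * (e2 \<bullet> y) + (x \<bullet> e3) * (e3 \<bullet> y)"
    by (simp add: inner_add_left)
  finally show ?thesis by (simp add: inner_commute[of _ y])
qed

text \<open>Parseval, applied to each \<open>H e\<close> against \<open>e\<close>. It allows a
  divergence given as a sum over \<open>Basis\<close> to be evaluated in the moving frame of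
  spherical coordinates.\<close>

lemma trace_eq:
  assumes "linear H"
  shows "(\<Sum>b\<in>Basis. H b \<bullet> b) = H e1 \<bullet> e1 + H e2 \<bullet> e2 + H e3 \<bullet> e3"
proof -
  have H: "H x = (x \<bullet> e1) *\<^sub>R H e1 + (x \<bullet> e2) *\<^sub>R H e2 + (x \<bullet> e3) *\<^sub>R H e3" for x
  proof -
    have "H x = H ((x \<bullet> e1) *\<^sub>R e1 + (x \<bullet> e2) *\<^sub>R e2 + (x \<bullet> e3) *\<^sub>R e3)" using expand[of x] by simp
    then show ?thesis by (simp add: linear_add[OF assms] linear_scale[OF assms])
  qed
  have "(\<Sum>b\<in>Basis. H b \<bullet> b) = (\<Sum>b\<in>Basis. (H e1 \<bullet> b) * (e1 \<bullet> b) + (H e2 \<bullet> b) * (e2 \<bullet> b) + (H e3 \<bullet> b) * (e3 \<bullet> b))"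
    by (rule sum.cong[OF refl], subst H) (simp add: inner_add_left inner_commute[of e1] inner_commute[of e2] inner_commute[of e3])
  then show ?thesis by (simp add: sum.distrib euclidean_inner[symmetric])
qed

section \<open>Spherical coordinates and their moving frame\<close>

definition sph :: "real \<Rightarrow> real \<Rightarrow> real^3" where
  "sph \<theta> \<phi> = cos \<theta> *\<^sub>R e1 + sin \<theta> *\<^sub>R (cos \<phi> *\<^sub>R e2 + sin \<phi> *\<^sub>R e3)"

definition sph\<^sub>\<theta> :: "real \<Rightarrow> real \<Rightarrow> real^3" where
  "sph\<^sub>\<theta> \<theta> \<phi> = - sin \<theta> *\<^sub>R e1 + cos \<theta> *\<^sub>R (cos \<phi> *\<^sub>R e2 + sin \<phi> *\<^sub>R e3)"

text \<open>Normalised: the derivative of \<open>sph\<close> in \<phi> is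
  \<open>sin \<theta>\<close> times this vector, so the frame stays orthonormal at the
  poles.\<close>

definition sph\<^sub>\<phi> :: "real \<Rightarrow> real^3" where
  "sph\<^sub>\<phi> \<phi> = - sin \<phi> *\<^sub>R e2 + cos \<phi> *\<^sub>R e3"

lemma sph_inner_self: "sph \<theta> \<phi> \<bullet> sph \<theta> \<phi> = 1"
proof -
  have "sph \<theta> \<phi> \<bullet> sph \<theta> \<phi> = (cos \<theta>)^2 + (sin \<theta>)^2 * ((cos \<phi>)^2 + (sin \<phi>)^2)"
    unfolding sph_def by (simp add: inner_add_left inner_add_right unit orth orth' power2_eq_square algebra_simps del: sin_cos_squared_add sin_cos_squared_add2 sin_cos_squared_add3)
  then show ?thesis by simp
qed

lemma norm_sph [simp]: "norm (sph \<theta> \<phi>) = 1"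
  by (simp add: norm_eq_1 sph_inner_self)

lemma spherical_frame: "orthonormal_frame (sph \<theta> \<phi>) (sph\<^sub>\<theta> \<theta> \<phi>) (sph\<^sub>\<phi> \<phi>)"
proof
  show "sph \<theta> \<phi> \<bullet> sph \<theta> \<phi> = 1" by (rule sph_inner_self)
  have "sph\<^sub>\<theta> \<theta> \<phi> \<bullet> sph\<^sub>\<theta> \<theta> \<phi> = (sin \<theta>)^2 + (cos \<theta>)^2 * ((cos \<phi>)^2 + (sin \<phi>)^2)"
    unfolding sph\<^sub>\<theta>_def by (simp add: inner_add_left inner_add_right unit orth orth' power2_eq_square algebra_simps del: sin_cos_squared_add sin_cos_squared_add2 sin_cos_squared_add3)
  then show "sph\<^sub>\<theta> \<theta> \<phi> \<bullet> sph\<^sub>\<theta> \<theta> \<phi> = 1" by simp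
  have "sph\<^sub>\<phi> \<phi> \<bullet> sph\<^sub>\<phi> \<phi> = (cos \<phi>)^2 + (sin \<phi>)^2"
    unfolding sph\<^sub>\<phi>_def by (simp add: inner_add_left inner_add_right unit orth orth' power2_eq_square algebra_simps del: sin_cos_squared_add sin_cos_squared_add2 sin_cos_squared_add3)
  then show "sph\<^sub>\<phi> \<phi> \<bullet> sph\<^sub>\<phi> \<phi> = 1" by simp
  have "sph \<theta> \<phi> \<bullet> sph\<^sub>\<theta> \<theta> \<phi> = - (sin \<theta> * cos \<theta>) + sin \<theta> * cos \<theta> * ((cos \<phi>)^2 + (sin \<phi>)^2)"
    unfolding sph\<^sub>\<theta>_def sph_def by (simp add: inner_add_left inner_add_right unit orth orth' power2_eq_square algebra_simps del: sin_cos_squared_add sin_cos_squared_add2 sin_cos_squared_add3)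
  then show "sph \<theta> \<phi> \<bullet> sph\<^sub>\<theta> \<theta> \<phi> = 0" by simp
  show "sph \<theta> \<phi> \<bullet> sph\<^sub>\<phi> \<phi> = 0" "sph\<^sub>\<theta> \<theta> \<phi> \<bullet> sph\<^sub>\<phi> \<phi> = 0"
    unfolding sph\<^sub>\<theta>_def sph_def sph\<^sub>\<phi>_def
    by (simp_all add: inner_add_left inner_add_right unit orth orth' algebra_simps)
qed

lemma sph_has_derivative_theta:
  "((\<lambda>\<theta>. sph \<theta> \<phi>) has_vector_derivative sph\<^sub>\<theta> \<theta> \<phi>) (at \<theta> within S)"
  unfolding sph_def sph\<^sub>\<theta>_def by (auto intro!: derivative_eq_intros)

lemma sph_has_derivative_phi:
  "((\<lambda>\<phi>. sph \<theta> \<phi>) has_vector_derivative (sin \<theta> *\<^sub>R sph\<^sub>\<phi> \<phi>)) (at \<phi> within S)"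
  unfolding sph_def sph\<^sub>\<phi>_def by (auto intro!: derivative_eq_intros)

lemma sph_theta_has_derivative:
  "((\<lambda>\<theta>. sph\<^sub>\<theta> \<theta> \<phi>) has_vector_derivative (- sph \<theta> \<phi>)) (at \<theta> within S)"
  unfolding sph_def sph\<^sub>\<theta>_def by (auto intro!: derivative_eq_intros)

lemma sph_phi_has_derivative:
  "(sph\<^sub>\<phi> has_vector_derivative (- (sin \<theta> *\<^sub>R sph \<theta> \<phi> + cos \<theta> *\<^sub>R sph\<^sub>\<theta> \<theta> \<phi>))) (at \<phi> within S)"
proof -
  have "sin \<theta> *\<^sub>R sph \<theta> \<phi> + cos \<theta> *\<^sub>R sph\<^sub>\<theta> \<theta> \<phi> = ((sin \<theta>)^2 + (cos \<theta>)^2) *\<^sub>R (cos \<phi> *\<^sub>R e2 + sin \<phi> *\<^sub>R e3)"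
    unfolding sph_def sph\<^sub>\<theta>_def scaleR_add_left 
    by (simp add: scaleR_add_right scaleR_right_diff_distrib power2_eq_square algebra_simps del: sin_cos_squared_add sin_cos_squared_add2 sin_cos_squared_add3)
  then have "sin \<theta> *\<^sub>R sph \<theta> \<phi> + cos \<theta> *\<^sub>R sph\<^sub>\<theta> \<theta> \<phi> = cos \<phi> *\<^sub>R e2 + sin \<phi> *\<^sub>R e3" by simp
  then show ?thesis unfolding sph\<^sub>\<phi>_def[abs_def] by (auto intro!: derivative_eq_intros)
qed

lemma continuous_sph [continuous_intros]:
  fixes f g :: "'x::t2_space \<Rightarrow> real"
  shows "continuous_on S f \<Longrightarrow> continuous_on S g \<Longrightarrow> continuous_on S (\<lambda>t. sph (f t) (g t))"
  and "continuous_on S f \<Longrightarrow> continuous_on S g \<Longrightarrow> continuous_on S (\<lambda>t. sph\<^sub>\<theta> (f t) (g t))"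
  and "continuous_on S g \<Longrightarrow> continuous_on S (\<lambda>t. sph\<^sub>\<phi> (g t))"
  unfolding sph_def sph\<^sub>\<theta>_def sph\<^sub>\<phi>_def by (auto intro!: continuous_intros)

abbreviation sphere_box :: "(real \<times> real) set" where
  "sphere_box \<equiv> cbox (0, 0) (pi, 2 * pi)"

text \<open>The flux, including the area factor \<open>s^2\<close>, is differentiated in the radius
  \<open>s\<close>. In spherical coordinates the divergence is the radial derivative plus exact
  derivatives in \<theta> and \<phi>, and the latter two integrate to zero over the box.\<close>

theorem flux_eq_0:
  assumes Z: "\<And>y. y \<in> ball 0 R \<Longrightarrow> (Z has_derivative D y) (at y)"
    and cont: "\<And>h. continuous_on (ball 0 R) (\<lambda>y. D y h)"
    and div0: "\<And>y. y \<in> ball 0 R \<Longrightarrow> (\<Sum>b\<in>Basis. D y b \<bullet> b) = 0"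
    and r: "0 < r" "r < R"
  shows "integral sphere_box (\<lambda>(\<theta>, \<phi>). (Z (r *\<^sub>R sph \<theta> \<phi>) \<bullet> sph \<theta> \<phi>) * sin \<theta>) = 0"
proof -
  define U where "U = {0..r}"
  have inb: "s *\<^sub>R sph \<theta> \<phi> \<in> ball 0 R" if "s \<in> U" for s \<theta> \<phi>
    using that r by (auto simp: U_def)
  have lin: "linear (D y)" if "y \<in> ball 0 R" for y
    using Z[OF that] has_derivative_linear by blast
  have contZ: "continuous_on (ball 0 R) Z"
    using Z by (meson continuous_at_imp_continuous_on has_derivative_continuous)
  have contZ': "continuous_on T (\<lambda>t. Z (f t *\<^sub>R sph (g t) (h t)))"
    if "continuous_on T f" "continuous_on T g" "continuous_on T h" "f ` T \<subseteq> U" for T :: "'x::t2_space set" and f g h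
    using that inb by (intro continuous_on_compose2[OF contZ]) (auto intro!: continuous_intros)
  have contD: "continuous_on T (\<lambda>t. D (f t *\<^sub>R sph (g t) (h t)) (k t))"
    if "continuous_on T f" "continuous_on T g" "continuous_on T h" "f ` T \<subseteq> U" "continuous_on T k"
    for T :: "'x::t2_space set" and f g h k
  proof (rule blinear_continuous_on[where S = "ball 0 R" and D = D])
    show "continuous_on T (\<lambda>t. f t *\<^sub>R sph (g t) (h t))" by (intro continuous_intros that)
    show "(\<lambda>t. f t *\<^sub>R sph (g t) (h t)) ` T \<subseteq> ball 0 R" using that(4) inb by blast
  qed (use that lin cont in auto)
  define f where "f s t = (case t of (\<theta>, \<phi>) \<Rightarrow> s^2 * ((Z (s *\<^sub>R sph \<theta> \<phi>) \<bullet> sph \<theta> \<phi>) * sin \<theta>))" for s t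
  define f' where "f' s t = (case t of (\<theta>, \<phi>) \<Rightarrow>
      (2 * s * (Z (s *\<^sub>R sph \<theta> \<phi>) \<bullet> sph \<theta> \<phi>) + s^2 * (D (s *\<^sub>R sph \<theta> \<phi>) (sph \<theta> \<phi>) \<bullet> sph \<theta> \<phi>)) * sin \<theta>)" for s t
  have contf': "continuous_on (U \<times> sphere_box) (\<lambda>(s, t). f' s t)"
    unfolding f'_def split_beta
    by (intro continuous_intros contZ' contD) auto
  have contf: "continuous_on sphere_box (f s)" if "s \<in> U" for s
    unfolding f_def split_beta using that by (intro continuous_intros contZ') auto
  have deriv: "((\<lambda>s. integral sphere_box (f s)) has_field_derivative integral sphere_box (f' s)) (at s within U)"
    if "s \<in> U" for s
  proof (rule leibniz_rule_field_derivative[OF _ _ contf' that])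
    fix s t assume s: "s \<in> U" and "t \<in> sphere_box"
    obtain \<theta> \<phi> where t: "t = (\<theta>, \<phi>)" by force
    have "((\<lambda>s. s *\<^sub>R sph \<theta> \<phi>) has_derivative (\<lambda>h. h *\<^sub>R sph \<theta> \<phi>)) (at s within U)"
      by (auto intro!: derivative_eq_intros)
    from has_derivative_compose[OF this Z[OF inb[OF s]]]
    have "((\<lambda>s. Z (s *\<^sub>R sph \<theta> \<phi>)) has_derivative (\<lambda>h. D (s *\<^sub>R sph \<theta> \<phi>) (h *\<^sub>R sph \<theta> \<phi>))) (at s within U)" .
    then have "((\<lambda>s. Z (s *\<^sub>R sph \<theta> \<phi>)) has_vector_derivative D (s *\<^sub>R sph \<theta> \<phi>) (sph \<theta> \<phi>)) (at s within U)"
      unfolding has_vector_derivative_def by (simp add: linear_scale[OF lin[OF inb[OF s]]])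
    then have "((\<lambda>s. Z (s *\<^sub>R sph \<theta> \<phi>) \<bullet> sph \<theta> \<phi>) has_field_derivative D (s *\<^sub>R sph \<theta> \<phi>) (sph \<theta> \<phi>) \<bullet> sph \<theta> \<phi>) (at s within U)"
      unfolding has_real_derivative_iff_has_vector_derivative
      by (rule bounded_linear.has_vector_derivative[OF bounded_linear_inner_left])
    then show "((\<lambda>s. f s t) has_field_derivative f' s t) (at s within U)"
      unfolding f_def f'_def t prod.case
      by (auto intro!: derivative_eq_intros simp: power2_eq_square algebra_simps)
  next
    fix s assume "s \<in> U"
    then show "f s integrable_on sphere_box" by (intro integrable_continuous contf)
  qed (simp add: U_def)
  have zero: "integral sphere_box (f' s) = 0" if s: "s \<in> U" for s
  proof -
    \<comment> \<open>\<open>a'\<close> is the \<theta>-derivative of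
      \<open>s * sin \<theta> * (Z \<bullet> sph\<^sub>\<theta>)\<close>, which vanishes at both
      poles. \<open>b'\<close> is the \<phi>-derivative of
      \<open>s * (Z \<bullet> sph\<^sub>\<phi>)\<close>, which has period \<open>2 * pi\<close>. The
      sum of \<open>f'\<close>, \<open>a'\<close> and \<open>b'\<close> is
      \<open>s^2 * sin \<theta>\<close> times the divergence of \<open>Z\<close>.\<close>
    define a' where "a' \<theta> \<phi> = s * cos \<theta> * (Z (s *\<^sub>R sph \<theta> \<phi>) \<bullet> sph\<^sub>\<theta> \<theta> \<phi>)
       + s * sin \<theta> * (s * (D (s *\<^sub>R sph \<theta> \<phi>) (sph\<^sub>\<theta> \<theta> \<phi>) \<bullet> sph\<^sub>\<theta> \<theta> \<phi>) - Z (s *\<^sub>R sph \<theta> \<phi>) \<bullet> sph \<theta> \<phi>)" for \<theta> \<phi>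
    define b' where "b' \<theta> \<phi> = s * (s * sin \<theta> * (D (s *\<^sub>R sph \<theta> \<phi>) (sph\<^sub>\<phi> \<phi>) \<bullet> sph\<^sub>\<phi> \<phi>)
       - (sin \<theta> * (Z (s *\<^sub>R sph \<theta> \<phi>) \<bullet> sph \<theta> \<phi>) + cos \<theta> * (Z (s *\<^sub>R sph \<theta> \<phi>) \<bullet> sph\<^sub>\<theta> \<theta> \<phi>)))" for \<theta> \<phi>
    have conta: "continuous_on sphere_box (\<lambda>(\<theta>, \<phi>). a' \<theta> \<phi>)"
      unfolding a'_def split_beta using s by (intro continuous_intros contZ' contD) auto
    have contb: "continuous_on sphere_box (\<lambda>(\<theta>, \<phi>). b' \<theta> \<phi>)"
      unfolding b'_def split_beta using s by (intro continuous_intros contZ' contD) auto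
    have DZ: "((\<lambda>x. Z (s *\<^sub>R \<gamma> x)) has_vector_derivative s *\<^sub>R D (s *\<^sub>R \<gamma> x) v) (at x within T)"
      if "(\<gamma> has_vector_derivative v) (at x within T)" "\<gamma> x = sph \<theta> \<phi>" for \<gamma> :: "real \<Rightarrow> real^3" and x v T \<theta> \<phi>
    proof -
      have inb': "s *\<^sub>R \<gamma> x \<in> ball 0 R" using inb[OF s] that by simp
      have "((\<lambda>x. s *\<^sub>R \<gamma> x) has_derivative (\<lambda>h. s *\<^sub>R (h *\<^sub>R v))) (at x within T)"
        using that(1) unfolding has_vector_derivative_def by (auto intro!: derivative_eq_intros)
      from has_derivative_compose[OF this Z[OF inb']] show ?thesis
        unfolding has_vector_derivative_def
        by (simp add: linear_scale[OF lin[OF inb']] mult.commute)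
    qed
    have Ia: "integral sphere_box (\<lambda>(\<theta>, \<phi>). a' \<theta> \<phi>) = 0"
    proof -
      have "integral sphere_box (\<lambda>(\<theta>, \<phi>). a' \<theta> \<phi>) = integral (cbox 0 (2*pi)) (\<lambda>\<phi>. integral (cbox 0 pi) (\<lambda>\<theta>. a' \<theta> \<phi>))"
        using integral_prod_continuous[OF conta] integral_swap_continuous[OF conta] by simp
      also have "(\<lambda>\<phi>. integral (cbox 0 pi) (\<lambda>\<theta>. a' \<theta> \<phi>)) = (\<lambda>\<phi>. 0)"
      proof
        fix \<phi>
        define a where "a \<theta> = s * sin \<theta> * (Z (s *\<^sub>R sph \<theta> \<phi>) \<bullet> sph\<^sub>\<theta> \<theta> \<phi>)" for \<theta>
        have "((\<lambda>\<theta>. a' \<theta> \<phi>) has_integral (a pi - a 0)) {0..pi}"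
        proof (rule fundamental_theorem_of_calculus)
          fix \<theta> assume "\<theta> \<in> {0..pi}"
          have "((\<lambda>\<theta>. Z (s *\<^sub>R sph \<theta> \<phi>) \<bullet> sph\<^sub>\<theta> \<theta> \<phi>) has_vector_derivative
             (Z (s *\<^sub>R sph \<theta> \<phi>) \<bullet> (- sph \<theta> \<phi>) + (s *\<^sub>R D (s *\<^sub>R sph \<theta> \<phi>) (sph\<^sub>\<theta> \<theta> \<phi>)) \<bullet> sph\<^sub>\<theta> \<theta> \<phi>)) (at \<theta> within {0..pi})"
            by (rule bounded_bilinear.has_vector_derivative[OF bounded_bilinear_inner DZ[OF sph_has_derivative_theta refl] sph_theta_has_derivative])
          then have "((\<lambda>\<theta>. Z (s *\<^sub>R sph \<theta> \<phi>) \<bullet> sph\<^sub>\<theta> \<theta> \<phi>) has_field_derivative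
             (Z (s *\<^sub>R sph \<theta> \<phi>) \<bullet> (- sph \<theta> \<phi>) + (s *\<^sub>R D (s *\<^sub>R sph \<theta> \<phi>) (sph\<^sub>\<theta> \<theta> \<phi>)) \<bullet> sph\<^sub>\<theta> \<theta> \<phi>)) (at \<theta> within {0..pi})"
            by (simp add: has_real_derivative_iff_has_vector_derivative)
          then show "(a has_vector_derivative a' \<theta> \<phi>) (at \<theta> within {0..pi})"
            unfolding has_real_derivative_iff_has_vector_derivative[symmetric] a_def a'_def
            by (auto intro!: derivative_eq_intros simp: algebra_simps)
        qed simp
        then show "integral (cbox 0 pi) (\<lambda>\<theta>. a' \<theta> \<phi>) = 0" by (simp add: a_def integral_unique)
      qed
      finally show ?thesis by simp
    qed
    have Ib: "integral sphere_box (\<lambda>(\<theta>, \<phi>). b' \<theta> \<phi>) = 0"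
    proof -
      have "integral sphere_box (\<lambda>(\<theta>, \<phi>). b' \<theta> \<phi>) = integral (cbox 0 pi) (\<lambda>\<theta>. integral (cbox 0 (2*pi)) (\<lambda>\<phi>. b' \<theta> \<phi>))"
        using integral_prod_continuous[OF contb] by simp
      also have "(\<lambda>\<theta>. integral (cbox 0 (2*pi)) (\<lambda>\<phi>. b' \<theta> \<phi>)) = (\<lambda>\<theta>. 0)"
      proof
        fix \<theta>
        define b where "b \<phi> = s * (Z (s *\<^sub>R sph \<theta> \<phi>) \<bullet> sph\<^sub>\<phi> \<phi>)" for \<phi>
        have "((\<lambda>\<phi>. b' \<theta> \<phi>) has_integral (b (2*pi) - b 0)) {0..2*pi}"
        proof (rule fundamental_theorem_of_calculus)
          fix \<phi> assume "\<phi> \<in> {0..2*pi}"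
          have "((\<lambda>\<phi>. Z (s *\<^sub>R sph \<theta> \<phi>) \<bullet> sph\<^sub>\<phi> \<phi>) has_vector_derivative
             (Z (s *\<^sub>R sph \<theta> \<phi>) \<bullet> (- (sin \<theta> *\<^sub>R sph \<theta> \<phi> + cos \<theta> *\<^sub>R sph\<^sub>\<theta> \<theta> \<phi>)) + (s *\<^sub>R D (s *\<^sub>R sph \<theta> \<phi>) (sin \<theta> *\<^sub>R sph\<^sub>\<phi> \<phi>)) \<bullet> sph\<^sub>\<phi> \<phi>)) (at \<phi> within {0..2*pi})"
            by (rule bounded_bilinear.has_vector_derivative[OF bounded_bilinear_inner DZ[OF sph_has_derivative_phi refl] sph_phi_has_derivative])
          then have "((\<lambda>\<phi>. Z (s *\<^sub>R sph \<theta> \<phi>) \<bullet> sph\<^sub>\<phi> \<phi>) has_field_derivative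
             (Z (s *\<^sub>R sph \<theta> \<phi>) \<bullet> (- (sin \<theta> *\<^sub>R sph \<theta> \<phi> + cos \<theta> *\<^sub>R sph\<^sub>\<theta> \<theta> \<phi>)) + (s *\<^sub>R D (s *\<^sub>R sph \<theta> \<phi>) (sin \<theta> *\<^sub>R sph\<^sub>\<phi> \<phi>)) \<bullet> sph\<^sub>\<phi> \<phi>)) (at \<phi> within {0..2*pi})"
            by (simp add: has_real_derivative_iff_has_vector_derivative)
          then show "(b has_vector_derivative b' \<theta> \<phi>) (at \<phi> within {0..2*pi})"
            unfolding has_real_derivative_iff_has_vector_derivative[symmetric] b_def b'_def
            by (auto intro!: derivative_eq_intros simp: algebra_simps linear_scale[OF lin[OF inb[OF s]]] inner_add_right)
        qed simp
        then show "integral (cbox 0 (2*pi)) (\<lambda>\<phi>. b' \<theta> \<phi>) = 0" by (simp add: b_def integral_unique sph_def sph\<^sub>\<phi>_def)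
      qed
      finally show ?thesis by simp
    qed
    have "f' s t = - ((case t of (\<theta>, \<phi>) \<Rightarrow> a' \<theta> \<phi>) + (case t of (\<theta>, \<phi>) \<Rightarrow> b' \<theta> \<phi>))" for t
    proof -
      obtain \<theta> \<phi> where t: "t = (\<theta>, \<phi>)" by force
      let ?D = "D (s *\<^sub>R sph \<theta> \<phi>)"
      interpret F: orthonormal_frame "sph \<theta> \<phi>" "sph\<^sub>\<theta> \<theta> \<phi>" "sph\<^sub>\<phi> \<phi>" by (rule spherical_frame)
      have "?D (sph \<theta> \<phi>) \<bullet> sph \<theta> \<phi> + ?D (sph\<^sub>\<theta> \<theta> \<phi>) \<bullet> sph\<^sub>\<theta> \<theta> \<phi> + ?D (sph\<^sub>\<phi> \<phi>) \<bullet> sph\<^sub>\<phi> \<phi> = 0"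
        using F.trace_eq[OF lin[OF inb[OF s]]] div0[OF inb[OF s]] by simp
      then have *: "?D (sph \<theta> \<phi>) \<bullet> sph \<theta> \<phi> = - (?D (sph\<^sub>\<theta> \<theta> \<phi>) \<bullet> sph\<^sub>\<theta> \<theta> \<phi>) - ?D (sph\<^sub>\<phi> \<phi>) \<bullet> sph\<^sub>\<phi> \<phi>" by simp
      show ?thesis unfolding t f'_def a'_def b'_def prod.case * by (simp add: algebra_simps power2_eq_square)
    qed
    then have "f' s = (\<lambda>t. - ((case t of (\<theta>, \<phi>) \<Rightarrow> a' \<theta> \<phi>) + (case t of (\<theta>, \<phi>) \<Rightarrow> b' \<theta> \<phi>)))" by (rule ext)
    then have "integral sphere_box (f' s) = - (integral sphere_box (\<lambda>(\<theta>, \<phi>). a' \<theta> \<phi>) + integral sphere_box (\<lambda>(\<theta>, \<phi>). b' \<theta> \<phi>))"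
      by (simp only: integral_neg integral_add[OF integrable_continuous[OF conta] integrable_continuous[OF contb]])
    then show ?thesis using Ia Ib by simp
  qed
  have "\<exists>c. \<forall>s\<in>U. integral sphere_box (f s) = c"
    using deriv zero by (intro has_field_derivative_zero_constant) (auto simp: U_def)
  \<comment> \<open>The factor \<open>s^2\<close> makes the constant vanish at the centre, and for
    positive radius it can be cancelled again.\<close>
  then have "integral sphere_box (f r) = integral sphere_box (f 0)" using r by (force simp: U_def)
  also have "f 0 = (\<lambda>t. 0)" by (auto simp: f_def)
  finally have "integral sphere_box (f r) = 0" by simp
  moreover have "f r = (\<lambda>t. r^2 * (case t of (\<theta>, \<phi>) \<Rightarrow> (Z (r *\<^sub>R sph \<theta> \<phi>) \<bullet> sph \<theta> \<phi>) * sin \<theta>))"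
    by (auto simp: f_def)
  ultimately show ?thesis using r by simp
qed

end

text \<open>Gradient and Hessian are explicit data, so that transforms and parameter integrals of
  harmonic functions come with formulas for their gradients. The last clause is the Laplace equation
  as vanishing trace of the Hessian.\<close>

definition harmonic_with ::
  "'a::euclidean_space set \<Rightarrow> ('a \<Rightarrow> real) \<Rightarrow> ('a \<Rightarrow> 'a) \<Rightarrow> ('a \<Rightarrow> 'a \<Rightarrow> 'a) \<Rightarrow> bool" where
  "harmonic_with S u g H \<longleftrightarrow>
     (\<forall>y\<in>S. (u has_derivative (\<lambda>h. g y \<bullet> h)) (at y)) \<and>
     (\<forall>y\<in>S. (g has_derivative H y) (at y)) \<and>
     (\<forall>h. continuous_on S (\<lambda>y. H y h)) \<and>
     (\<forall>y\<in>S. (\<Sum>b\<in>Basis. H y b \<bullet> b) = 0)"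

section \<open>Mean value and first moment of a harmonic function over a sphere\<close>

context orthonormal_frame
begin

lemma sph_inner_e1: "sph \<theta> \<phi> \<bullet> e1 = cos \<theta>"
  by (simp add: sph_def inner_add_left unit orth')

lemma integral_sphere_box:
  fixes f :: "real \<Rightarrow> real \<Rightarrow> real"
  assumes "continuous_on sphere_box (\<lambda>(\<theta>, \<phi>). f \<theta> \<phi>)"
  shows "integral sphere_box (\<lambda>(\<theta>, \<phi>). f \<theta> \<phi>) = integral {0..pi} (\<lambda>\<theta>. integral {0..2*pi} (f \<theta>))"
  using integral_prod_continuous[OF assms] by (simp add: cbox_interval)

lemma integral_sin: "integral {0..pi} sin = (2::real)"
proof -
  have "(sin has_integral ((- cos pi) - (- cos 0))) {0..pi}"
    by (rule fundamental_theorem_of_calculus)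
       (auto intro!: derivative_eq_intros simp flip: has_real_derivative_iff_has_vector_derivative)
  then show ?thesis by (simp add: integral_unique)
qed

lemma integral_sin_sphere_box: "integral sphere_box (\<lambda>(\<theta>, \<phi>). sin \<theta>) = 4 * pi"
proof -
  have "integral sphere_box (\<lambda>(\<theta>, \<phi>). sin \<theta>) = integral {0..pi} (\<lambda>\<theta>. integral {0..2*pi} (\<lambda>\<phi>. sin \<theta>))"
    by (rule integral_sphere_box) (auto simp: split_beta intro!: continuous_intros)
  also have "\<dots> = integral {0..pi} (\<lambda>\<theta>. (2*pi) *\<^sub>R sin \<theta>)" by simp
  also have "\<dots> = 4 * pi" unfolding integral_cmul using integral_sin by simp
  finally show ?thesis .
qed

lemma integral_cos_sin_sphere_box: "integral sphere_box (\<lambda>(\<theta>, \<phi>). cos \<theta> * sin \<theta>) = 0"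
proof -
  have "((\<lambda>\<theta>. cos \<theta> * sin \<theta>) has_integral ((sin pi)^2 / 2 - (sin 0)^2 / 2)) {0..pi}"
    by (rule fundamental_theorem_of_calculus)
       (auto intro!: derivative_eq_intros simp flip: has_real_derivative_iff_has_vector_derivative)
  then have I: "integral {0..pi} (\<lambda>\<theta>. cos \<theta> * sin \<theta>) = (0::real)" by (simp add: integral_unique)
  have "integral sphere_box (\<lambda>(\<theta>, \<phi>). cos \<theta> * sin \<theta>) = integral {0..pi} (\<lambda>\<theta>. integral {0..2*pi} (\<lambda>\<phi>. cos \<theta> * sin \<theta>))"
    by (rule integral_sphere_box) (auto simp: split_beta intro!: continuous_intros)
  also have "\<dots> = integral {0..pi} (\<lambda>\<theta>. (2*pi) *\<^sub>R (cos \<theta> * sin \<theta>))"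
    by (rule integral_cong) simp
  also have "\<dots> = 0" unfolding integral_cmul using I by simp
  finally show ?thesis .
qed

lemma integral_inner_cos_sphere_box:
  "integral sphere_box (\<lambda>(\<theta>, \<phi>). (v \<bullet> sph \<theta> \<phi>) * cos \<theta> * sin \<theta>) = 4 * pi / 3 * (v \<bullet> e1)"
proof -
  have inner: "integral {0..2*pi} (\<lambda>\<phi>. (v \<bullet> sph \<theta> \<phi>) * cos \<theta> * sin \<theta>) = 2 * pi * (v \<bullet> e1) * ((cos \<theta>)^2 * sin \<theta>)" for \<theta>
  proof -
    define F where "F \<phi> = (\<phi> * cos \<theta> * (v \<bullet> e1) + sin \<theta> * (sin \<phi> * (v \<bullet> e2) - cos \<phi> * (v \<bullet> e3))) * cos \<theta> * sin \<theta>" for \<phi>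
    have "((\<lambda>\<phi>. (v \<bullet> sph \<theta> \<phi>) * cos \<theta> * sin \<theta>) has_integral (F (2*pi) - F 0)) {0..2*pi}"
      unfolding F_def
      by (rule fundamental_theorem_of_calculus)
         (auto intro!: derivative_eq_intros simp: sph_def inner_add_right algebra_simps simp flip: has_real_derivative_iff_has_vector_derivative)
    then have "integral {0..2*pi} (\<lambda>\<phi>. (v \<bullet> sph \<theta> \<phi>) * cos \<theta> * sin \<theta>) = F (2*pi) - F 0"
      by (rule integral_unique)
    also have "\<dots> = 2 * pi * (v \<bullet> e1) * ((cos \<theta>)^2 * sin \<theta>)"
      by (simp add: F_def power2_eq_square algebra_simps)
    finally show ?thesis .
  qed
  have "((\<lambda>\<theta>. (cos \<theta>)^2 * sin \<theta>) has_integral (- ((cos pi)^3) / 3 - - ((cos 0)^3) / 3)) {0..pi}"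
    by (rule fundamental_theorem_of_calculus)
       (auto intro!: derivative_eq_intros simp flip: has_real_derivative_iff_has_vector_derivative)
  then have I: "integral {0..pi} (\<lambda>\<theta>. (cos \<theta>)^2 * sin \<theta>) = (2/3::real)" by (simp add: integral_unique)
  have "integral sphere_box (\<lambda>(\<theta>, \<phi>). (v \<bullet> sph \<theta> \<phi>) * cos \<theta> * sin \<theta>)
      = integral {0..pi} (\<lambda>\<theta>. integral {0..2*pi} (\<lambda>\<phi>. (v \<bullet> sph \<theta> \<phi>) * cos \<theta> * sin \<theta>))"
    by (rule integral_sphere_box) (auto simp: split_beta intro!: continuous_intros)
  also have "\<dots> = integral {0..pi} (\<lambda>\<theta>. (2 * pi * (v \<bullet> e1)) *\<^sub>R ((cos \<theta>)^2 * sin \<theta>))" by (simp only: inner real_scaleR_def)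
  also have "\<dots> = 4 * pi / 3 * (v \<bullet> e1)" unfolding integral_cmul using I by simp
  finally show ?thesis .
qed

context
  fixes R r :: real and v :: "real^3 \<Rightarrow> real" and g :: "real^3 \<Rightarrow> real^3" and H
  assumes harm: "harmonic_with (ball 0 R) v g H" and r: "0 < r" "r < R"
begin

lemma harm_deriv: "y \<in> ball 0 R \<Longrightarrow> (v has_derivative (\<lambda>h. g y \<bullet> h)) (at y)"
  "y \<in> ball 0 R \<Longrightarrow> (g has_derivative H y) (at y)"
  using harm by (auto simp: harmonic_with_def)

lemma flux_gradient:
  "integral sphere_box (\<lambda>(\<theta>, \<phi>). (g (r *\<^sub>R sph \<theta> \<phi>) \<bullet> sph \<theta> \<phi>) * sin \<theta>) = 0"
  using harm r by (intro flux_eq_0[where D = H and R = R]) (auto simp: harmonic_with_def)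

text \<open>Green's second identity for \<open>v\<close> and the linear function
  \<open>y \<bullet> e1\<close>: since both are harmonic, the field
  \<open>(y \<bullet> e1) *\<^sub>R g y - v y *\<^sub>R e1\<close> is free of divergence.\<close>

lemma flux_first_moment:
  "integral sphere_box (\<lambda>(\<theta>, \<phi>). (r * cos \<theta> * (g (r *\<^sub>R sph \<theta> \<phi>) \<bullet> sph \<theta> \<phi>) - v (r *\<^sub>R sph \<theta> \<phi>) * cos \<theta>) * sin \<theta>) = 0"
proof -
  have contg: "continuous_on (ball 0 R) g"
    using harm_deriv(2) by (meson continuous_at_imp_continuous_on has_derivative_continuous)
  have "integral sphere_box (\<lambda>(\<theta>, \<phi>). (((r *\<^sub>R sph \<theta> \<phi> \<bullet> e1) *\<^sub>R g (r *\<^sub>R sph \<theta> \<phi>) - v (r *\<^sub>R sph \<theta> \<phi>) *\<^sub>R e1) \<bullet> sph \<theta> \<phi>) * sin \<theta>) = 0"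
  proof (rule flux_eq_0[where Z = "\<lambda>y. (y \<bullet> e1) *\<^sub>R g y - v y *\<^sub>R e1" and
        D = "\<lambda>y h. (h \<bullet> e1) *\<^sub>R g y + (y \<bullet> e1) *\<^sub>R H y h - (g y \<bullet> h) *\<^sub>R e1", OF _ _ _ r])
    fix y :: "real^3" assume y: "y \<in> ball 0 R"
    show "((\<lambda>y. (y \<bullet> e1) *\<^sub>R g y - v y *\<^sub>R e1) has_derivative
        (\<lambda>h. (h \<bullet> e1) *\<^sub>R g y + (y \<bullet> e1) *\<^sub>R H y h - (g y \<bullet> h) *\<^sub>R e1)) (at y)"
      by (auto intro!: derivative_eq_intros harm_deriv[OF y] simp: fun_eq_iff)
    have "(\<Sum>b\<in>Basis. ((b \<bullet> e1) *\<^sub>R g y + (y \<bullet> e1) *\<^sub>R H y b - (g y \<bullet> b) *\<^sub>R e1) \<bullet> b)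
        = (\<Sum>b\<in>Basis. (e1 \<bullet> b) * (g y \<bullet> b)) + (y \<bullet> e1) * (\<Sum>b\<in>Basis. H y b \<bullet> b) - (\<Sum>b\<in>Basis. (g y \<bullet> b) * (e1 \<bullet> b))"
      by (simp add: inner_add_left inner_diff_left sum.distrib sum_subtractf sum_distrib_left inner_commute[of e1] mult.commute)
    then show "(\<Sum>b\<in>Basis. ((b \<bullet> e1) *\<^sub>R g y + (y \<bullet> e1) *\<^sub>R H y b - (g y \<bullet> b) *\<^sub>R e1) \<bullet> b) = 0"
      using harm y by (simp add: harmonic_with_def mult.commute)
  next
    fix h
    show "continuous_on (ball 0 R) (\<lambda>y. (h \<bullet> e1) *\<^sub>R g y + (y \<bullet> e1) *\<^sub>R H y h - (g y \<bullet> h) *\<^sub>R e1)"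
      using harm by (intro continuous_intros contg) (auto simp: harmonic_with_def)
  qed
  then show ?thesis
    by (simp add: inner_diff_left sph_inner_e1 inner_commute[of e1] mult.commute mult.left_commute)
qed

end

text \<open>The derivative of a weighted mean in the radius is a flux. For weight 1 it vanishes, so
  the mean keeps its value at radius 0. For weight \<open>cos\<close> the flux identity reads
  \<open>s * M' = M\<close>, so \<open>M / s\<close> is constant and equals its limit at 0, which is
  the derivative there.\<close>

theorem
  fixes R r :: real and v :: "real^3 \<Rightarrow> real" and g :: "real^3 \<Rightarrow> real^3"
  assumes harm: "harmonic_with (ball 0 R) v g H" and r: "0 < r" "r < R"
  shows sphere_mean: "integral sphere_box (\<lambda>(\<theta>, \<phi>). v (r *\<^sub>R sph \<theta> \<phi>) * sin \<theta>) = 4 * pi * v 0"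
    and sphere_first_moment: "integral sphere_box (\<lambda>(\<theta>, \<phi>). v (r *\<^sub>R sph \<theta> \<phi>) * cos \<theta> * sin \<theta>) = 4 * pi / 3 * r * (g 0 \<bullet> e1)"
proof -
  define U where "U = {0..r}"
  have inb: "s *\<^sub>R sph \<theta> \<phi> \<in> ball 0 R" if "s \<in> U" for s \<theta> \<phi>
    using that r by (auto simp: U_def)
  have contv: "continuous_on (ball 0 R) v" and contg: "continuous_on (ball 0 R) g"
    using harm_deriv[OF harm r] by (meson continuous_at_imp_continuous_on has_derivative_continuous)+
  have contv': "continuous_on T (\<lambda>t. v (f t *\<^sub>R sph (k t) (l t)))" "continuous_on T (\<lambda>t. g (f t *\<^sub>R sph (k t) (l t)))"
    if "continuous_on T f" "continuous_on T k" "continuous_on T l" "f ` T \<subseteq> U" for T :: "'x::t2_space set" and f k l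
    using that inb by (auto intro!: continuous_on_compose2[OF contv] continuous_on_compose2[OF contg] continuous_intros)
  define M where "M w s = integral sphere_box (\<lambda>(\<theta>, \<phi>). v (s *\<^sub>R sph \<theta> \<phi>) * w \<theta> * sin \<theta>)" for w s
  define M' where "M' w s = integral sphere_box (\<lambda>(\<theta>, \<phi>). (g (s *\<^sub>R sph \<theta> \<phi>) \<bullet> sph \<theta> \<phi>) * w \<theta> * sin \<theta>)" for w s
  have deriv: "(M w has_field_derivative M' w s) (at s within U)"
    if s: "s \<in> U" and w: "continuous_on UNIV w" for s and w :: "real \<Rightarrow> real"
    unfolding M_def M'_def
  proof (rule leibniz_rule_field_derivative[OF _ _ _ s])
    have w': "continuous_on S (\<lambda>x. w (f x))" if "continuous_on S f" for S :: "'x::t2_space set" and f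
      using continuous_on_compose2[OF w that] by auto
    show "continuous_on (U \<times> sphere_box) (\<lambda>(s, t). case t of (\<theta>, \<phi>) \<Rightarrow> (g (s *\<^sub>R sph \<theta> \<phi>) \<bullet> sph \<theta> \<phi>) * w \<theta> * sin \<theta>)"
      unfolding split_beta by (intro continuous_intros contv' w') auto
    fix s assume s: "s \<in> U"
    show "(\<lambda>(\<theta>, \<phi>). v (s *\<^sub>R sph \<theta> \<phi>) * w \<theta> * sin \<theta>) integrable_on sphere_box"
      unfolding split_beta using s by (intro integrable_continuous continuous_intros contv' w') auto
    fix t :: "real \<times> real"
    obtain \<theta> \<phi> where t: "t = (\<theta>, \<phi>)" by force
    have "((\<lambda>s. s *\<^sub>R sph \<theta> \<phi>) has_derivative (\<lambda>h. h *\<^sub>R sph \<theta> \<phi>)) (at s within U)"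
      by (auto intro!: derivative_eq_intros)
    from has_derivative_compose[OF this harm_deriv(1)[OF harm r inb[OF s]]]
    have "((\<lambda>s. v (s *\<^sub>R sph \<theta> \<phi>)) has_derivative (\<lambda>h. g (s *\<^sub>R sph \<theta> \<phi>) \<bullet> (h *\<^sub>R sph \<theta> \<phi>))) (at s within U)" .
    then have "((\<lambda>s. v (s *\<^sub>R sph \<theta> \<phi>)) has_field_derivative g (s *\<^sub>R sph \<theta> \<phi>) \<bullet> sph \<theta> \<phi>) (at s within U)"
      by (simp add: has_field_derivative_def mult_commute_abs)
    then show "((\<lambda>s. case t of (\<theta>, \<phi>) \<Rightarrow> v (s *\<^sub>R sph \<theta> \<phi>) * w \<theta> * sin \<theta>) has_field_derivative
       (case t of (\<theta>, \<phi>) \<Rightarrow> (g (s *\<^sub>R sph \<theta> \<phi>) \<bullet> sph \<theta> \<phi>) * w \<theta> * sin \<theta>)) (at s within U)"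
      unfolding t prod.case by (auto intro!: derivative_eq_intros)
  qed (simp add: U_def)
  have at: "at s within U = at s" if "0 < s" "s < r" for s
    using that by (intro at_within_interior) (auto simp: U_def)
  have cont_M: "continuous_on U (M w)" if "continuous_on UNIV w" for w
    using deriv[OF _ that] by (meson DERIV_continuous continuous_on_eq_continuous_within)
  have "M (\<lambda>_. 1) r = M (\<lambda>_. 1) 0"
  proof (rule DERIV_isconst_end[where f = "M (\<lambda>_. 1)" and a = 0 and b = r])
    show "continuous_on {0..r} (M (\<lambda>_. 1))" using cont_M by (simp add: U_def)
    fix s assume s: "0 < s" "s < r"
    have "M' (\<lambda>_. 1) s = 0" using flux_gradient[OF harm, of s] s r by (simp add: M'_def)
    then show "(M (\<lambda>_. 1) has_field_derivative 0) (at s)"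
      using deriv[of s "\<lambda>_. 1"] s at[OF s] by (simp add: U_def)
  qed (rule r)
  also have "\<dots> = 4 * pi * v 0"
    using integral_mult_right[of sphere_box "v 0" "\<lambda>t. sin (fst t)"] integral_sin_sphere_box
    unfolding M_def case_prod_unfold by simp
  finally show "integral sphere_box (\<lambda>(\<theta>, \<phi>). v (r *\<^sub>R sph \<theta> \<phi>) * sin \<theta>) = 4 * pi * v 0"
    by (simp add: M_def)
  have M0: "M cos 0 = 0"
    using integral_mult_right[of sphere_box "v 0" "\<lambda>t. cos (fst t) * sin (fst t)"] integral_cos_sin_sphere_box
    unfolding M_def case_prod_unfold by (simp add: mult.assoc)
  have cc: "continuous_on UNIV (cos :: real \<Rightarrow> real)" by (intro continuous_intros)
  have ratio: "M cos s / s = M cos r / r" if s: "0 < s" "s < r" for s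
  proof (rule DERIV_isconst_end[where f = "\<lambda>s. M cos s / s" and a = s and b = r, symmetric])
    show "continuous_on {s..r} (\<lambda>s. M cos s / s)"
      using s by (intro continuous_intros continuous_on_subset[OF cont_M[OF cc]]) (auto simp: U_def)
    fix x assume x: "s < x" "x < r"
    have "x * M' cos x = M cos x"
    proof -
      have c1: "continuous_on sphere_box (\<lambda>(\<theta>, \<phi>). x * ((g (x *\<^sub>R sph \<theta> \<phi>) \<bullet> sph \<theta> \<phi>) * cos \<theta> * sin \<theta>))"
        unfolding split_beta using x s by (intro continuous_intros contv') (auto simp: U_def)
      have c2: "continuous_on sphere_box (\<lambda>(\<theta>, \<phi>). v (x *\<^sub>R sph \<theta> \<phi>) * cos \<theta> * sin \<theta>)"
        unfolding split_beta using x s by (intro continuous_intros contv') (auto simp: U_def)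
      have "x * M' cos x - M cos x = integral sphere_box (\<lambda>t. (case t of (\<theta>, \<phi>) \<Rightarrow> x * ((g (x *\<^sub>R sph \<theta> \<phi>) \<bullet> sph \<theta> \<phi>) * cos \<theta> * sin \<theta>)) - (case t of (\<theta>, \<phi>) \<Rightarrow> v (x *\<^sub>R sph \<theta> \<phi>) * cos \<theta> * sin \<theta>))"
        unfolding integral_diff[OF integrable_continuous[OF c1] integrable_continuous[OF c2]] M_def M'_def
        unfolding case_prod_unfold by simp
      also have "\<dots> = integral sphere_box (\<lambda>(\<theta>, \<phi>). (x * cos \<theta> * (g (x *\<^sub>R sph \<theta> \<phi>) \<bullet> sph \<theta> \<phi>) - v (x *\<^sub>R sph \<theta> \<phi>) * cos \<theta>) * sin \<theta>)"
        by (rule integral_cong) (auto simp: algebra_simps)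
      also have "\<dots> = 0" using flux_first_moment[OF harm, of x] x s r by simp
      finally show ?thesis by simp
    qed
    moreover have "(M cos has_field_derivative M' cos x) (at x)"
      using deriv[OF _ cc, of x] x s at[of x] by (simp add: U_def)
    ultimately have "((\<lambda>s. M cos s / s) has_field_derivative (M' cos x * x - M cos x * 1) / (x * x)) (at x)"
      using x s by (intro DERIV_divide DERIV_ident) auto
    moreover have "M' cos x * x - M cos x * 1 = 0" using \<open>x * M' cos x = M cos x\<close> by (simp add: mult.commute)
    ultimately show "((\<lambda>s. M cos s / s) has_field_derivative 0) (at x)" by simp
  qed (rule s)
  \<comment> \<open>As \<open>M cos 0 = 0\<close>, the quotient \<open>M cos s / s\<close> is the
    one-sided difference quotient of \<open>M cos\<close> at 0.\<close>
  have "((\<lambda>s. M cos s / s) \<longlongrightarrow> M' cos 0) (at 0 within U)"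
    using deriv[OF _ cc, of 0] r unfolding has_field_derivative_iff by (simp add: M0 U_def)
  moreover have "eventually (\<lambda>s. M cos s / s = M cos r / r) (at 0 within U)"
    unfolding eventually_at by (rule exI[of _ r]) (use r ratio in \<open>auto simp: U_def\<close>)
  ultimately have "((\<lambda>s. M cos r / r) \<longlongrightarrow> M' cos 0) (at 0 within U)"
    by (rule Lim_transform_eventually)
  moreover have "at 0 within U \<noteq> bot"
    using at_within_Icc_at_right[of 0 r] r trivial_limit_at_right_real[of "0::real"] by (simp add: U_def)
  ultimately have "M' cos 0 = M cos r / r"
    by (intro tendsto_unique[OF _ _ tendsto_const])
  moreover have "M' cos 0 = 4 * pi / 3 * (g 0 \<bullet> e1)"
    using integral_inner_cos_sphere_box[of "g 0"] by (simp add: M'_def)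
  ultimately have "M cos r = r * (4 * pi / 3 * (g 0 \<bullet> e1))"
    using r by (simp add: field_simps)
  then show "integral sphere_box (\<lambda>(\<theta>, \<phi>). v (r *\<^sub>R sph \<theta> \<phi>) * cos \<theta> * sin \<theta>) = 4 * pi / 3 * r * (g 0 \<bullet> e1)"
    by (simp add: M_def mult.commute mult.left_commute)
qed

end

section \<open>The Kelvin transform\<close>

lemma trace_rank_one:
  fixes L :: "'a::euclidean_space \<Rightarrow> real"
  assumes "linear L"
  shows "(\<Sum>b\<in>Basis. (L b *\<^sub>R a) \<bullet> b) = L a"
proof -
  have "L a = L (\<Sum>b\<in>Basis. (a \<bullet> b) *\<^sub>R b)" by (simp add: euclidean_representation)
  also have "\<dots> = (\<Sum>b\<in>Basis. (a \<bullet> b) * L b)" using assms by (simp add: linear_sum linear_scale)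
  finally show ?thesis by (simp add: mult.commute)
qed

lemma has_derivative_inverse_norm:
  fixes z p :: "'a::real_inner"
  assumes "z \<noteq> p"
  shows "((\<lambda>z. inverse (norm (z - p))) has_derivative (\<lambda>h. - ((inverse (norm (z - p)))^3) * ((z - p) \<bullet> h))) (at z)"
proof -
  have "((\<lambda>z. z - p) has_derivative (\<lambda>h. h)) (at z)" by (auto intro!: derivative_eq_intros)
  from has_derivative_compose[OF this has_derivative_norm]
  have "((\<lambda>z. norm (z - p)) has_derivative (\<lambda>h. sgn (z - p) \<bullet> h)) (at z)"
    using assms by (simp add: inner_commute)
  then have "((\<lambda>z. inverse (norm (z - p))) has_derivative (\<lambda>h. - (inverse (norm (z - p)) * (sgn (z - p) \<bullet> h) * inverse (norm (z - p))))) (at z)"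
    using assms by (intro Deriv.has_derivative_inverse) auto
  moreover have "- (inverse (norm (z - p)) * (sgn (z - p) \<bullet> h) * inverse (norm (z - p))) = - ((inverse (norm (z - p)))^3) * ((z - p) \<bullet> h)" for h
    by (simp add: sgn_div_norm power3_eq_cube)
  ultimately show ?thesis by simp
qed

text \<open>\<open>T\<close> is the inversion with centre \<open>p\<close> and power
  \<open>k\<close>; in dimension 3 the conformal factor is the first power of the inverse distance.
  The gradient is spelled out because its value at the origin carries the gradient of
  \<open>u\<close> at \<open>T 0\<close>.\<close>

theorem kelvin_transform:
  fixes u :: "real^3 \<Rightarrow> real" and p :: "real^3" and k :: real
  assumes harm: "harmonic_with S u g H" and S': "open S'" "p \<notin> S'"
  defines "T \<equiv> \<lambda>z. p + (k / (norm (z - p))^2) *\<^sub>R (z - p)"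
  assumes maps: "\<And>z. z \<in> S' \<Longrightarrow> T z \<in> S"
  shows "\<exists>H'. harmonic_with S' (\<lambda>z. u (T z) / norm (z - p))
     (\<lambda>z. (k / norm (z - p)^3) *\<^sub>R g (T z)
        - (2 * k * (g (T z) \<bullet> (z - p)) / norm (z - p)^5 + u (T z) / norm (z - p)^3) *\<^sub>R (z - p)) H'"
proof -
  \<comment> \<open>All derivatives are polynomials in \<open>q\<close>, and the only relation
    needed among them is that \<open>q^2\<close> times the squared norm of \<open>z - p\<close> is
    1.\<close>
  define q where "q z = inverse (norm (z - p))" for z
  have np: "z \<noteq> p" if "z \<in> S'" for z using S'(2) that by auto
  have q1: "q z * q z * ((z - p) \<bullet> (z - p)) = 1" if "z \<in> S'" for z
    using np[OF that] by (simp add: q_def field_simps flip: power2_norm_eq_inner power2_eq_square)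
  have T_eq: "T z = p + (k * (q z)^2) *\<^sub>R (z - p)" for z
    by (simp add: T_def q_def power_inverse divide_inverse)
  \<comment> \<open>\<open>k * q^2\<close> times the reflection in the plane orthogonal to
    \<open>z - p\<close>; an inversion is conformal.\<close>
  define T' where "T' z h = (k * (q z)^2) *\<^sub>R h - (2 * k * (q z)^4 * ((z - p) \<bullet> h)) *\<^sub>R (z - p)" for z h
  have linT': "linear (T' z)" for z
    by (rule linearI) (simp_all add: T'_def algebra_simps inner_add_right scaleR_add_left)
  have dq: "(q has_derivative (\<lambda>h. - ((q z)^3) * ((z - p) \<bullet> h))) (at z)" if "z \<in> S'" for z
    unfolding q_def using has_derivative_inverse_norm[OF np[OF that]] .
  have dT: "(T has_derivative T' z) (at z)" if "z \<in> S'" for z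
    unfolding T_eq[abs_def] T'_def[abs_def]
    by (rule derivative_eq_intros dq[OF that] refl | simp)+
       (simp add: fun_eq_iff algebra_simps power2_eq_square power3_eq_cube power4_eq_xxxx)
  have u': "(u has_derivative (\<lambda>h. g y \<bullet> h)) (at y)" and g': "(g has_derivative H y) (at y)"
    and linH: "linear (H y)" and trH: "(\<Sum>b\<in>Basis. H y b \<bullet> b) = 0"
    if "y \<in> S" for y
    using harm that unfolding harmonic_with_def by (auto dest: has_derivative_linear)
  have duT: "((\<lambda>z. u (T z)) has_derivative (\<lambda>h. g (T z) \<bullet> T' z h)) (at z)" if "z \<in> S'" for z
    by (rule has_derivative_compose[OF dT[OF that] u'[OF maps[OF that]]])
  have dgT: "((\<lambda>z. g (T z)) has_derivative (\<lambda>h. H (T z) (T' z h))) (at z)" if "z \<in> S'" for z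
    by (rule has_derivative_compose[OF dT[OF that] g'[OF maps[OF that]]])
  define A where "A z h = - 3 * k * (q z)^5 * ((z - p) \<bullet> h)" for z h
  define B where "B z h = 2 * k * (5 * (q z)^7 * ((z - p) \<bullet> h) * (g (T z) \<bullet> (z - p))
        - (q z)^5 * (H (T z) (T' z h) \<bullet> (z - p) + g (T z) \<bullet> h))
        + 3 * (q z)^5 * ((z - p) \<bullet> h) * u (T z) - (q z)^3 * (g (T z) \<bullet> T' z h)" for z h
  define c where "c z = - (2 * k * (q z)^5 * (g (T z) \<bullet> (z - p)) + (q z)^3 * u (T z))" for z
  define H' where "H' z h = A z h *\<^sub>R g (T z) + (k * (q z)^3) *\<^sub>R H (T z) (T' z h) + B z h *\<^sub>R (z - p) + c z *\<^sub>R h" for z h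
  define G where "G z = (k * (q z)^3) *\<^sub>R g (T z) + c z *\<^sub>R (z - p)" for z
  have "((\<lambda>z. q z * u (T z)) has_derivative (\<lambda>h. G z \<bullet> h)) (at z)" if z: "z \<in> S'" for z
  proof -
    have "((\<lambda>z. q z * u (T z)) has_derivative (\<lambda>h. q z * (g (T z) \<bullet> T' z h) + - ((q z)^3) * ((z - p) \<bullet> h) * u (T z))) (at z)"
      by (rule has_derivative_mult[OF dq[OF z] duT[OF z]])
    moreover have "q z * (g (T z) \<bullet> T' z h) + - ((q z)^3) * ((z - p) \<bullet> h) * u (T z) = G z \<bullet> h" for h
      unfolding G_def c_def T'_def
      by (simp add: inner_add_left inner_diff_right algebra_simps power2_eq_square power3_eq_cube eval_nat_numeral)
    ultimately show ?thesis by simp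
  qed
  moreover have "(G has_derivative H' z) (at z)" if z: "z \<in> S'" for z
  proof -
    have dw: "((\<lambda>z. z - p) has_derivative (\<lambda>h. h)) (at z)" by (auto intro!: derivative_eq_intros)
    have d3: "((\<lambda>z. (q z)^3) has_derivative (\<lambda>h. - 3 * (q z)^5 * ((z - p) \<bullet> h))) (at z)"
      by (rule derivative_eq_intros dq[OF z] refl)+ (simp add: fun_eq_iff eval_nat_numeral algebra_simps)
    have d5: "((\<lambda>z. (q z)^5) has_derivative (\<lambda>h. - 5 * (q z)^7 * ((z - p) \<bullet> h))) (at z)"
      by (rule derivative_eq_intros dq[OF z] refl)+ (simp add: fun_eq_iff eval_nat_numeral algebra_simps)
    show ?thesis
      unfolding G_def[abs_def] c_def
      by (rule derivative_eq_intros d3 d5 dw dgT[OF z] duT[OF z] refl)+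
         (simp add: fun_eq_iff H'_def A_def B_def c_def algebra_simps inner_commute)
  qed
  moreover have "continuous_on S' (\<lambda>z. H' z h)" for h
  proof -
    have cq: "continuous_on S' q" unfolding q_def[abs_def] using np by (intro continuous_intros) auto
    have cT: "continuous_on S' T" using dT by (meson continuous_at_imp_continuous_on has_derivative_continuous)
    have cu: "continuous_on S' (\<lambda>z. u (T z))" using duT by (meson continuous_at_imp_continuous_on has_derivative_continuous)
    have cg: "continuous_on S' (\<lambda>z. g (T z))" using dgT by (meson continuous_at_imp_continuous_on has_derivative_continuous)
    have cT': "continuous_on S' (\<lambda>z. T' z h)" unfolding T'_def by (intro continuous_intros cq)
    have "continuous_on S' (\<lambda>z. H (T z) (T' z h))"
    proof (rule blinear_continuous_on[where S = S and D = H])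
      show "continuous_on S (\<lambda>y. H y h)" for h using harm by (simp add: harmonic_with_def)
      show "T ` S' \<subseteq> S" using maps by auto
    qed (use linH cT cT' in auto)
    then show ?thesis unfolding H'_def A_def B_def c_def
      by (intro continuous_intros cq cu cg cT')
  qed
  moreover have "(\<Sum>b\<in>Basis. H' z b \<bullet> b) = 0" if z: "z \<in> S'" for z
  proof -
    let ?w = "z - p" and ?H = "H (T z)"
    note lH = linH[OF maps[OF z]]
    have linA: "linear (A z)" by (rule linearI) (simp_all add: A_def inner_add_right algebra_simps)
    have linB: "linear (B z)"
      by (rule linearI)
         (simp_all add: B_def linear_add[OF linT'] linear_scale[OF linT'] linear_add[OF lH] linear_scale[OF lH]
           inner_add_right inner_add_left algebra_simps)
    have qw: "(q z)^2 * (?w \<bullet> ?w) = 1" using q1[OF z] by (simp add: power2_eq_square)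
    have T'w: "T' z ?w = (- k * (q z)^2) *\<^sub>R ?w"
    proof -
      have "2 * k * (q z)^4 * (?w \<bullet> ?w) = 2 * k * (q z)^2 * ((q z)^2 * (?w \<bullet> ?w))"
        by (simp add: power2_eq_square power4_eq_xxxx)
      also have "\<dots> = 2 * k * (q z)^2" unfolding qw by simp
      finally have *: "2 * k * (q z)^4 * (?w \<bullet> ?w) = 2 * k * (q z)^2" .
      have "k * (q z)^2 - 2 * k * (q z)^2 = - k * (q z)^2" by simp
      then show ?thesis unfolding T'_def * scaleR_diff_left[symmetric] by (rule arg_cong)
    qed
    \<comment> \<open>The multiple of the identity in \<open>T'\<close> contributes a multiple of
      the trace of the Hessian, hence nothing; only the rank one part of the reflection
      remains.\<close>
    have trHT: "(\<Sum>b\<in>Basis. ?H (T' z b) \<bullet> b) = - 2 * k * (q z)^4 * (?H ?w \<bullet> ?w)"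
    proof -
      have "?H (T' z b) \<bullet> b = (k * (q z)^2) * (?H b \<bullet> b) - ((2 * k * (q z)^4 * (?w \<bullet> b)) *\<^sub>R ?H ?w) \<bullet> b" for b
        by (simp add: T'_def linear_diff[OF lH] linear_scale[OF lH] inner_diff_left)
      then have "(\<Sum>b\<in>Basis. ?H (T' z b) \<bullet> b) = (k * (q z)^2) * (\<Sum>b\<in>Basis. ?H b \<bullet> b)
          - (\<Sum>b\<in>Basis. ((2 * k * (q z)^4 * (?w \<bullet> b)) *\<^sub>R ?H ?w) \<bullet> b)"
        by (simp only: sum_subtractf sum_distrib_left)
      also have "(\<Sum>b\<in>Basis. ((2 * k * (q z)^4 * (?w \<bullet> b)) *\<^sub>R ?H ?w) \<bullet> b) = 2 * k * (q z)^4 * (?w \<bullet> ?H ?w)"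
        by (rule trace_rank_one[of "\<lambda>b. 2 * k * (q z)^4 * (?w \<bullet> b)"], rule linearI)
           (simp_all add: inner_add_right algebra_simps)
      finally show ?thesis using trH[OF maps[OF z]] by (simp add: inner_commute)
    qed
    have Hw: "?H (T' z ?w) \<bullet> ?w = - k * (q z)^2 * (?H ?w \<bullet> ?w)"
      and gw: "g (T z) \<bullet> T' z ?w = - k * (q z)^2 * (g (T z) \<bullet> ?w)"
      by (simp_all only: T'w linear_scale[OF lH] inner_scaleR_left inner_scaleR_right)
    have "(\<Sum>b\<in>Basis. H' z b \<bullet> b) = (\<Sum>b\<in>Basis. (A z b *\<^sub>R g (T z)) \<bullet> b) + (k * (q z)^3) * (\<Sum>b\<in>Basis. ?H (T' z b) \<bullet> b)
        + (\<Sum>b\<in>Basis. (B z b *\<^sub>R ?w) \<bullet> b) + c z * (\<Sum>b\<in>(Basis :: (real^3) set). b \<bullet> b)"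
      by (simp add: H'_def inner_add_left sum.distrib sum_distrib_left)
    also have "(\<Sum>b\<in>(Basis :: (real^3) set). b \<bullet> b) = 3"
      by (simp add: inner_Basis)
    also have "(\<Sum>b\<in>Basis. (A z b *\<^sub>R g (T z)) \<bullet> b) = A z (g (T z))" by (rule trace_rank_one[OF linA])
    also have "(\<Sum>b\<in>Basis. (B z b *\<^sub>R ?w) \<bullet> b) = B z ?w" by (rule trace_rank_one[OF linB])
    also have "B z ?w = 10 * k * (q z)^5 * ((q z)^2 * (?w \<bullet> ?w)) * (g (T z) \<bullet> ?w)
        + 2 * k^2 * (q z)^7 * (?H ?w \<bullet> ?w) - 2 * k * (q z)^5 * (g (T z) \<bullet> ?w)
        + 3 * (q z)^3 * ((q z)^2 * (?w \<bullet> ?w)) * u (T z) + k * (q z)^5 * (g (T z) \<bullet> ?w)"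
      unfolding B_def Hw gw by algebra
    \<comment> \<open>The coefficients cancel by type: -3 + 9 - 6 for the gradient terms, -2 + 2 for
      the Hessian terms, 3 - 3 for the terms in \<open>u\<close>. The numbers -6 and -3 contain the
      dimension as the trace of the identity.\<close>
    finally show ?thesis unfolding trHT A_def c_def qw
      by (simp add: algebra_simps inner_commute eval_nat_numeral)
  qed
  ultimately have "harmonic_with S' (\<lambda>z. q z * u (T z)) G H'"
    by (auto simp: harmonic_with_def)
  moreover have "(\<lambda>z. q z * u (T z)) = (\<lambda>z. u (T z) / norm (z - p))"
    by (simp add: q_def divide_inverse mult.commute)
  moreover have "G = (\<lambda>z. (k / norm (z - p)^3) *\<^sub>R g (T z)
        - (2 * k * (g (T z) \<bullet> (z - p)) / norm (z - p)^5 + u (T z) / norm (z - p)^3) *\<^sub>R (z - p))"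
    unfolding G_def[abs_def] c_def q_def scaleR_minus_left
    by (simp add: divide_inverse power_inverse mult.commute mult.left_commute)
  ultimately show ?thesis by metis
qed

section \<open>The maximality of the radial direction\<close>

text \<open>
  \<open>capint a X Y\<close> is the integral of \<open>3 * (s + a) / sqrt (l s)\<close> for \<open>s\<close> in \<open>{-a..1}\<close>, where \<open>l\<close> is linear
  with \<open>l (-a) = Y^2\<close> and \<open>l 1 = X^2\<close>.
\<close>

definition capint :: "real \<Rightarrow> real \<Rightarrow> real \<Rightarrow> real" where
  "capint a X Y = 2 * (1 + a)^2 * (X + 2 * Y) / (X + Y)^2"

text \<open>\<open>(X + 2 * Y) / (X + Y)^2\<close> decreases in \<open>Y\<close>, so the square root
  in the last argument of \<open>capint\<close> can be traded for a simpler lower bound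
  \<open>y\<close>.\<close>

lemma capint_le:
  assumes "X > 0" "0 \<le> y" "y \<le> Y" "2 * (1 + a)^2 * (X + 2 * y) \<le> K * (X + y)^2"
  shows "capint a X Y \<le> K"
proof -
  have "(X + 2 * Y) * (X + y)^2 \<le> (X + 2 * y) * (X + Y)^2"
  proof -
    have "(X + 2 * y) * (X + Y)^2 - (X + 2 * Y) * (X + y)^2 = X * (Y^2 - y^2) + 2 * y * Y * (Y - y)"
      by (simp add: algebra_simps power2_eq_square)
    moreover have "X * (Y^2 - y^2) \<ge> 0" using assms by (simp add: power_mono)
    moreover have "2 * y * Y * (Y - y) \<ge> 0" using assms by simp
    ultimately show ?thesis by linarith
  qed
  then have "(X + 2 * Y) / (X + Y)^2 \<le> (X + 2 * y) / (X + y)^2"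
    using assms by (simp add: divide_simps)
  then have "2 * (1 + a)^2 * ((X + 2 * Y) / (X + Y)^2) \<le> 2 * (1 + a)^2 * ((X + 2 * y) / (X + y)^2)"
    by (rule mult_left_mono) simp
  also have "\<dots> \<le> K" using assms by (simp add: divide_simps)
  finally show ?thesis by (simp add: capint_def)
qed

text \<open>
  With \<open>X = sqrt (1 + \<sigma>^2 + 2 * \<sigma> * c)\<close>, where \<open>\<sigma>\<close> is the norm of the point and \<open>c\<close> the cosine of the
  angle between point and direction, the parameters are \<open>p = X - 1\<close>, \<open>d = \<sigma>^2 - p^2\<close> and
  \<open>y = sqrt (1 + \<sigma>^2 / 3) - 1\<close>. All quantities become polynomials in them and \<open>d = 0\<close> is the radial case;
  the differences below are divisible by \<open>d\<close> modulo \<open>yrel\<close>, with a cofactor found by polynomial division.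
\<close>

locale extremal_parameters =
  fixes p d y :: real
  assumes p0: "0 \<le> p" and d0: "0 \<le> d" and dp: "d \<le> 2 * p" and pd: "p^2 + d \<le> 1"
    and y0: "0 \<le> y" and yrel: "3 * (y^2 + 2 * y) = p^2 + d"
begin

lemma p1: "p \<le> 1"
proof -
  have "p^2 \<le> 1^2" using pd d0 by simp
  then show ?thesis using p0 by (rule_tac power2_le_imp_le) auto
qed

lemma y_upper: "y \<le> 1 / 6" 
proof -
  have "3 * y^2 + 6 * y \<le> 1" using yrel pd by simp
  then show ?thesis using zero_le_power2[of y] by linarith
qed

text \<open>By \<open>yrel\<close>, \<open>y\<close> is a concave function of \<open>p^2 + d\<close>
  that vanishes at 0. Its value at 1 is about 0.1547, so on the unit interval its chord lies above
  the line of slope 3/20.\<close>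

lemma y_lower: "3 / 20 * (p^2 + d) \<le> y"
proof (rule ccontr)
  define s where "s = p^2 + d"
  assume "\<not> ?thesis" then have l: "y < 3/20 * s" by (simp add: s_def)
  have s: "0 \<le> s" "s \<le> 1" using pd d0 by (auto simp: s_def)
  have "y^2 \<le> (3/20 * s)^2" using l y0 by (intro power_mono) auto
  also have "\<dots> \<le> 9/400 * s" using s by (simp add: power2_eq_square mult_left_le)
  finally show False using yrel l s unfolding s_def[symmetric] by simp
qed

text \<open>After multiplication by \<open>18 * (2 + y)\<close> and clearing the other denominator,
  this is the bound \<open>T - 3 * \<gamma> * d\<close> for \<open>capint a X (Y + 3/10 * d)\<close>
  in \<open>capint_combination_le\<close>. Equality holds for \<open>d = 0\<close>.\<close>

lemma capint_A0_polynomial_bound: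
  "6 * ((y + 3)^2 - 9 * (2 + y) * (49/40 - (1 + y)) * d) * (2 + p + y + 3/10 * d)^2
     \<ge> (2 + y) * (6 + 2 * p - d)^2 * (1 + p + 2 * (1 + y) + 2 * (3/10 * d))"
proof -
  define Q where "Q = (72/5) + (51/5) * y + (1673/30) * d + (2493/100) * d * y + (63889/3000) * d^2 + (18213/2000) * d^2 * y + (81/50) * d^3 + (-188/5) * p + (-103/5) * p * y + (4199/75) * p * d + (3011/100) * p * d * y + (54/5) * p * d^2 + (1517/30) * p^2 + (113/5) * p^2 * y + (2921/60) * p^2 * d + (54/5) * p^2 * d * y + (81/50) * p^2 * d^2 + (2033/30) * p^3 + (36) * p^3 * y + (54/5) * p^3 * d + (24) * p^4"
  have "6 * ((y + 3)^2 - 9 * (2 + y) * (49/40 - (1 + y)) * d) * (2 + p + y + 3/10 * d)^2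
      - (2 + y) * (6 + 2 * p - d)^2 * (1 + p + 2 * (1 + y) + 2 * (3/10 * d)) = d * Q + (3 * (y^2 + 2 * y) - (p^2 + d)) * ((18) + (16) * y + (2) * y^2 + (215/3) * d + (1383/20) * d * y + (18) * d * y^2 + (1481/60) * d^2 + (54/5) * d^2 * y + (81/50) * d^3 + (8) * p + (4) * p * y + (2033/30) * p * d + (36) * p * d * y + (54/5) * p * d^2 + (24) * p^2 * d)"
    unfolding Q_def by algebra
  moreover have "Q \<ge> 0"
  proof -
    \<comment> \<open>The only negative terms of \<open>Q\<close> are those in \<open>p\<close> and
      \<open>p * y\<close>. The second is estimated by \<open>y \<le> 1/6\<close>, and the resulting
      multiple of \<open>p\<close> is absorbed by the constant and \<open>p^2\<close>; the square is
      completed near the minimiser, at 2/5.\<close>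
    have "Q = (72/5 - 1233/30 * p + (1517/30) * p^2) + (103/5) * p * (1/6 - y) + 2/30 * p
      + ((51/5) * y + (1673/30) * d + (2493/100) * d * y + (63889/3000) * d^2 + (18213/2000) * d^2 * y + (81/50) * d^3 + (4199/75) * p * d + (3011/100) * p * d * y + (54/5) * p * d^2 + (113/5) * p^2 * y + (2921/60) * p^2 * d + (54/5) * p^2 * d * y + (81/50) * p^2 * d^2 + (2033/30) * p^3 + (36) * p^3 * y + (54/5) * p^3 * d + (24) * p^4)"
      by (simp add: Q_def field_simps)
    moreover have "72/5 - 1233/30 * p + (1517/30) * p^2 \<ge> 0"
    proof -
      have "72/5 - 1233/30 * p + (1517/30) * p^2 = 1517/30 * (p - 2/5)^2 + (72/5 - 1517/30 * 4/25) + (1517/30 * 4/5 - 1233/30) * p"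
        by (simp add: power2_eq_square field_simps)
      moreover have "(1517/30 * 4/5 - 1233/30) * p \<ge> (1517/30 * 4/5 - 1233/30) * 1"
        using p1 by simp
      moreover have "(72/5 - 1517/30 * 4/25) + (1517/30 * 4/5 - 1233/30) * 1 \<ge> (0::real)" by simp
      ultimately show ?thesis using zero_le_power2[of "p - 2/5"] by linarith
    qed
    moreover have "(103/5) * p * (1/6 - y) \<ge> 0" using p0 y_upper by simp
    moreover have "2/30 * p \<ge> 0" using p0 by simp
    moreover have "0 \<le> (51/5) * y + (1673/30) * d + (2493/100) * d * y + (63889/3000) * d^2 + (18213/2000) * d^2 * y + (81/50) * d^3 + (4199/75) * p * d + (3011/100) * p * d * y + (54/5) * p * d^2 + (113/5) * p^2 * y + (2921/60) * p^2 * d + (54/5) * p^2 * d * y + (81/50) * p^2 * d^2 + (2033/30) * p^3 + (36) * p^3 * y + (54/5) * p^3 * d + (24) * p^4"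
      using p0 d0 y0 by (intro add_nonneg_nonneg mult_nonneg_nonneg) auto
    ultimately show ?thesis by linarith
  qed
  ultimately show ?thesis using mult_nonneg_nonneg[OF d0, of Q] yrel by simp
qed

text \<open>The counterpart for the second integral: cleared of denominators, the bound
  \<open>T + \<gamma> * d\<close> for \<open>capint a X (Y - 5/3 * d)\<close>. The assumption makes
  \<open>Y - 5/3 * d\<close> nonnegative.\<close>

lemma capint_L0_polynomial_bound:
  assumes small: "5/3 * d \<le> 1 + y"
  shows "6 * ((y + 3)^2 + 3 * (2 + y) * (49/40 - (1 + y)) * d) * (2 + p + y - 5/3 * d)^2
     \<ge> (2 + y) * (6 + 2 * p - d)^2 * (1 + p + 2 * (1 + y) - 2 * (5/3 * d))"
proof -
  \<comment> \<open>In the application \<open>w\<close> is \<sigma> c. It turns the constraint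
    \<open>d \<le> 2 * p\<close> into nonnegativity of a variable.\<close>
  define w where "w = p - d/2"
  have w: "0 \<le> w" and p_eq: "p = w + 1/2 * d" and w1: "w \<le> 1 - d/2" using dp p1 by (auto simp: w_def)
  have d7: "d \<le> 7/10" using small y_upper by simp
  define Q where "Q = (12/5) + (21/5) * y + (-86/15) * d + (29/20) * d * y + (9101/360) * d^2 + (941/60) * d^2 * y + (-1607/720) * d^3 + (7/2) * d^3 * y + (-13/6) * d^4 + (342/5) * w + (221/5) * w * y + (-1322/15) * w * d + (-1073/30) * w * d * y + (11309/360) * w * d^2 + (11) * w * d^2 * y + (-17/3) * w * d^3 + (-43/6) * w^2 + (61/15) * w^2 * y + (-1361/180) * w^2 * d + (2) * w^2 * d * y + (4/3) * w^2 * d^2 + (-253/10) * w^3 + (-12) * w^3 * y + (4) * w^3 * d + (-8) * w^4"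
  have "6 * ((y + 3)^2 + 3 * (2 + y) * (49/40 - (1 + y)) * d) * (2 + p + y - 5/3 * d)^2
      - (2 + y) * (6 + 2 * p - d)^2 * (1 + p + 2 * (1 + y) - 2 * (5/3 * d)) = d * ((12/5) + (21/5) * y + (-599/15) * d + (-413/20) * d * y + (608/9) * d^2 + (415/12) * d^2 * y + (-50/3) * d^3 + (342/5) * p + (221/5) * p * y + (-2429/30) * p * d + (-239/6) * p * d * y + (20) * p * d^2 + (-43/6) * p^2 + (61/15) * p^2 * y + (547/18) * p^2 * d + (20) * p^2 * d * y + (-50/3) * p^2 * d^2 + (-253/10) * p^3 + (-12) * p^3 * y + (20) * p^3 * d + (-8) * p^4) + (3 * (y^2 + 2 * y) - (p^2 + d)) * ((18) + (16) * y + (2) * y^2 + (-749/15) * d + (-1759/60) * d * y + (-6) * d * y^2 + (691/18) * d^2 + (20) * d^2 * y + (-50/3) * d^3 + (8) * p + (4) * p * y + (-253/10) * p * d + (-12) * p * d * y + (20) * p * d^2 + (-8) * p^2 * d)"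
    by algebra
  moreover have "(12/5) + (21/5) * y + (-599/15) * d + (-413/20) * d * y + (608/9) * d^2 + (415/12) * d^2 * y + (-50/3) * d^3 + (342/5) * p + (221/5) * p * y + (-2429/30) * p * d + (-239/6) * p * d * y + (20) * p * d^2 + (-43/6) * p^2 + (61/15) * p^2 * y + (547/18) * p^2 * d + (20) * p^2 * d * y + (-50/3) * p^2 * d^2 + (-253/10) * p^3 + (-12) * p^3 * y + (20) * p^3 * d + (-8) * p^4 = Q"
    unfolding Q_def p_eq by algebra
  moreover have "Q \<ge> 0"
  proof -
    \<comment> \<open>All negative terms are collected in three groups according to their common
      factor 1, \<open>w\<close> or \<open>w * y\<close>; each group is nonnegative by itself and
      what is left has positive coefficients.\<close>
    define Q1 where "Q1 = 12/5 - 86/15 * d + 9101/360 * d^2 - 1607/720 * d^3 - 13/6 * d^4"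
    define Q2 where "Q2 = 342/5 - 1322/15 * d + 11309/360 * d^2 - 17/3 * d^3 - 43/6 * w - 1361/180 * w * d - 253/10 * w^2 - 8 * w^3"
    define Q3 where "Q3 = 221/5 - 1073/30 * d - 12 * w^2"
    have "Q = Q1 + w * Q2 + w * y * Q3 + ((21/5) * y + (29/20) * d * y + (941/60) * d^2 * y + (7/2) * d^3 * y
       + (11) * w * d^2 * y + (61/15) * w^2 * y + (2) * w^2 * d * y + (4/3) * w^2 * d^2 + (4) * w^3 * d)"
      unfolding Q_def Q1_def Q2_def Q3_def by algebra
    moreover have "Q1 \<ge> 0"
    proof -
      have "d^3 \<le> 7/10 * d^2" using mult_right_mono[OF d7, of "d^2"] by (simp add: power3_eq_cube power2_eq_square)
      moreover have "d^4 \<le> d^2" using d7 d0 by (simp add: power_decreasing)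
      moreover have "12/5 - 86/15 * d + 20 * d^2 = 20 * (d - 43/300)^2 + (12/5 - 20 * (43/300)^2)"
        by (simp add: power2_eq_square algebra_simps)
      then have "12/5 - 86/15 * d + 20 * d^2 \<ge> 0" using zero_le_power2[of "d - 43/300"] by (simp add: power2_eq_square)
      ultimately show ?thesis unfolding Q1_def using zero_le_power2[of d] by linarith
    qed
    moreover have w2: "w^2 + w * d + d^2/4 \<le> 1 - d"
      using pd unfolding p_eq by (simp add: power2_eq_square algebra_simps)
    have wd: "w * d \<ge> 0" using w d0 by simp
    have w2': "w^2 \<le> 1" using w2 wd d0 zero_le_power2[of d] by linarith
    have "Q3 \<ge> 0" unfolding Q3_def using w2' d7 by linarith
    moreover have "Q2 \<ge> 0"
    proof -
      have "w \<le> 1" using w1 d0 by simp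
      then have "w^3 \<le> w^2" using w by (simp add: power_decreasing)
      moreover have "d^3 \<le> 7/10 * d^2" using mult_right_mono[OF d7, of "d^2"] by (simp add: power3_eq_cube power2_eq_square)
      moreover have "27 - 103/2 * d + 35 * d^2 \<ge> 0"
      proof -
        have "27 - 103/2 * d + 35 * d^2 = 35 * (d - 103/140)^2 + (27 - 35 * (103/140)^2)"
          by (simp add: power2_eq_square algebra_simps)
        also have "\<dots> \<ge> 35 * (d - 103/140)^2" by (simp add: power2_eq_square)
        finally show ?thesis using zero_le_power2[of "d - 103/140"] by linarith
      qed
      ultimately show ?thesis unfolding Q2_def mult.assoc using w2 wd w1 zero_le_power2[of d] d0
        by linarith
    qed
    moreover have "0 \<le> (21/5) * y + (29/20) * d * y + (941/60) * d^2 * y + (7/2) * d^3 * y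
       + (11) * w * d^2 * y + (61/15) * w^2 * y + (2) * w^2 * d * y + (4/3) * w^2 * d^2 + (4) * w^3 * d"
      using w d0 y0 by (intro add_nonneg_nonneg mult_nonneg_nonneg) auto
    ultimately show ?thesis
      using mult_nonneg_nonneg[of w Q2] mult_nonneg_nonneg[of "w * y" Q3] w y0 by simp
  qed
  ultimately show ?thesis using mult_nonneg_nonneg[OF d0, of Q] yrel by simp
qed

text \<open>In the notation of \<open>capint_combination_le\<close> this is
  \<open>X^2 * (L0 - (Y - 5/3 * d)^2)\<close> with the factor \<open>d\<close> removed, so it yields
  the lower bound \<open>Y - 5/3 * d\<close> for the root of \<open>L0\<close>.\<close>

lemma L0_lower_polynomial_bound:
  assumes small: "5/3 * d \<le> 1 + y"
  shows "0 \<le> (1 + p)^2 * (10/3 * (1 + y) - 25/9 * d) + (2/3 * (1 + p)^2 - 4 - 2/3 * (2 * p - d)) * (1 + p - d/4)"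
proof -
  define w where "w = p - d/2"
  have w: "0 \<le> w" and p_eq: "p = w + d/2" using dp by (auto simp: w_def)
  have d7: "d \<le> 7/10" using small y_upper by simp
  \<comment> \<open>The excess of \<open>y\<close> over its lower bound in terms of \<open>d\<close>
    alone, obtained from \<open>y_lower\<close> and \<open>d/2 \<le> p\<close>. After this
    substitution only a few monomials have negative coefficients.\<close>
  define z where "z = y - 3/20 * (d + d^2/4)"
  have "d^2/4 \<le> p^2" using dp d0 power_mono[of d "2*p" 2] by (simp add: power2_eq_square)
  then have z: "0 \<le> z" using y_lower by (simp add: z_def)
  have y_eq: "y = z + 3/20 * (d + d^2/4)" by (simp add: z_def)
  have dd: "d^2 \<le> 49/100" using d7 d0 power_mono[of d "7/10" 2] by (simp add: power2_eq_square)
  have "(1 + p)^2 * (10/3 * (1 + y) - 25/9 * d) + (2/3 * (1 + p)^2 - 4 - 2/3 * (2 * p - d)) * (1 + p - d/4)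
    = d * (8/9 - 71/72 * d - 29/72 * d^2) + w * (10/3 - 8/9 * d - 22/9 * d^2)
      + w^2 * (4 - 35/18 * d) + (2/3 * w^3 + 1/32 * d^4
      + z * (10/3 + 10/3 * d + 5/6 * d^2 + 20/3 * w + 10/3 * w * d + 10/3 * w^2)
      + 3/20 * (d + d^2/4) * (20/3 * w + 10/3 * w * d + 10/3 * w^2))"
    unfolding p_eq y_eq by (simp add: field_simps power2_eq_square power3_eq_cube power4_eq_xxxx)
  moreover have "d * (8/9 - 71/72 * d - 29/72 * d^2) \<ge> 0" "w * (10/3 - 8/9 * d - 22/9 * d^2) \<ge> 0"
    "w^2 * (4 - 35/18 * d) \<ge> 0"
    using d7 dd d0 w by (auto intro!: mult_nonneg_nonneg)
  moreover have "0 \<le> 2/3 * w^3 + 1/32 * d^4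
      + z * (10/3 + 10/3 * d + 5/6 * d^2 + 20/3 * w + 10/3 * w * d + 10/3 * w^2)
      + 3/20 * (d + d^2/4) * (20/3 * w + 10/3 * w * d + 10/3 * w^2)"
    using w d0 z by (intro add_nonneg_nonneg mult_nonneg_nonneg) auto
  ultimately show ?thesis by linarith
qed

text \<open>For large \<open>d\<close> the lower bound \<open>Y - 5/3 * d\<close> is negative and
  the trivial bound 0 takes its place. Then already \<open>T\<close> is an upper bound, because
  \<open>d\<close> is bounded away from 0.\<close>

lemma capint_zero_polynomial_bound:
  assumes large: "1 + y < 5/3 * d"
  shows "(2 + y) * (6 + 2 * p - d)^2 \<le> 6 * (y + 3)^2 * (1 + p)"
proof -
  \<comment> \<open>The lower bounds improve each other: \<open>d > 3/5\<close> gives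
    \<open>p > 3/10\<close>, both give \<open>y > 1/10\<close>, and this gives
    \<open>d > 13/20\<close> and \<open>p > 13/40\<close>.\<close>
  have d6: "d > 3/5" using large y0 by simp
  then have p3: "p > 3/10" using dp by simp
  then have "p^2 > (3/10)^2" by (intro power_strict_mono) auto
  then have s: "3 * (y^2 + 2 * y) > 69/100" using yrel d6 by (simp add: power2_eq_square)
  have y1: "y > 1/10"
  proof (rule ccontr)
    assume "\<not> ?thesis"
    then have "y \<le> 1/10" by simp
    then have "y^2 \<le> (1/10)^2" using y0 by (intro power_mono) auto
    then show False using s \<open>y \<le> 1/10\<close> by (simp add: power2_eq_square)
  qed
  then have d65: "d > 13/20" using large by simp
  then have p325: "p > 13/40" using dp by simp
  \<comment> \<open>Here 107/20 is 6 - 13/20. The factor 27 * (76/75) = 27.36 lies just below the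
    value of \<open>6 * (y + 3)^2 / (2 + y)\<close> at \<open>y = 1/10\<close>, and 27.36 * (1 + p)
    still dominates the convex square at the endpoints 13/40 and 1 of the range of
    \<open>p\<close>.\<close>
  have "(6 + 2 * p - d)^2 \<le> (107/20 + 2 * p)^2" using d65 p0 pd p1 d0 dp by (intro power_mono) auto
  moreover have "(107/20 + 2 * p)^2 \<le> 27 * (76/75) * (1 + p)"
  proof -
    have "27 * (76/75) * (1 + p) - (107/20 + 2 * p)^2 = 4 * (p - 13/40) * (1 - p) + (27 * (76/75) * (1 + p) - (107/20)^2 - 107/5 * p - 53/10 * p + 13/10)"
      by (simp add: power2_eq_square field_simps)
    moreover have "27 * (76/75) * (1 + p) - (107/20)^2 - 107/5 * p - 53/10 * p + 13/10 \<ge> 0"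
      using p325 by (simp add: power2_eq_square field_simps)
    moreover have "4 * (p - 13/40) * (1 - p) \<ge> 0" using p325 p1 by simp
    ultimately show ?thesis by linarith
  qed
  ultimately have "(2 + y) * (6 + 2 * p - d)^2 \<le> (2 + y) * (27 * (76/75) * (1 + p))"
    using y0 by (intro mult_left_mono) auto
  also have "\<dots> = ((2 + y) * (27 * (76/75))) * (1 + p)" by (simp add: algebra_simps)
  also have "\<dots> \<le> (6 * (y + 3)^2) * (1 + p)"
  proof (rule mult_right_mono)
    have "6 * (y + 3)^2 - (2 + y) * (27 * (76/75)) = 6 * (y - 1/10)^2 + 246/25 * y - 39/50"
      by algebra
    then show "(2 + y) * (27 * (76/75)) \<le> 6 * (y + 3)^2"
      using zero_le_power2[of "y - 1/10"] y1 by linarith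
  qed (use p0 in simp)
  finally show ?thesis by simp
qed

end

text \<open>The two integrals are bounded by \<open>T - 3 * \<gamma> * d\<close> and
  \<open>T + \<gamma> * d\<close>, whose combination with weights 1/4 and 3/4 is exactly
  \<open>T\<close>. For \<open>c = 1\<close> both \<open>A0\<close> and \<open>L0\<close> equal
  \<open>Y^2\<close> and equality holds.\<close>

lemma capint_combination_le:
  fixes \<sigma> c :: real
  assumes \<sigma>: "0 < \<sigma>" "\<sigma> < 1" and c: "0 \<le> c" "c \<le> 1"
  defines "a \<equiv> \<sigma> * c / 3" and "X \<equiv> sqrt (1 + \<sigma>^2 + 2 * \<sigma> * c)" and "Y \<equiv> sqrt (1 + \<sigma>^2 / 3)"
  defines "A0 \<equiv> 1 + \<sigma>^2 - 2 * (\<sigma> * c)^2 / 3"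
  defines "L0 \<equiv> A0 - 4 * \<sigma>^2 * (1 - c^2) * (1 + a) / X^2"
  shows "capint a X (sqrt A0) / 4 + 3 * capint a X (sqrt L0) / 4 \<le> (Y + 2)^2 / (3 * (Y + 1))"
proof -
  define p where "p = X - 1"
  define d where "d = \<sigma>^2 - p^2"
  define y where "y = Y - 1"
  have X2: "X^2 = 1 + \<sigma>^2 + 2 * \<sigma> * c" using \<sigma> c by (simp add: X_def)
  have Y2: "Y^2 = 1 + \<sigma>^2 / 3" by (simp add: Y_def add_nonneg_nonneg)
  have X1: "X \<ge> 1" using \<sigma> c by (simp add: X_def)
  have Y1: "Y \<ge> 1" by (simp add: Y_def)
  have sc: "2 * (\<sigma> * c) = 2 * p - d" using X2 by (simp add: p_def d_def power2_eq_square algebra_simps)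
  have "X^2 \<le> (1 + \<sigma>)^2" using X2 mult_left_le[of c \<sigma>] \<sigma> c by (simp add: power2_eq_square algebra_simps)
  then have "X \<le> 1 + \<sigma>" using \<sigma> by (rule_tac power2_le_imp_le) auto
  then have "p^2 \<le> \<sigma>^2" unfolding p_def using X1 by (intro power_mono) auto
  moreover have "\<sigma>^2 \<le> 1" using \<sigma> by (simp add: power_le_one)
  moreover have "0 \<le> 2 * p - d" using sc \<sigma> c by (metis mult_nonneg_nonneg less_imp_le zero_le_numeral)
  \<comment> \<open>\<open>0 \<le> d\<close> expresses c \<le> 1, \<open>d \<le> 2 * p\<close>
    expresses 0 \<le> c, and \<open>p^2 + d \<le> 1\<close> expresses \<sigma> \<le> 1.\<close>
  ultimately interpret extremal_parameters p d y
    using X1 Y1 Y2 by unfold_locales (auto simp: p_def d_def y_def power2_eq_square algebra_simps)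
  define T where "T = (Y + 2)^2 / (3 * (Y + 1))"
  text \<open>The two integrals deviate from \<open>T\<close> in opposite directions; the weight \<open>\<gamma>\<close> separates the two
    deviations and was found numerically.\<close>
  define \<gamma> where "\<gamma> = 49/40 - Y"
  have Yy: "Y = 1 + y" and Xp: "X = 1 + p" by (auto simp: y_def p_def)
  have a_eq: "1 + a = 1/6 * (6 + 2 * p - d)" using sc by (simp add: a_def)
  have s_eq: "\<sigma>^2 = p^2 + d" by (simp add: d_def)
  \<comment> \<open>The squared component of the point orthogonal to the direction. It contains the
    factor \<open>d\<close>, and so do the deviations of \<open>A0\<close> and \<open>L0\<close>
    from \<open>Y^2\<close>.\<close>
  define \<Delta> where "\<Delta> = \<sigma>^2 * (1 - c^2)"
  have \<Delta>: "\<Delta> = d * (1 + p - d/4)"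
  proof -
    have "\<Delta> = \<sigma>^2 - (2 * (\<sigma> * c))^2 / 4" by (simp add: \<Delta>_def power2_eq_square algebra_simps)
    also have "\<dots> = (p^2 + d) - (2 * p - d)^2 / 4" unfolding sc s_eq ..
    finally show ?thesis by (simp add: power2_eq_square field_simps)
  qed
  have A0: "A0 = Y^2 + 2/3 * \<Delta>" unfolding A0_def Y2 \<Delta>_def by (simp add: power2_eq_square field_simps)
  have L0: "L0 = Y^2 + 2/3 * \<Delta> - 4 * \<Delta> * (1 + a) / X^2"
    unfolding L0_def A0 by (simp add: \<Delta>_def algebra_simps)
  have T: "T * (6 * (2 + y)) = 2 * (y + 3)^2" using y0 by (simp add: T_def Yy field_simps)
  have "capint a X (sqrt A0) \<le> T - 3 * \<gamma> * d"
  proof (rule capint_le)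
    show "X > 0" using X1 by simp
    show "0 \<le> Y + 3/10 * d" using Y1 d0 by simp
    have "(Y + 3/10 * d)^2 \<le> A0"
    proof -
      have "A0 - (Y + 3/10 * d)^2 = d * (2/3 * (1 + p - d/4) - 3/5 * Y - 9/100 * d)"
        unfolding A0 \<Delta> by (simp add: power2_eq_square field_simps)
      moreover have "2/3 * (1 + p - d/4) - 3/5 * Y - 9/100 * d \<ge> 0"
      proof -
        have "p^2 \<le> p" using p0 p1 by (simp add: power2_eq_square mult_left_le)
        moreover have "3 * y^2 + 6 * y = p^2 + d" using yrel by simp
        ultimately have "6 * y \<le> p^2 + d" using zero_le_power2[of y] by linarith
        moreover have "2/3 * (1 + p - d/4) - 3/5 * Y - 9/100 * d = 1/15 + 2/3 * p - 77/300 * d - 1/10 * (6 * y)"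
          by (simp add: Yy field_simps)
        ultimately show ?thesis using dp p0 pd \<open>p^2 \<le> p\<close> by linarith
      qed
      ultimately show ?thesis using d0 by (metis diff_ge_0_iff_ge mult_nonneg_nonneg)
    qed
    then show "Y + 3/10 * d \<le> sqrt A0" by (rule real_le_rsqrt)
    have "18 * (2 + y) * (2 * (1 + a)^2 * (X + 2 * (Y + 3/10 * d))) = (2 + y) * (6 + 2 * p - d)^2 * (1 + p + 2 * (1 + y) + 2 * (3/10 * d))"
      unfolding a_eq Xp Yy by algebra
    also note capint_A0_polynomial_bound
    also have "6 * ((y + 3)^2 - 9 * (2 + y) * (49/40 - (1 + y)) * d) * (2 + p + y + 3/10 * d)^2
       = (3 * (2 * (y+3)^2) - 18 * (2 + y) * (3 * (49/40 - (1 + y)) * d)) * (X + (Y + 3/10 * d))^2"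
      unfolding Xp Yy by algebra
    also have "\<dots> = 18 * (2 + y) * ((T - 3 * \<gamma> * d) * (X + (Y + 3/10 * d))^2)"
      unfolding T[symmetric] \<gamma>_def Yy by (simp add: algebra_simps)
    finally show "2 * (1 + a)^2 * (X + 2 * (Y + 3/10 * d)) \<le> (T - 3 * \<gamma> * d) * (X + (Y + 3/10 * d))^2"
      using y0 by (simp add: mult_le_cancel_left)
  qed
  moreover have "capint a X (sqrt L0) \<le> T + \<gamma> * d"
  proof (cases "5/3 * d \<le> 1 + y")
    case True
    show ?thesis
    proof (rule capint_le)
      show "X > 0" using X1 by simp
      show "0 \<le> Y - 5/3 * d" using True by (simp add: Yy)
      have "X^2 * (L0 - (Y - 5/3 * d)^2)
          = d * ((1 + p)^2 * (10/3 * (1 + y) - 25/9 * d) + (2/3 * (1 + p)^2 - 4 - 2/3 * (2 * p - d)) * (1 + p - d/4))"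
      proof -
        have "X^2 * L0 = X^2 * Y^2 + X^2 * (2/3 * \<Delta>) - 4 * \<Delta> * (1 + a)"
          using X1 unfolding L0 by (simp add: field_simps)
        then have "X^2 * (L0 - (Y - 5/3 * d)^2) = X^2 * (2/3 * \<Delta>) - 4 * \<Delta> * (1 + a) + X^2 * (Y^2 - (Y - 5/3 * d)^2)"
          by (simp add: algebra_simps)
        also have "\<dots> = d * ((1 + p)^2 * (10/3 * (1 + y) - 25/9 * d) + (2/3 * (1 + p)^2 - 4 - 2/3 * (2 * p - d)) * (1 + p - d/4))"
          unfolding \<Delta> a_eq Xp Yy by (simp add: field_simps power2_eq_square)
        finally show ?thesis .
      qed
      also have "\<dots> \<ge> 0" using L0_lower_polynomial_bound[OF True] d0 by (intro mult_nonneg_nonneg) auto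
      finally have "(Y - 5/3 * d)^2 \<le> L0" using X1 by (simp add: zero_le_mult_iff)
      then show "Y - 5/3 * d \<le> sqrt L0" by (rule real_le_rsqrt)
      have "18 * (2 + y) * (2 * (1 + a)^2 * (X + 2 * (Y - 5/3 * d))) = (2 + y) * (6 + 2 * p - d)^2 * (1 + p + 2 * (1 + y) - 2 * (5/3 * d))"
        unfolding a_eq Xp Yy by algebra
      also note capint_L0_polynomial_bound[OF True]
      also have "6 * ((y + 3)^2 + 3 * (2 + y) * (49/40 - (1 + y)) * d) * (2 + p + y - 5/3 * d)^2
         = (3 * (2 * (y+3)^2) + 18 * (2 + y) * ((49/40 - (1 + y)) * d)) * (X + (Y - 5/3 * d))^2"
        unfolding Xp Yy by algebra
      also have "\<dots> = 18 * (2 + y) * ((T + \<gamma> * d) * (X + (Y - 5/3 * d))^2)"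
        unfolding T[symmetric] \<gamma>_def Yy by (simp add: algebra_simps)
      finally show "2 * (1 + a)^2 * (X + 2 * (Y - 5/3 * d)) \<le> (T + \<gamma> * d) * (X + (Y - 5/3 * d))^2"
        using y0 by (simp add: mult_le_cancel_left)
    qed
  next
    \<comment> \<open>Now \<open>Y - 5/3 * d\<close> is negative, so \<open>capint_le\<close> is
      applied with 0 instead.\<close>
    case False
    have "capint a X (sqrt L0) \<le> T"
    proof (rule capint_le[where y = 0])
      show "X > 0" using X1 by simp
      show "0 \<le> sqrt L0"
      proof -
        have "X^2 * L0 = X^2 * (Y^2 + 2/3 * \<Delta>) - 4 * \<Delta> * (1 + a)"
          using X1 unfolding L0 by (simp add: field_simps)
        also have "\<dots> = (1 - \<sigma>^2)^2 + 2 * (\<sigma> * c) * (1 + \<sigma>^2/3) + 2/3 * (\<sigma> * c)^2 * (5 - \<sigma>^2)"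
          unfolding X2 Y2 \<Delta>_def a_def by (simp add: field_simps power2_eq_square)
        also have "\<dots> \<ge> 0" using \<sigma> c \<open>\<sigma>^2 \<le> 1\<close> by (intro add_nonneg_nonneg mult_nonneg_nonneg) auto
        finally show ?thesis using X1 by (simp add: zero_le_mult_iff)
      qed
      have "18 * (2 + y) * (2 * (1 + a)^2 * (X + 2 * 0)) = X * ((2 + y) * (6 + 2 * p - d)^2)"
        unfolding a_eq by algebra
      also have "\<dots> \<le> X * (6 * (y + 3)^2 * (1 + p))" using capint_zero_polynomial_bound False X1 by (intro mult_left_mono) auto
      also have "\<dots> = (3 * (2 * (y + 3)^2)) * X^2" by (simp add: Xp power2_eq_square)
      also have "\<dots> = 18 * (2 + y) * (T * (X + 0)^2)" unfolding T[symmetric] by simp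
      finally show "2 * (1 + a)^2 * (X + 2 * 0) \<le> T * (X + 0)^2"
        using y0 by (simp add: mult_le_cancel_left)
    qed simp
    moreover have "\<gamma> * d \<ge> 0" using y_upper d0 by (simp add: \<gamma>_def Yy)
    ultimately show ?thesis by simp
  qed
  ultimately show ?thesis unfolding T_def[symmetric] by simp
qed

section \<open>Integrals over circles and caps\<close>

lemma has_integral_inverse_add_cos:
  fixes A B :: real
  assumes "\<bar>B\<bar> < A"
  shows "((\<lambda>\<phi>. 1 / (A + B * cos \<phi>)) has_integral (pi / sqrt (A^2 - B^2))) {0..pi}"
proof -
  define \<Delta> where "\<Delta> = sqrt (A^2 - B^2)"
  have "\<bar>B\<bar>^2 < A^2" using assms by (intro power_strict_mono) auto
  then have \<Delta>: "\<Delta> > 0" "\<Delta>^2 = A^2 - B^2" by (simp_all add: \<Delta>_def)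
  have pos: "A + B * cos \<phi> > 0" for \<phi>
  proof -
    have "\<bar>B * cos \<phi>\<bar> \<le> \<bar>B\<bar> * 1" unfolding abs_mult by (intro mult_left_mono) auto
    then show ?thesis using assms by linarith
  qed
  \<comment> \<open>A primitive that is smooth on the whole interval; the usual one, obtained from
    the substitution tan (\<phi>/2), degenerates at \<open>pi\<close>.\<close>
  define W where "W \<phi> = (\<phi> - 2 * arctan (B * sin \<phi> / (A + \<Delta> + B * cos \<phi>))) / \<Delta>" for \<phi>
  have "((\<lambda>\<phi>. 1 / (A + B * cos \<phi>)) has_integral (W pi - W 0)) {0..pi}"
  proof (rule fundamental_theorem_of_calculus)
    fix \<phi> :: real assume "\<phi> \<in> {0..pi}"
    define N where "N = A + \<Delta> + B * cos \<phi>"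
    define M where "M = A + B * cos \<phi>"
    have N: "N > 0" and M: "M > 0" using pos[of \<phi>] \<Delta> by (simp_all add: N_def M_def)
    have sc: "(sin \<phi>)^2 = 1 - (cos \<phi>)^2" by (simp add: sin_squared_eq)
    have B2: "B^2 = (A - \<Delta>) * (A + \<Delta>)" using \<Delta>(2) by (simp add: power2_eq_square algebra_simps)
    have e1: "N^2 + (B * sin \<phi>)^2 = 2 * (A + \<Delta>) * M"
    proof -
      have "N^2 + (B * sin \<phi>)^2 = (A + \<Delta>)^2 + 2 * (A + \<Delta>) * B * cos \<phi> + B^2"
        unfolding N_def power_mult_distrib sc by (simp add: power2_eq_square algebra_simps)
      also have "\<dots> = 2 * (A + \<Delta>) * M" unfolding B2 M_def by (simp add: power2_eq_square algebra_simps)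
      finally show ?thesis .
    qed
    have e2: "B * cos \<phi> * N + (B * sin \<phi>)^2 = (A + \<Delta>) * (M - \<Delta>)"
    proof -
      have "B * cos \<phi> * N + (B * sin \<phi>)^2 = B * cos \<phi> * (A + \<Delta>) + B^2"
        unfolding N_def power_mult_distrib sc by (simp add: power2_eq_square algebra_simps)
      also have "\<dots> = (A + \<Delta>) * (M - \<Delta>)" unfolding B2 M_def by (simp add: algebra_simps)
      finally show ?thesis .
    qed
    have A\<Delta>: "A + \<Delta> > 0" using assms \<Delta> by linarith
    have "((\<lambda>\<phi>. B * sin \<phi> / (A + \<Delta> + B * cos \<phi>)) has_real_derivative (B * cos \<phi> * N + (B * sin \<phi>)^2) / N^2) (at \<phi> within {0..pi})"
      using N by (auto intro!: derivative_eq_intros simp: N_def power2_eq_square algebra_simps)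
    then have "((\<lambda>\<phi>. arctan (B * sin \<phi> / (A + \<Delta> + B * cos \<phi>))) has_real_derivative
        (B * cos \<phi> * N + (B * sin \<phi>)^2) / N^2 * inverse (1 + (B * sin \<phi> / N)^2)) (at \<phi> within {0..pi})"
      unfolding N_def by (rule DERIV_chain2[OF DERIV_arctan, THEN DERIV_cong]) (simp add: mult.commute)
    moreover have "(B * cos \<phi> * N + (B * sin \<phi>)^2) / N^2 * inverse (1 + (B * sin \<phi> / N)^2) = (M - \<Delta>) / (2 * M)"
    proof -
      have "1 + (B * sin \<phi> / N)^2 = (N^2 + (B * sin \<phi>)^2) / N^2"
        using N by (simp add: power_divide field_simps)
      also have "\<dots> = 2 * (A + \<Delta>) * M / N^2" unfolding e1 ..
      finally have e3: "1 + (B * sin \<phi> / N)^2 = 2 * (A + \<Delta>) * M / N^2" .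
      have "C * (M - \<Delta>) / N2 * inverse (2 * C * M / N2) = (M - \<Delta>) / (2 * M)"
        if "C > 0" "N2 > 0" for C N2 using that M by (simp add: field_simps)
      from this[of "A + \<Delta>" "N^2"] show ?thesis unfolding e2 e3 using N A\<Delta> by (simp only: zero_less_power)
    qed
    ultimately have "((\<lambda>\<phi>. arctan (B * sin \<phi> / (A + \<Delta> + B * cos \<phi>))) has_real_derivative (M - \<Delta>) / (2 * M)) (at \<phi> within {0..pi})"
      by simp
    then have "(W has_real_derivative (1 - 2 * ((M - \<Delta>) / (2 * M))) / \<Delta>) (at \<phi> within {0..pi})"
      unfolding W_def by (intro DERIV_cdivide DERIV_diff DERIV_ident DERIV_cmult)
    moreover have "(1 - 2 * ((M - \<Delta>) / (2 * M))) / \<Delta> = 1 / M" using M \<Delta> by (simp add: field_simps)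
    ultimately show "(W has_vector_derivative 1 / (A + B * cos \<phi>)) (at \<phi> within {0..pi})"
      by (simp add: M_def has_real_derivative_iff_has_vector_derivative)
  qed simp
  then show ?thesis by (simp add: W_def \<Delta>_def)
qed

text \<open>The pairing of opposite points of the circle makes the bound exact to second order in \<open>B\<close>;
  Cauchy--Schwarz alone would lose too much for the final inequality.\<close>

lemma inverse_sqrt_pair_le:
  fixes A b l :: real
  assumes b: "\<bar>b\<bar> < A" and l: "l > 0"
  shows "1 / sqrt (A - b) + 1 / sqrt (A + b)
    \<le> 1 / (2 * sqrt A) + 3 / 4 * sqrt A * (l * (1 / (2 * A) * (1 / (A - b) + 1 / (A + b))) + 1 / l)"
proof -
  define P Q r E where "P = sqrt (A - b)" and "Q = sqrt (A + b)" and "r = sqrt A" and "E = P * Q"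
  have P: "P > 0" "P^2 = A - b" and Q: "Q > 0" "Q^2 = A + b" and r: "r > 0" "r^2 = A"
    using b by (auto simp: P_def Q_def r_def)
  have E: "E > 0" using P Q by (simp add: E_def)
  \<comment> \<open>The sum \<open>P + Q\<close> is compared with its value \<open>2 * r\<close> at
    \<open>b = 0\<close>; this leaves only the product \<open>E\<close> of the two roots.\<close>
  have "0 \<le> (2 * r - (P + Q))^2" by simp
  also have "\<dots> = 4 * r^2 + P^2 + Q^2 + 2 * E - 4 * r * (P + Q)"
    by (simp add: E_def power2_eq_square algebra_simps)
  also have "\<dots> = 2 * (3 * A + E - 2 * r * (P + Q))" unfolding P Q r by simp
  finally have "2 * r * (P + Q) \<le> 3 * A + E" by simp
  then have "2 * r * (P + Q) / (2 * r * E) \<le> (3 * r^2 + E) / (2 * r * E)"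
    using E r by (intro divide_right_mono) auto
  then have "(P + Q) / E \<le> (3 * r^2 + E) / (2 * r * E)"
    using E r by simp
  moreover have "1 / P + 1 / Q = (P + Q) / E" using P Q by (simp add: E_def field_simps)
  moreover have "(3 * r^2 + E) / (2 * r * E) = 1 / (2 * r) + 3 / 2 * r * (1 / E)"
    using r E by (simp add: field_simps power2_eq_square)
  \<comment> \<open>The arithmetic-geometric mean inequality removes the root:
    \<open>E^2 = (A - b) * (A + b)\<close> splits into partial fractions, whose integrals over the
    circle are known. The weight \<open>l\<close> is chosen after integration.\<close>
  moreover have "1 / E \<le> 1 / 2 * (l / E^2 + 1 / l)"
  proof -
    have "0 \<le> (l - E)^2" by simp
    then have "2 * (l * E) \<le> l^2 + E^2" by (simp add: power2_eq_square algebra_simps)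
    then show ?thesis using l E by (simp add: field_simps power2_eq_square)
  qed
  moreover have "l / E^2 = l * (1 / (2 * A) * (1 / (A - b) + 1 / (A + b)))"
  proof -
    have "E^2 = (A - b) * (A + b)" by (simp add: E_def power_mult_distrib P Q)
    then show ?thesis using b by (simp add: field_simps)
  qed
  ultimately have "1 / P + 1 / Q \<le> 1 / (2 * r) + 3 / 2 * r * (1 / 2 * (l * (1 / (2 * A) * (1 / (A - b) + 1 / (A + b))) + 1 / l))"
    using r by (smt (verit) mult_left_mono mult_nonneg_nonneg divide_nonneg_nonneg)
  then show ?thesis by (simp add: P_def Q_def r_def)
qed

text \<open>The fractions 1/4 and 3/4 come from \<open>inverse_sqrt_pair_le\<close>.
  \<open>L\<close> is kept as a free lower bound for the root of \<open>A^2 - B^2\<close>, so that a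
  function linear in the cosine of the polar angle can be inserted.\<close>

lemma integral_inverse_sqrt_le:
  fixes A B L :: real
  assumes B: "\<bar>B\<bar> < A" and L: "0 < L" "L^2 \<le> A^2 - B^2"
  shows "integral {0..2*pi} (\<lambda>\<phi>. 1 / sqrt (A - B * cos \<phi>)) \<le> 2 * pi * (1 / (4 * sqrt A) + 3 / (4 * sqrt L))"
proof -
  have bc: "\<bar>B * cos \<phi>\<bar> < A" for \<phi>
  proof -
    have "\<bar>B * cos \<phi>\<bar> \<le> \<bar>B\<bar> * 1" unfolding abs_mult by (intro mult_left_mono) auto
    then show ?thesis using B by linarith
  qed
  have A: "A > 0" using B by linarith
  have cont: "continuous_on S (\<lambda>\<phi>. 1 / sqrt (A - B * cos \<phi>))" "continuous_on S (\<lambda>\<phi>. 1 / sqrt (A + B * cos \<phi>))" for S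
    using bc by (auto intro!: continuous_intros simp: abs_less_iff) (smt (verit))+
  define d where "d = sqrt (A^2 - B^2)"
  have d: "d \<ge> L" using real_le_rsqrt[OF L(2)] by (simp add: d_def)
  then have d: "d \<ge> L" "d > 0" using L by auto
  \<comment> \<open>The optimal weight: for it the integrals of the two terms of the
    arithmetic-geometric mean inequality are equal.\<close>
  define l where "l = sqrt (A * d)"
  have l: "l > 0" "l^2 = A * d" using A d by (auto simp: l_def)
  have "integral {0..2*pi} (\<lambda>\<phi>. 1 / sqrt (A - B * cos \<phi>))
     = integral {0..pi} (\<lambda>\<phi>. 1 / sqrt (A - B * cos \<phi>)) + integral {pi..2*pi} (\<lambda>\<phi>. 1 / sqrt (A - B * cos \<phi>))"
    by (intro Henstock_Kurzweil_Integration.integral_combine[symmetric] integrable_continuous_real cont) auto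
  \<comment> \<open>The shift by \<open>pi\<close> changes the sign of the cosine and thereby pairs
    opposite points of the circle.\<close>
  also have "integral {pi..2*pi} (\<lambda>\<phi>. 1 / sqrt (A - B * cos \<phi>)) = integral {0..pi} (\<lambda>\<phi>. 1 / sqrt (A + B * cos \<phi>))"
    using integral_shift_real_ivl[of pi pi "2*pi" "\<lambda>\<phi>. 1 / sqrt (A - B * cos \<phi>)"] by simp
  also have "integral {0..pi} (\<lambda>\<phi>. 1 / sqrt (A - B * cos \<phi>)) + integral {0..pi} (\<lambda>\<phi>. 1 / sqrt (A + B * cos \<phi>))
     = integral {0..pi} (\<lambda>\<phi>. 1 / sqrt (A - B * cos \<phi>) + 1 / sqrt (A + B * cos \<phi>))"
    by (intro integral_add[symmetric] integrable_continuous_real cont)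
  also have "\<dots> \<le> pi * (1 / (2 * sqrt A)) + 3 / 4 * sqrt A * (l * (1 / (2 * A) * (pi / d + pi / d)) + pi * (1 / l))"
  proof (rule has_integral_le)
    show "((\<lambda>\<phi>. 1 / sqrt (A - B * cos \<phi>) + 1 / sqrt (A + B * cos \<phi>)) has_integral
        integral {0..pi} (\<lambda>\<phi>. 1 / sqrt (A - B * cos \<phi>) + 1 / sqrt (A + B * cos \<phi>))) {0..pi}"
      by (intro integrable_integral integrable_continuous_real continuous_intros cont)
    have c: "((\<lambda>_. x) has_integral pi * x) {0..pi}" for x :: real
      using has_integral_const_real[of x 0 pi] by simp
    have i1: "((\<lambda>\<phi>. 1 / (A - B * cos \<phi>)) has_integral (pi / d)) {0..pi}"
      using has_integral_inverse_add_cos[of "- B" A] B by (simp add: d_def)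
    have i2: "((\<lambda>\<phi>. 1 / (A + B * cos \<phi>)) has_integral (pi / d)) {0..pi}"
      using has_integral_inverse_add_cos[of B A] B by (simp add: d_def)
    show "((\<lambda>\<phi>. 1 / (2 * sqrt A) + 3 / 4 * sqrt A * (l * (1 / (2 * A) * (1 / (A - B * cos \<phi>) + 1 / (A + B * cos \<phi>))) + 1 / l))
        has_integral pi * (1 / (2 * sqrt A)) + 3 / 4 * sqrt A * (l * (1 / (2 * A) * (pi / d + pi / d)) + pi * (1 / l))) {0..pi}"
      by (intro has_integral_add has_integral_mult_right c i1 i2)
    fix \<phi> :: real
    show "1 / sqrt (A - B * cos \<phi>) + 1 / sqrt (A + B * cos \<phi>)
      \<le> 1 / (2 * sqrt A) + 3 / 4 * sqrt A * (l * (1 / (2 * A) * (1 / (A - B * cos \<phi>) + 1 / (A + B * cos \<phi>))) + 1 / l)"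
      by (rule inverse_sqrt_pair_le[OF bc l(1)])
  qed
  also have "\<dots> = 2 * pi * (1 / (4 * sqrt A) + 3 / (4 * sqrt d))"
  proof -
    have "l * (1 / (2 * A) * (pi / d + pi / d)) = pi * l / l^2" using A d by (simp add: l(2) field_simps)
    also have "\<dots> = pi * (1 / l)" using l(1) by (simp add: power2_eq_square)
    finally show ?thesis using A d by (simp add: l_def real_sqrt_mult field_simps)
  qed
  also have "\<dots> \<le> 2 * pi * (1 / (4 * sqrt A) + 3 / (4 * sqrt L))"
  proof -
    have "3 / (4 * sqrt d) \<le> 3 / (4 * sqrt L)" using L d by (intro divide_left_mono) auto
    then show ?thesis by (intro mult_left_mono) auto
  qed
  finally show ?thesis .
qed

lemma has_integral_cap:
  fixes a q y :: real
  assumes a: "0 \<le> a" "a \<le> 1" and y: "0 < y" "0 < y + q * (1 + a)"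
  shows "((\<lambda>\<theta>. 3 * (cos \<theta> + a) * sin \<theta> / sqrt (y + q * (cos \<theta> + a))) has_integral
     capint a (sqrt (y + q * (1 + a))) (sqrt y)) {0..arccos (- a)}"
proof -
  define m where "m \<theta> = sqrt (y + q * (cos \<theta> + a))" for \<theta>
  define Y where "Y = sqrt y"
  have Y: "Y > 0" "Y^2 = y" using y by (auto simp: Y_def)
  \<comment> \<open>The usual primitive is \<open>(m - Y)^2 * (m + 2 * Y)\<close> divided by
    \<open>q^2\<close>, up to a factor. Rewriting \<open>m - Y\<close> as
    \<open>q * t / (m + Y)\<close>, with \<open>t = cos \<theta> + a\<close>, cancels
    \<open>q^2\<close>, and the formula also holds for \<open>q = 0\<close>.\<close>
  define \<Psi> where "\<Psi> \<theta> = - (2 * (cos \<theta> + a)^2 * ((m \<theta> + 2 * Y) / (m \<theta> + Y)^2))" for \<theta>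
  have ac: "0 \<le> arccos (- a)" "arccos (- a) \<le> pi" "cos (arccos (- a)) = - a"
    using a by (auto intro: arccos_lbound arccos_ubound cos_arccos)
  have "((\<lambda>\<theta>. 3 * (cos \<theta> + a) * sin \<theta> / m \<theta>) has_integral \<Psi> (arccos (- a)) - \<Psi> 0) {0..arccos (- a)}"
  proof (rule fundamental_theorem_of_calculus)
    fix \<theta> assume \<theta>: "\<theta> \<in> {0..arccos (- a)}"
    define t where "t = cos \<theta> + a"
    have "cos (arccos (- a)) \<le> cos \<theta>" using \<theta> ac by (intro cos_monotone_0_pi_le) auto
    then have t: "0 \<le> t" "t \<le> 1 + a" using ac by (auto simp: t_def)
    have "y + q * t > 0"
    proof (cases "q \<ge> 0")
      case True then show ?thesis using y t by (simp add: add_pos_nonneg)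
    next
      case False
      then have "q * (1 + a) \<le> q * t" using t by (intro mult_left_mono_neg) auto
      then show ?thesis using y by linarith
    qed
    then have m: "m \<theta> > 0" "(m \<theta>)^2 = y + q * t" by (auto simp: m_def t_def)
    have dm: "(m has_real_derivative - (q * sin \<theta>) / (2 * m \<theta>)) (at \<theta> within {0..arccos (- a)})"
      using m unfolding m_def[abs_def] t_def
      by (auto intro!: derivative_eq_intros simp: field_simps)
    have d1: "((\<lambda>\<theta>. 2 * (cos \<theta> + a)^2) has_real_derivative - (4 * t * sin \<theta>)) (at \<theta> within {0..arccos (- a)})"
      unfolding t_def by (auto intro!: derivative_eq_intros)
    have d2: "((\<lambda>\<theta>. m \<theta> + 2 * Y) has_real_derivative - (q * sin \<theta>) / (2 * m \<theta>)) (at \<theta> within {0..arccos (- a)})"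
      by (auto intro!: derivative_eq_intros dm)
    have d3: "((\<lambda>\<theta>. (m \<theta> + Y)^2) has_real_derivative 2 * (m \<theta> + Y) * (- (q * sin \<theta>) / (2 * m \<theta>))) (at \<theta> within {0..arccos (- a)})"
      using m(1) by (auto intro!: derivative_eq_intros dm simp: field_simps)
    have "(m \<theta> + Y)^2 \<noteq> 0" using m Y by auto
    note D = DERIV_minus[OF DERIV_mult[OF d1 DERIV_divide[OF d2 d3 this]], folded t_def \<Psi>_def[abs_def]]
    let ?m = "m \<theta>"
    have mY: "?m > 0" "?m + Y > 0" using m Y by auto
    have qt: "q * t = (?m - Y) * (?m + Y)" using m Y by (simp add: power2_eq_square algebra_simps)
    have "- (- (4 * t * sin \<theta>) * ((?m + 2 * Y) / (?m + Y)^2) +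
        (- (q * sin \<theta>) / (2 * ?m) * (?m + Y)^2 - (?m + 2 * Y) * (2 * (?m + Y) * (- (q * sin \<theta>) / (2 * ?m)))) / ((?m + Y)^2 * (?m + Y)^2) * (2 * t^2))
      = t * sin \<theta> * (4 * (?m + 2 * Y) / (?m + Y)^2 - (q * t) * (?m + 3 * Y) / (?m * (?m + Y)^3))"
    proof -
      have E: "- (q * sin \<theta>) / (2 * ?m) * (?m + Y)^2 - (?m + 2 * Y) * (2 * (?m + Y) * (- (q * sin \<theta>) / (2 * ?m)))
         = q * sin \<theta> / (2 * ?m) * ((?m + Y) * (?m + 3 * Y))"
        using mY by (simp add: field_simps power2_eq_square)
      have gen: "Q * (Z * W) / (Z^2 * Z^2) = Q * W / Z^3" if "Z > 0" for Q Z W :: real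
        using that by (simp add: field_simps eval_nat_numeral)
      have E': "(- (q * sin \<theta>) / (2 * ?m) * (?m + Y)^2 - (?m + 2 * Y) * (2 * (?m + Y) * (- (q * sin \<theta>) / (2 * ?m)))) / ((?m + Y)^2 * (?m + Y)^2)
         = q * sin \<theta> / (2 * ?m) * (?m + 3 * Y) / (?m + Y)^3" unfolding E by (rule gen[OF mY(2)])
      have "- (- (4 * t * S) * (V / Z2) + q * S / (2 * ?m) * W / Z3 * (2 * t^2)) = t * S * (4 * V / Z2 - q * t * W / (?m * Z3))"
        if "Z2 \<noteq> 0" "Z3 \<noteq> 0" for S V Z2 W Z3 :: real
        using that mY by (simp add: field_simps power2_eq_square)
      then show ?thesis unfolding E' using mY by (metis less_irrefl zero_less_power)
    qed
    also have "\<dots> = t * sin \<theta> * ((4 * ?m * (?m + 2 * Y) - (?m - Y) * (?m + 3 * Y)) / (?m * (?m + Y)^2))"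
    proof -
      have "4 * V / Z^2 - (?m - Y) * Z * W / (?m * Z^3) = (4 * ?m * V - (?m - Y) * W) / (?m * Z^2)" if "Z > 0" for V Z W
        using that mY by (simp add: field_simps eval_nat_numeral)
      from this[OF mY(2), of "?m + 2 * Y" "?m + 3 * Y"] show ?thesis unfolding qt by (simp only:)
    qed
    also have "4 * ?m * (?m + 2 * Y) - (?m - Y) * (?m + 3 * Y) = 3 * (?m + Y)^2"
      by (simp add: algebra_simps power2_eq_square)
    also have "t * sin \<theta> * (3 * (?m + Y)^2 / (?m * (?m + Y)^2)) = 3 * t * sin \<theta> / ?m"
      using mY by simp
    finally have "(\<Psi> has_real_derivative 3 * t * sin \<theta> / ?m) (at \<theta> within {0..arccos (- a)})"
      using D by (simp only:)
    then show "(\<Psi> has_vector_derivative 3 * (cos \<theta> + a) * sin \<theta> / m \<theta>) (at \<theta> within {0..arccos (- a)})"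
      by (simp add: t_def has_real_derivative_iff_has_vector_derivative)
  qed (rule ac)
  moreover have "\<Psi> (arccos (- a)) - \<Psi> 0 = capint a (sqrt (y + q * (1 + a))) (sqrt y)"
    by (simp add: \<Psi>_def ac capint_def m_def Y_def)
  ultimately show ?thesis by (simp add: m_def)
qed

text \<open>\<open>L\<close> is the tangent at \<open>s = 1\<close> of the square root of the right-hand side, a convex function of \<open>s\<close>.\<close>

lemma tangent_minorant:
  fixes \<sigma> c s :: real
  assumes \<sigma>: "0 < \<sigma>" "\<sigma> < 1" and c: "0 \<le> c" "c \<le> 1" and s: "- (\<sigma> * c / 3) \<le> s" "s \<le> 1"
  defines "A \<equiv> 1 + \<sigma>^2 + 2 * \<sigma> * c * s" and "X2 \<equiv> 1 + \<sigma>^2 + 2 * \<sigma> * c"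
  defines "L \<equiv> A - 4 * \<sigma>^2 * (1 - c^2) * (1 - s) / X2"
  shows "0 < L" "L^2 \<le> A^2 - 4 * \<sigma>^2 * (1 - c^2) * (1 - s^2)"
proof -
  \<comment> \<open>With these, \<open>X2^2 = w1^2 + b\<close>, \<open>X2 * L = w * w1 + b\<close>,
    and the right-hand side of the second claim is \<open>w^2 + b\<close>. That claim becomes the
    Cauchy-Schwarz inequality with defect \<open>b * (w - w1)^2\<close>, which is zero at
    \<open>s = 1\<close>.\<close>
  define w w1 b where "w = 2 * \<sigma> * s + (1 + \<sigma>^2) * c" and "w1 = 2 * \<sigma> + (1 + \<sigma>^2) * c"
    and "b = (1 - \<sigma>^2)^2 * (1 - c^2)"
  have s2: "\<sigma>^2 < 1" using \<sigma> by (simp add: power_less_one_iff)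
  have X2: "X2 > 0" using \<sigma> c by (simp add: X2_def add_pos_nonneg)
  have c2: "c^2 \<le> 1" using c by (simp add: power_le_one)
  have L: "X2 * L = w * w1 + b"
  proof -
    have "X2 * L = X2 * A - 4 * \<sigma>^2 * (1 - c^2) * (1 - s)" using X2 by (simp add: L_def field_simps)
    also have "\<dots> = w * w1 + b" unfolding X2_def A_def w_def w1_def b_def by algebra
    finally show ?thesis .
  qed
  have "2 * \<sigma> * (- (\<sigma> * c / 3)) \<le> 2 * \<sigma> * s" using s \<sigma> by (intro mult_left_mono) auto
  then have w: "w \<ge> (1 + \<sigma>^2 / 3) * c" by (simp add: w_def power2_eq_square algebra_simps)
  have K: "1 + \<sigma>^2 / 3 > 0" by (simp add: add_pos_nonneg)
  have w1: "w1 > 0" using \<sigma> c by (simp add: w1_def add_pos_nonneg)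
  have b: "b \<ge> 0" using c2 by (simp add: b_def)
  \<comment> \<open>Both summands are nonnegative; \<open>b\<close> can vanish only for
    \<open>c = 1\<close>, and then \<open>w\<close> is positive.\<close>
  have "w * w1 + b > 0"
  proof (cases "c = 1")
    case True
    then have "w > 0" using w K by simp
    then show ?thesis using w1 b by (simp add: add_pos_nonneg)
  next
    case False
    then have "c^2 < 1" using c by (simp add: power_less_one_iff)
    then have "b > 0" using s2 by (simp add: b_def)
    moreover have "w \<ge> 0" using w c K mult_nonneg_nonneg[of "1 + \<sigma>^2 / 3" c] by linarith
    ultimately show ?thesis using w1 by (simp add: add_nonneg_pos)
  qed
  then have "X2 * L > 0" unfolding L .
  then show "0 < L" using X2 by (simp add: zero_less_mult_iff)
  have "X2^2 * (A^2 - 4 * \<sigma>^2 * (1 - c^2) * (1 - s^2) - L^2) = (w1^2 + b) * (w^2 + b) - (X2 * L)^2"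
  proof -
    have "X2^2 = w1^2 + b" unfolding X2_def w1_def b_def by algebra
    moreover have "A^2 - 4 * \<sigma>^2 * (1 - c^2) * (1 - s^2) = w^2 + b" unfolding A_def w_def b_def by algebra
    ultimately show ?thesis by (simp add: power_mult_distrib algebra_simps)
  qed
  also have "\<dots> = b * (w - w1)^2" unfolding L by algebra
  also have "\<dots> \<ge> 0" using b by simp
  finally show "L^2 \<le> A^2 - 4 * \<sigma>^2 * (1 - c^2) * (1 - s^2)" using X2 by (simp add: zero_le_mult_iff)
qed

text \<open>\<open>Q \<theta> \<phi>\<close> is the squared distance from the point of the unit
  sphere to the point with coordinates -\<sigma> c, \<sigma> sqrt (1 - c^2), 0 in the frame. The
  positive part cuts off the sphere at cos \<theta> = -\<sigma> c / 3, the range in which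
  \<open>tangent_minorant\<close> applies.\<close>

lemma spherical_cap_bound:
  fixes \<sigma> c :: real
  assumes \<sigma>: "0 < \<sigma>" "\<sigma> < 1" and c: "0 \<le> c" "c \<le> 1"
  defines "Q \<equiv> \<lambda>\<theta> \<phi>. 1 + \<sigma>^2 + 2 * \<sigma> * (c * cos \<theta> - sqrt (1 - c^2) * sin \<theta> * cos \<phi>)"
  shows "Q \<theta> \<phi> > 0"
    and "integral (cbox (0, 0) (pi, 2 * pi)) (\<lambda>(\<theta>, \<phi>). max 0 (3 * cos \<theta> + \<sigma> * c) * sin \<theta> / sqrt (Q \<theta> \<phi>))
      \<le> 2 * pi * ((sqrt (1 + \<sigma>^2 / 3) + 2)^2 / (3 * (sqrt (1 + \<sigma>^2 / 3) + 1)))"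
proof -
  define e where "e = sqrt (1 - c^2)"
  have e: "e^2 = 1 - c^2" "e \<ge> 0" using c by (simp_all add: e_def power_le_one)
  define A B where "A \<theta> = 1 + \<sigma>^2 + 2 * \<sigma> * c * cos \<theta>" and "B \<theta> = 2 * \<sigma> * e * sin \<theta>" for \<theta>
  have Q: "Q \<theta> \<phi> = A \<theta> - B \<theta> * cos \<phi>" for \<theta> \<phi> by (simp add: Q_def A_def B_def e_def algebra_simps)
  have AB: "\<bar>B \<theta>\<bar> < A \<theta>" for \<theta>
  proof -
    \<comment> \<open>Cauchy-Schwarz for two unit vectors of the plane; the two signs of
      \<open>t\<close> together give the bound for the absolute value.\<close>
    have "- 1 \<le> c * cos \<theta> + t * (e * sin \<theta>)" if "t^2 = 1" for t
    proof -
      have "(c * cos \<theta> + t * (e * sin \<theta>))^2 + (c * sin \<theta> - t * e * cos \<theta>)^2 = (c^2 + t^2 * e^2) * ((sin \<theta>)^2 + (cos \<theta>)^2)"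
        by algebra
      also have "\<dots> = 1" using e that by simp
      finally have "(c * cos \<theta> + t * (e * sin \<theta>))^2 \<le> 1^2"
        unfolding one_power2 using zero_le_power2[of "c * sin \<theta> - t * e * cos \<theta>"] by linarith
      then show ?thesis using abs_le_square_iff[of "c * cos \<theta> + t * (e * sin \<theta>)" 1] by linarith
    qed
    from this[of 1] this[of "-1"] have "\<bar>e * sin \<theta>\<bar> \<le> 1 + c * cos \<theta>" by (simp add: abs_le_iff)
    then have "2 * \<sigma> * \<bar>e * sin \<theta>\<bar> \<le> 2 * \<sigma> * (1 + c * cos \<theta>)" using \<sigma> by (intro mult_left_mono) auto
    moreover have "\<bar>B \<theta>\<bar> = 2 * \<sigma> * \<bar>e * sin \<theta>\<bar>" using \<sigma> by (simp add: B_def abs_mult)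
    moreover have "A \<theta> = 2 * \<sigma> * (1 + c * cos \<theta>) + (1 - \<sigma>)^2" by (simp add: A_def power2_eq_square algebra_simps)
    moreover have "(1 - \<sigma>)^2 > 0" using \<sigma> by simp
    ultimately show ?thesis by linarith
  qed
  have Qpos: "Q \<theta> \<phi> > 0" for \<theta> \<phi>
  proof -
    have "\<bar>B \<theta> * cos \<phi>\<bar> \<le> \<bar>B \<theta>\<bar> * 1" unfolding abs_mult by (intro mult_left_mono) auto
    then show ?thesis using AB[of \<theta>] unfolding Q by linarith
  qed
  then show "Q \<theta> \<phi> > 0" .
  define a where "a = \<sigma> * c / 3"
  have a: "0 \<le> a" "a \<le> 1" using \<sigma> c mult_le_one[of \<sigma> c] by (auto simp: a_def)
  define \<theta>1 where "\<theta>1 = arccos (- a)"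
  have \<theta>1: "0 \<le> \<theta>1" "\<theta>1 \<le> pi" "cos \<theta>1 = - a"
    using a by (auto simp: \<theta>1_def intro: arccos_lbound arccos_ubound cos_arccos)
  define \<kappa> where "\<kappa> \<theta> = max 0 (3 * cos \<theta> + \<sigma> * c) * sin \<theta>" for \<theta>
  define f where "f \<theta> \<phi> = \<kappa> \<theta> / sqrt (Q \<theta> \<phi>)" for \<theta> \<phi>
  have cont: "continuous_on S (\<lambda>(\<theta>, \<phi>). f \<theta> \<phi>)" for S
  proof -
    have "continuous_on S (\<lambda>t. Q (fst t) (snd t))" unfolding Q_def by (intro continuous_intros)
    moreover have "Q \<theta> \<phi> \<noteq> 0" for \<theta> \<phi> using Qpos[of \<theta> \<phi>] by simp
    ultimately show ?thesis unfolding f_def \<kappa>_def split_beta by (intro continuous_intros) auto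
  qed
  define J where "J \<theta> = integral {0..2*pi} (f \<theta>)" for \<theta>
  have contJ: "continuous_on {0..pi} J"
    unfolding J_def using integral_continuous_on_param[OF cont, of "{0..pi}" 0 "2*pi"] by simp
  have "integral (cbox (0, 0) (pi, 2 * pi)) (\<lambda>(\<theta>, \<phi>). f \<theta> \<phi>) = integral {0..pi} J"
    using integral_prod_continuous[OF cont, of 0 0 pi "2*pi"] by (simp add: J_def[abs_def])
  also have "\<dots> = integral {0..\<theta>1} J + integral {\<theta>1..pi} J"
    using \<theta>1 by (intro Henstock_Kurzweil_Integration.integral_combine[symmetric] integrable_continuous_real contJ) auto
  \<comment> \<open>Beyond \<open>\<theta>1\<close> the positive part of the weight
    vanishes.\<close>
  also have "integral {\<theta>1..pi} J = integral {\<theta>1..pi} (\<lambda>_. 0)"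
  proof (rule integral_cong)
    fix \<theta> assume "\<theta> \<in> {\<theta>1..pi}"
    then have "cos \<theta> \<le> - a" using cos_monotone_0_pi_le[of \<theta>1 \<theta>] \<theta>1 by auto
    then have "\<kappa> \<theta> = 0" by (simp add: \<kappa>_def a_def max_def)
    then have "f \<theta> = (\<lambda>_. 0)" by (simp add: f_def fun_eq_iff)
    then show "J \<theta> = 0" by (simp add: J_def)
  qed
  also have "integral {0..\<theta>1} J + integral {\<theta>1..pi} (\<lambda>_. 0::real) = integral {0..\<theta>1} J" by simp
  \<comment> \<open>The circle means are bounded by \<open>integral_inverse_sqrt_le\<close>. The
    last arguments of the two \<open>capint\<close> terms are the roots of \<open>A\<close> and of
    its minorant \<open>L\<close> at \<open>\<theta>1\<close>; at \<theta> = 0 both functions have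
    the same value.\<close>
  also have "\<dots> \<le> 2 * pi * (capint a (sqrt (1 + \<sigma>^2 + 2 * \<sigma> * c)) (sqrt (1 + \<sigma>^2 - 2 * (\<sigma> * c)^2 / 3)) / 4
      + 3 * capint a (sqrt (1 + \<sigma>^2 + 2 * \<sigma> * c))
          (sqrt (1 + \<sigma>^2 - 2 * (\<sigma> * c)^2 / 3 - 4 * \<sigma>^2 * (1 - c^2) * (1 + a) / (1 + \<sigma>^2 + 2 * \<sigma> * c))) / 4)"
  proof (rule has_integral_le)
    let ?X2 = "1 + \<sigma>^2 + 2 * \<sigma> * c" and ?A0 = "1 + \<sigma>^2 - 2 * (\<sigma> * c)^2 / 3"
    let ?L0 = "?A0 - 4 * \<sigma>^2 * (1 - c^2) * (1 + a) / ?X2"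
    let ?q = "2 * \<sigma> * c + 4 * \<sigma>^2 * (1 - c^2) / ?X2"
    have X2: "?X2 > 0" using \<sigma> c by (simp add: add_pos_nonneg)
    have A_eq: "A \<theta> = ?A0 + 2 * \<sigma> * c * (cos \<theta> + a)" for \<theta>
      by (simp add: A_def a_def power2_eq_square field_simps)
    have A1: "?A0 + 2 * \<sigma> * c * (1 + a) = ?X2"
      by (simp add: a_def power2_eq_square field_simps)
    define L where "L \<theta> = A \<theta> - 4 * \<sigma>^2 * (1 - c^2) * (1 - cos \<theta>) / ?X2" for \<theta>
    have L_eq: "L \<theta> = ?L0 + ?q * (cos \<theta> + a)" for \<theta>
    proof -
      have "(A0 + q * (z + a)) - N * (1 - z) / X = (A0 - N * (1 + a) / X) + (q + N / X) * (z + a)" for A0 q z N X :: real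
        unfolding times_divide_eq_left[symmetric] by algebra
      then show ?thesis unfolding L_def A_eq .
    qed
    have L1: "?L0 + ?q * (1 + a) = ?X2"
    proof -
      have "(A0 - N * (1 + a) / X) + (q + N / X) * (1 + a) = A0 + q * (1 + a)" for A0 q N X :: real
        unfolding times_divide_eq_left[symmetric] by algebra
      then show ?thesis using A1 by (simp only:)
    qed
    have "\<bar>\<sigma> * c\<bar> \<le> 1" using \<sigma> c mult_le_one[of \<sigma> c] by auto
    then have "(\<sigma> * c)^2 \<le> 1" by (simp add: abs_square_le_1)
    then have A0: "?A0 > 0" using zero_le_power2[of \<sigma>] by linarith
    have L\<theta>1: "?L0 = L \<theta>1" unfolding L_eq \<theta>1 by simp
    have L: "0 < L \<theta>" "(L \<theta>)^2 \<le> (A \<theta>)^2 - (B \<theta>)^2" if "\<theta> \<in> {0..\<theta>1}" for \<theta>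
    proof -
      have "cos \<theta>1 \<le> cos \<theta>" using that \<theta>1 by (intro cos_monotone_0_pi_le) auto
      then have s: "- (\<sigma> * c / 3) \<le> cos \<theta>" using \<theta>1 a_def by simp
      have "(B \<theta>)^2 = 4 * \<sigma>^2 * (1 - c^2) * (1 - (cos \<theta>)^2)"
        by (simp add: B_def power_mult_distrib e sin_squared_eq)
      then show "0 < L \<theta>" "(L \<theta>)^2 \<le> (A \<theta>)^2 - (B \<theta>)^2"
        using tangent_minorant[OF \<sigma> c s cos_le_one] by (simp_all add: L_def A_def)
    qed
    have L0: "?L0 > 0" using L(1)[of \<theta>1] \<theta>1 L\<theta>1 by simp
    show "(J has_integral integral {0..\<theta>1} J) {0..\<theta>1}"
      using \<theta>1 by (intro integrable_integral integrable_continuous_real continuous_on_subset[OF contJ]) auto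
    have hA: "((\<lambda>\<theta>. 3 * (cos \<theta> + a) * sin \<theta> / sqrt (A \<theta>)) has_integral capint a (sqrt ?X2) (sqrt ?A0)) {0..\<theta>1}"
      using has_integral_cap[OF a A0, of "2 * \<sigma> * c"] X2 unfolding A1 A_eq[symmetric] \<theta>1_def by simp
    have hL: "((\<lambda>\<theta>. 3 * (cos \<theta> + a) * sin \<theta> / sqrt (L \<theta>)) has_integral capint a (sqrt ?X2) (sqrt ?L0)) {0..\<theta>1}"
      using has_integral_cap[OF a L0, of ?q] X2 unfolding L1 L_eq[symmetric] \<theta>1_def by simp
    have "((\<lambda>\<theta>. 2 * pi * (1 / 4 * (3 * (cos \<theta> + a) * sin \<theta> / sqrt (A \<theta>)) + 3 / 4 * (3 * (cos \<theta> + a) * sin \<theta> / sqrt (L \<theta>))))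
      has_integral 2 * pi * (1 / 4 * capint a (sqrt ?X2) (sqrt ?A0) + 3 / 4 * capint a (sqrt ?X2) (sqrt ?L0))) {0..\<theta>1}"
      by (intro has_integral_mult_right has_integral_add hA hL)
    then show "((\<lambda>\<theta>. 2 * pi * (1 / 4 * (3 * (cos \<theta> + a) * sin \<theta> / sqrt (A \<theta>)) + 3 / 4 * (3 * (cos \<theta> + a) * sin \<theta> / sqrt (L \<theta>))))
      has_integral 2 * pi * (capint a (sqrt ?X2) (sqrt ?A0) / 4 + 3 * capint a (sqrt ?X2) (sqrt ?L0) / 4)) {0..\<theta>1}"
      by simp
    fix \<theta> assume \<theta>: "\<theta> \<in> {0..\<theta>1}"
    have sin: "sin \<theta> \<ge> 0" using \<theta> \<theta>1 by (intro sin_ge_zero) auto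
    have "cos \<theta>1 \<le> cos \<theta>" using \<theta> \<theta>1 by (intro cos_monotone_0_pi_le) auto
    then have ca: "cos \<theta> + a \<ge> 0" using \<theta>1 by simp
    have \<kappa>: "\<kappa> \<theta> = 3 * (cos \<theta> + a) * sin \<theta>" using ca by (simp add: \<kappa>_def a_def max_def)
    have \<kappa>0: "\<kappa> \<theta> \<ge> 0" using ca sin by (simp add: \<kappa>)
    have "J \<theta> = \<kappa> \<theta> * integral {0..2*pi} (\<lambda>\<phi>. 1 / sqrt (A \<theta> - B \<theta> * cos \<phi>))"
      unfolding J_def f_def Q by (simp flip: integral_mult_right)
    also have "\<dots> \<le> \<kappa> \<theta> * (2 * pi * (1 / (4 * sqrt (A \<theta>)) + 3 / (4 * sqrt (L \<theta>))))"
      by (intro mult_left_mono integral_inverse_sqrt_le AB L \<theta> \<kappa>0)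
    also have "\<dots> = 2 * pi * (1 / 4 * (3 * (cos \<theta> + a) * sin \<theta> / sqrt (A \<theta>)) + 3 / 4 * (3 * (cos \<theta> + a) * sin \<theta> / sqrt (L \<theta>)))"
    proof -
      have "k * (2 * pi * (1 / (4 * x) + 3 / (4 * y))) = 2 * pi * (1 / 4 * (k / x) + 3 / 4 * (k / y))" for k x y :: real
      proof -
        have "1 / (4 * x) = 1 / 4 * (1 / x)" "3 / (4 * y) = 3 / 4 * (1 / y)" "k / x = k * (1 / x)" "k / y = k * (1 / y)"
          by simp_all
        moreover have "k * (2 * pi * (1 / 4 * r + 3 / 4 * s)) = 2 * pi * (1 / 4 * (k * r) + 3 / 4 * (k * s))" for r s :: real
          by (simp add: algebra_simps)
        ultimately show ?thesis by (simp only:)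
      qed
      then show ?thesis unfolding \<kappa> .
    qed
    finally show "J \<theta> \<le> 2 * pi * (1 / 4 * (3 * (cos \<theta> + a) * sin \<theta> / sqrt (A \<theta>)) + 3 / 4 * (3 * (cos \<theta> + a) * sin \<theta> / sqrt (L \<theta>)))" .
  qed
  also have "\<dots> \<le> 2 * pi * ((sqrt (1 + \<sigma>^2 / 3) + 2)^2 / (3 * (sqrt (1 + \<sigma>^2 / 3) + 1)))"
  proof -
    have "(sqrt (1 + \<sigma>^2 + 2 * \<sigma> * c))^2 = 1 + \<sigma>^2 + 2 * \<sigma> * c"
      using \<sigma> c by simp
    then show ?thesis
      using capint_combination_le[OF \<sigma> c] by (intro mult_left_mono) (simp_all add: a_def)
  qed
  finally show "integral (cbox (0, 0) (pi, 2 * pi)) (\<lambda>(\<theta>, \<phi>). max 0 (3 * cos \<theta> + \<sigma> * c) * sin \<theta> / sqrt (Q \<theta> \<phi>))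
      \<le> 2 * pi * ((sqrt (1 + \<sigma>^2 / 3) + 2)^2 / (3 * (sqrt (1 + \<sigma>^2 / 3) + 1)))"
    by (simp add: f_def \<kappa>_def)
qed

section \<open>The gradient estimate\<close>

text \<open>With \<open>x\<close> in the half-plane spanned by \<open>e1\<close> and the nonnegative
  multiples of \<open>e2\<close>, its inner product with a point of the sphere involves the azimuth
  only through its cosine.\<close>

lemma orthonormal_frame_exists:
  fixes e1 x :: "real^3"
  assumes "norm e1 = 1"
  obtains e2 e3 where "orthonormal_frame e1 e2 e3" "x \<bullet> e3 = 0" "x \<bullet> e2 \<ge> 0"
proof -
  have e1: "e1 \<bullet> e1 = 1" using assms by (simp add: norm_eq_1)
  obtain e2 where e2: "norm e2 = 1" "e1 \<bullet> e2 = 0" "\<exists>s\<ge>0. x = (x \<bullet> e1) *\<^sub>R e1 + s *\<^sub>R e2"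
  proof (cases "x = (x \<bullet> e1) *\<^sub>R e1")
    case True
    obtain y :: "real^3" where y: "y \<noteq> 0" "orthogonal e1 y"
      using orthogonal_to_vector_exists[of e1] by auto
    show thesis
    proof (rule that[of "sgn y"])
      show "norm (sgn y) = 1" using y by (simp add: norm_sgn)
      show "e1 \<bullet> sgn y = 0" using y by (simp add: sgn_div_norm orthogonal_def)
      show "\<exists>s\<ge>0. x = (x \<bullet> e1) *\<^sub>R e1 + s *\<^sub>R sgn y" using True by (intro exI[of _ 0]) simp
    qed
  next
    case False
    define w where "w = x - (x \<bullet> e1) *\<^sub>R e1"
    have w: "w \<noteq> 0" using False by (simp add: w_def)
    show thesis
    proof (rule that[of "sgn w"])
      show "norm (sgn w) = 1" using w by (simp add: norm_sgn)
      have "e1 \<bullet> w = 0" by (simp add: w_def inner_diff_right e1 inner_commute)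
      then show "e1 \<bullet> sgn w = 0" by (simp add: sgn_div_norm)
      have "x = (x \<bullet> e1) *\<^sub>R e1 + norm w *\<^sub>R sgn w" using w by (simp add: sgn_div_norm w_def)
      then show "\<exists>s\<ge>0. x = (x \<bullet> e1) *\<^sub>R e1 + s *\<^sub>R sgn w" by (intro exI[of _ "norm w"]) simp
    qed
  qed
  obtain s where s: "s \<ge> 0" "x = (x \<bullet> e1) *\<^sub>R e1 + s *\<^sub>R e2" using e2(3) by blast
  have e22: "e2 \<bullet> e2 = 1" using e2 by (simp add: norm_eq_1)
  define e3 where "e3 = cross3 e1 e2"
  have "(norm e3)^2 + (e1 \<bullet> e2)^2 = (norm e1 * norm e2)^2" unfolding e3_def by (rule norm_cross_dot)
  then have "e3 \<bullet> e3 = 1" using e2 assms by (simp add: power2_norm_eq_inner)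
  moreover have "e1 \<bullet> e3 = 0" "e2 \<bullet> e3 = 0" by (simp_all add: e3_def dot_cross_self)
  ultimately have "orthonormal_frame e1 e2 e3" using e1 e22 e2 by unfold_locales auto
  moreover have "x \<bullet> e3 = 0"
    by (subst s(2)) (simp add: inner_add_left e3_def dot_cross_self)
  moreover have "x \<bullet> e2 = s"
    by (subst s(2)) (simp add: inner_add_left e2 e22)
  ultimately show thesis using that s by blast
qed

text \<open>\<open>k\<close> is the power of \<open>p\<close> with respect to the unit sphere, so
  the sphere of inversion meets the unit sphere orthogonally. Quantitatively, 1 minus the squared
  norm of the image is \<open>k * (1 - (norm z)^2) / (norm (z - p))^2\<close>.\<close>

lemma inversion_preserves_ball:
  fixes p z :: "'a::real_inner"
  assumes p: "norm p > 1" and z: "norm z < 1"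
  defines "k \<equiv> (norm p)^2 - 1"
  shows "norm (p + (k / (norm (z - p))^2) *\<^sub>R (z - p)) < 1"
proof -
  define n where "n = (norm (z - p))^2"
  have "z \<noteq> p" using p z by auto
  then have n: "n > 0" by (simp add: n_def)
  have "(norm p)^2 > 1^2" using p by (intro power_strict_mono) auto
  then have k: "k > 0" by (simp add: k_def)
  have n_eq: "n = (norm z)^2 - 2 * (z \<bullet> p) + (norm p)^2"
    by (simp add: n_def power2_norm_eq_inner inner_diff_left inner_diff_right inner_commute)
  have "(norm (p + (k / n) *\<^sub>R (z - p)))^2 = (norm p)^2 + 2 * (k / n) * (p \<bullet> (z - p)) + (k / n)^2 * n"
  proof -
    have "(norm (p + s *\<^sub>R w))^2 = (norm p)^2 + 2 * s * (p \<bullet> w) + s^2 * (norm w)^2" for s w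
      unfolding power2_norm_eq_inner by (simp add: inner_add_left inner_add_right inner_commute power2_eq_square algebra_simps)
    then show ?thesis unfolding n_def .
  qed
  also have "\<dots> = (norm p)^2 + 2 * (k / n) * ((z \<bullet> p) - (norm p)^2) + k * (k / n)"
  proof -
    have "p \<bullet> p = (norm p)^2" by (simp add: power2_norm_eq_inner)
    moreover have "(k / n)^2 * n = k * (k / n)" using n by (simp add: power2_eq_square)
    ultimately show ?thesis unfolding inner_diff_right by (simp only: inner_commute)
  qed
  also have "\<dots> = 1 - k * (1 - (norm z)^2) / n"
  proof -
    have "n * ((norm p)^2 + 2 * (k / n) * ((z \<bullet> p) - (norm p)^2) + k * (k / n)) = n * (norm p)^2 + 2 * k * ((z \<bullet> p) - (norm p)^2) + k * k"
      using n by (simp add: field_simps)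
    also have "\<dots> = n - k * (1 - (norm z)^2)" unfolding n_eq k_def by algebra
    also have "\<dots> = n * (1 - k * (1 - (norm z)^2) / n)" using n by (simp add: field_simps)
    finally show ?thesis using n by simp
  qed
  also have "\<dots> < 1"
  proof -
    have "(norm z)^2 < 1" using z by (simp add: power_less_one_iff)
    then show ?thesis using k n by simp
  qed
  finally have "(norm (p + (k / n) *\<^sub>R (z - p)))^2 < 1^2" by simp
  then show ?thesis unfolding n_def by (rule power2_less_imp_less) simp
qed

theorem harmonic_gradient_bound:
  fixes u :: "real^3 \<Rightarrow> real"
  assumes harm: "harmonic_with (ball 0 1) u g H" and S: "\<And>y. y \<in> ball 0 1 \<Longrightarrow> \<bar>u y\<bar> \<le> S"
    and x: "norm x < 1" "x \<noteq> 0"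
  shows "(1 - (norm x)^2) * norm (g x) \<le> S * ((sqrt (1 + (norm x)^2 / 3) + 2)^2 / (3 * (sqrt (1 + (norm x)^2 / 3) + 1)))"
proof -
  define \<rho> where "\<rho> = norm x"
  have \<rho>: "0 < \<rho>" "\<rho> < 1" using x by (auto simp: \<rho>_def)
  have \<rho>2: "\<rho>^2 < 1" using \<rho> by (simp add: power_less_one_iff)
  \<comment> \<open>The mirror point of \<open>x\<close> in the unit sphere; the inversion centred
    there that preserves the ball exchanges 0 and \<open>x\<close>.\<close>
  define p where "p = (1 / \<rho>^2) *\<^sub>R x"
  have np: "norm p = 1 / \<rho>" using \<rho> by (simp add: p_def \<rho>_def power2_eq_square)
  define k where "k = (norm p)^2 - 1"
  have k: "k = (1 - \<rho>^2) / \<rho>^2" using \<rho> by (simp add: k_def np power_divide diff_divide_distrib)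
  define T where "T z = p + (k / (norm (z - p))^2) *\<^sub>R (z - p)" for z
  have np1: "norm p > 1" using \<rho> by (simp add: np)
  have maps: "T z \<in> ball 0 1" if "z \<in> ball 0 1" for z
    using inversion_preserves_ball[OF np1, of z] that by (simp add: T_def k_def)
  have pb: "p \<notin> ball 0 1" using np1 by simp
  define v where "v z = u (T z) / norm (z - p)" for z
  define G where "G z = (k / norm (z - p)^3) *\<^sub>R g (T z)
        - (2 * k * (g (T z) \<bullet> (z - p)) / norm (z - p)^5 + u (T z) / norm (z - p)^3) *\<^sub>R (z - p)" for z
  obtain H' where v: "harmonic_with (ball 0 1) v G H'"
    using kelvin_transform[OF harm _ pb, of k] maps unfolding v_def[abs_def] G_def[abs_def] T_def[abs_def] by auto
  \<comment> \<open>The transform \<open>N\<close> of the constant 1 serves twice: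
    \<open>S * N\<close> is the majorant of the absolute value of \<open>v\<close>, and the moment
    identity for \<open>N\<close> removes the linear part of the absolute value.\<close>
  have one: "harmonic_with (ball 0 1) (\<lambda>_. 1) (\<lambda>_. 0) (\<lambda>_ _. 0 :: real^3)"
    by (simp add: harmonic_with_def)
  define N where "N z = 1 / norm (z - p)" for z
  define GN where "GN z = - (1 / norm (z - p)^3) *\<^sub>R (z - p)" for z
  obtain HN where N: "harmonic_with (ball 0 1) N GN HN"
    using kelvin_transform[OF one _ pb, of k] maps unfolding N_def[abs_def] GN_def[abs_def] T_def[abs_def] by auto
  have pn: "norm (0 - p) = 1 / \<rho>" by (simp add: np)
  have T0: "T 0 = x"
  proof -
    have kp: "k / (norm (0 - p))^2 = 1 - \<rho>^2" unfolding pn k using \<rho> by (simp add: field_simps)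
    have "T 0 = \<rho>^2 *\<^sub>R p" unfolding T_def kp by (simp add: algebra_simps)
    then show ?thesis using \<rho> by (simp add: p_def)
  qed
  have v0: "v 0 = \<rho> * u x" unfolding v_def T0 pn by simp
  have N0: "N 0 = \<rho>" unfolding N_def pn by simp
  have GN0: "GN 0 = \<rho> *\<^sub>R x" unfolding GN_def pn unfolding p_def using \<rho> by (simp add: field_simps power2_eq_square power3_eq_cube)
  \<comment> \<open>The reflection of \<open>g x\<close> in the plane orthogonal to
    \<open>x\<close>, which is the direction part of the derivative of the inversion at 0; it
    preserves the norm.\<close>
  define Rg where "Rg = g x - (2 * (g x \<bullet> x) / \<rho>^2) *\<^sub>R x"
  have G0: "G 0 = (\<rho> * (1 - \<rho>^2)) *\<^sub>R Rg + (\<rho> * u x) *\<^sub>R x"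
  proof -
    have c1: "k / (1 / \<rho>)^3 = \<rho> * (1 - \<rho>^2)" unfolding k using \<rho> by (simp add: field_simps eval_nat_numeral)
    have c2: "2 * k * (g x \<bullet> (0 - p)) / (1 / \<rho>)^5 + u x / (1 / \<rho>)^3 = - (2 * \<rho> * (1 - \<rho>^2) * (g x \<bullet> x)) + \<rho>^3 * u x"
      unfolding k p_def using \<rho> by (simp add: field_simps eval_nat_numeral)
    have "(- (2 * \<rho> * (1 - \<rho>^2) * (g x \<bullet> x)) + \<rho>^3 * u x) * (1 / \<rho>^2) = \<rho> * u x - \<rho> * (1 - \<rho>^2) * (2 * (g x \<bullet> x) / \<rho>^2)"
      using \<rho> by (simp add: field_simps power2_eq_square power3_eq_cube)
    moreover have "a *\<^sub>R v - X *\<^sub>R (0 - y *\<^sub>R x) = a *\<^sub>R (v - b *\<^sub>R x) + c *\<^sub>R x" if "X * y = c - a * b"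
      for a b c X y :: real and v :: "real^3"
    proof -
      have "X *\<^sub>R (y *\<^sub>R x) = (c - a * b) *\<^sub>R x" by (simp flip: that)
      then show ?thesis by (simp add: scaleR_diff_right scaleR_diff_left)
    qed
    ultimately show ?thesis unfolding G_def T0 pn c1 c2 unfolding Rg_def p_def by blast
  qed
  have normRg: "norm Rg = norm (g x)"
  proof -
    have xx: "x \<bullet> x = \<rho>^2" by (simp add: \<rho>_def power2_norm_eq_inner)
    have "Rg \<bullet> Rg = g x \<bullet> g x - 2 * (2 * (g x \<bullet> x) / \<rho>^2) * (g x \<bullet> x) + (2 * (g x \<bullet> x) / \<rho>^2)^2 * \<rho>^2"
      unfolding Rg_def
      by (simp add: inner_diff_left inner_diff_right inner_commute xx power2_eq_square)
    also have "\<dots> = g x \<bullet> g x" using \<rho> by (simp add: field_simps power2_eq_square)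
    finally show ?thesis by (simp add: norm_eq_sqrt_inner)
  qed
  \<comment> \<open>The sign of the axis is free since only the absolute value of the moment is
    estimated. It is chosen such that the cosine \<open>c\<close> below is nonnegative, as
    \<open>spherical_cap_bound\<close> requires.\<close>
  obtain e1 where e1: "norm e1 = 1" "x \<bullet> e1 \<le> 0" "\<bar>Rg \<bullet> e1\<bar> = norm (g x)"
  proof -
    obtain d :: "real^3" where d: "norm d = 1" "\<bar>Rg \<bullet> d\<bar> = norm Rg"
    proof (cases "Rg = 0")
      case True
      then show thesis using that[of "axis 1 1"] by simp
    next
      case False
      then show thesis using that[of "sgn Rg"]
        by (simp add: norm_sgn sgn_div_norm power2_norm_eq_inner[symmetric] power2_eq_square)
    qed
    show thesis
    proof (cases "x \<bullet> d \<le> 0")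
      case True then show thesis using that[of d] d normRg by simp
    next
      case False then show thesis using that[of "- d"] d normRg by simp
    qed
  qed
  obtain e2 e3 where fr: "orthonormal_frame e1 e2 e3" and xe: "x \<bullet> e3 = 0" "x \<bullet> e2 \<ge> 0"
    using orthonormal_frame_exists[OF e1(1), of x] by blast
  interpret orthonormal_frame e1 e2 e3 by (rule fr)
  define c where "c = - (x \<bullet> e1) / \<rho>"
  have xe1: "x \<bullet> e1 = - (\<rho> * c)" using \<rho> by (simp add: c_def)
  have c0: "0 \<le> c" using e1 \<rho> by (simp add: c_def divide_nonpos_pos)
  have sq: "\<rho>^2 = (\<rho> * c)^2 + (x \<bullet> e2)^2"
  proof -
    have "x \<bullet> x = \<rho>^2" by (simp add: \<rho>_def power2_norm_eq_inner)
    then show ?thesis using inner_expand[of x x] unfolding xe xe1 by (simp add: power2_eq_square)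
  qed
  then have "(\<rho> * c)^2 \<le> \<rho>^2" by simp
  then have "\<rho> * c \<le> \<rho>" using \<rho> by (rule_tac power2_le_imp_le) auto
  then have c1: "c \<le> 1" using \<rho> by simp
  have xe2: "x \<bullet> e2 = \<rho> * sqrt (1 - c^2)"
  proof -
    have "(x \<bullet> e2)^2 = (\<rho> * sqrt (1 - c^2))^2"
      using sq c0 c1 by (simp add: power_mult_distrib power_le_one algebra_simps)
    then show ?thesis using xe \<rho> c0 c1 by (simp add: power_le_one)
  qed
  define Tb where "Tb \<sigma> = (sqrt (1 + \<sigma>^2 / 3) + 2)^2 / (3 * (sqrt (1 + \<sigma>^2 / 3) + 1))" for \<sigma>
  text \<open>\<open>v\<close> need not extend to the closed ball, so the mean value properties are used on spheres of
    radius \<open>r < 1\<close>; these give the bound for \<open>r * \<rho>\<close> in place of \<open>\<rho>\<close>.\<close>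
  have bound: "r * ((1 - \<rho>^2) * norm (g x)) \<le> S * Tb (r * \<rho>)" if r: "0 < r" "r < 1" for r
  proof -
    define \<sigma> where "\<sigma> = r * \<rho>"
    have \<sigma>: "0 < \<sigma>" "\<sigma> < 1" using r \<rho> mult_strict_mono[of r 1 \<rho> 1] by (auto simp: \<sigma>_def)
    \<comment> \<open>The constant term is fixed by the cancellation of \<open>u x\<close>: it
      compensates the contribution of the \<open>u x\<close> term in \<open>G 0\<close>. The same
      choice gives moment zero for \<open>N\<close>.\<close>
    define \<kappa> where "\<kappa> \<theta> = 3 * cos \<theta> + \<sigma> * c" for \<theta>
    have inb: "r *\<^sub>R sph \<theta> \<phi> \<in> ball 0 1" for \<theta> \<phi> using r by simp
    have contw: "continuous_on sphere_box (\<lambda>t. w (r *\<^sub>R sph (fst t) (snd t)))" if w: "harmonic_with (ball 0 1) w Gw Hw" for w Gw Hw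
    proof -
      have "continuous_on (ball 0 1) w"
        using w unfolding harmonic_with_def by (meson continuous_at_imp_continuous_on has_derivative_continuous)
      then show ?thesis
        by (rule continuous_on_compose2) (use inb in \<open>auto intro!: continuous_intros\<close>)
    qed
    have moment: "integral sphere_box (\<lambda>(\<theta>, \<phi>). w (r *\<^sub>R sph \<theta> \<phi>) * (\<kappa> \<theta> * sin \<theta>)) = 4 * pi * r * (Gw 0 \<bullet> e1 + \<rho> * c * w 0)"
      if w: "harmonic_with (ball 0 1) w Gw Hw" for w Gw Hw
    proof -
      have i1: "(\<lambda>(\<theta>, \<phi>). w (r *\<^sub>R sph \<theta> \<phi>) * cos \<theta> * sin \<theta>) integrable_on sphere_box"
        and i2: "(\<lambda>(\<theta>, \<phi>). w (r *\<^sub>R sph \<theta> \<phi>) * sin \<theta>) integrable_on sphere_box"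
        unfolding split_beta by (intro integrable_continuous continuous_intros contw[OF w])+
      have "integral sphere_box (\<lambda>(\<theta>, \<phi>). w (r *\<^sub>R sph \<theta> \<phi>) * (\<kappa> \<theta> * sin \<theta>))
        = integral sphere_box (\<lambda>t. 3 * (case t of (\<theta>, \<phi>) \<Rightarrow> w (r *\<^sub>R sph \<theta> \<phi>) * cos \<theta> * sin \<theta>) + \<sigma> * c * (case t of (\<theta>, \<phi>) \<Rightarrow> w (r *\<^sub>R sph \<theta> \<phi>) * sin \<theta>))"
        by (rule integral_cong) (auto simp: \<kappa>_def algebra_simps)
      also have "\<dots> = 3 * integral sphere_box (\<lambda>(\<theta>, \<phi>). w (r *\<^sub>R sph \<theta> \<phi>) * cos \<theta> * sin \<theta>) + \<sigma> * c * integral sphere_box (\<lambda>(\<theta>, \<phi>). w (r *\<^sub>R sph \<theta> \<phi>) * sin \<theta>)"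
        by (subst integral_add) (simp_all only: integrable_on_mult_right i1 i2 integral_mult_right)
      also have "\<dots> = 4 * pi * r * (Gw 0 \<bullet> e1 + \<rho> * c * w 0)"
        unfolding sphere_mean[OF w r] sphere_first_moment[OF w r] \<sigma>_def by (simp add: algebra_simps)
      finally show ?thesis .
    qed
    have Iv: "integral sphere_box (\<lambda>(\<theta>, \<phi>). v (r *\<^sub>R sph \<theta> \<phi>) * (\<kappa> \<theta> * sin \<theta>)) = 4 * pi * r * \<rho> * (1 - \<rho>^2) * (Rg \<bullet> e1)"
      unfolding moment[OF v] v0 G0 by (simp add: inner_add_left xe1 algebra_simps)
    have IN: "integral sphere_box (\<lambda>(\<theta>, \<phi>). N (r *\<^sub>R sph \<theta> \<phi>) * (\<kappa> \<theta> * sin \<theta>)) = 0"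
      unfolding moment[OF N] N0 GN0 by (simp add: xe1)
    have S0: "0 \<le> S" using S[of 0] by simp
    have contN: "continuous_on sphere_box (\<lambda>t. N (r *\<^sub>R sph (fst t) (snd t)))" by (rule contw[OF N])
    \<comment> \<open>The absolute value of \<open>\<kappa>\<close> is written as twice its positive
      part minus \<open>\<kappa>\<close>; the subtracted term integrates to zero by
      \<open>IN\<close>.\<close>
    have "\<bar>integral sphere_box (\<lambda>(\<theta>, \<phi>). v (r *\<^sub>R sph \<theta> \<phi>) * (\<kappa> \<theta> * sin \<theta>))\<bar>
      \<le> integral sphere_box (\<lambda>t. S * (2 * (case t of (\<theta>, \<phi>) \<Rightarrow> N (r *\<^sub>R sph \<theta> \<phi>) * (max 0 (\<kappa> \<theta>) * sin \<theta>)) - (case t of (\<theta>, \<phi>) \<Rightarrow> N (r *\<^sub>R sph \<theta> \<phi>) * (\<kappa> \<theta> * sin \<theta>))))"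
      unfolding real_norm_def[symmetric]
    proof (rule integral_norm_bound_integral)
      show "(\<lambda>(\<theta>, \<phi>). v (r *\<^sub>R sph \<theta> \<phi>) * (\<kappa> \<theta> * sin \<theta>)) integrable_on sphere_box"
        unfolding split_beta \<kappa>_def by (intro integrable_continuous continuous_intros contw[OF v])
      show "(\<lambda>t. S * (2 * (case t of (\<theta>, \<phi>) \<Rightarrow> N (r *\<^sub>R sph \<theta> \<phi>) * (max 0 (\<kappa> \<theta>) * sin \<theta>)) - (case t of (\<theta>, \<phi>) \<Rightarrow> N (r *\<^sub>R sph \<theta> \<phi>) * (\<kappa> \<theta> * sin \<theta>)))) integrable_on sphere_box"
        unfolding split_beta \<kappa>_def by (intro integrable_continuous continuous_intros contN)
      fix t assume "t \<in> sphere_box"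
      then obtain \<theta> \<phi> where t: "t = (\<theta>, \<phi>)" and \<theta>: "0 \<le> \<theta>" "\<theta> \<le> pi" by (cases t) (auto simp: cbox_Pair_eq)
      define z where "z = r *\<^sub>R sph \<theta> \<phi>"
      have sin: "sin \<theta> \<ge> 0" using \<theta> by (rule sin_ge_zero)
      have "\<bar>v z\<bar> \<le> S * N z"
      proof -
        have "\<bar>u (T z)\<bar> \<le> S" using S maps inb by (simp add: z_def)
        then show ?thesis by (simp add: v_def N_def divide_right_mono)
      qed
      then have "\<bar>v z\<bar> * (\<bar>\<kappa> \<theta>\<bar> * sin \<theta>) \<le> S * N z * (\<bar>\<kappa> \<theta>\<bar> * sin \<theta>)"
        using sin by (intro mult_right_mono) auto
      moreover have "norm (v z * (\<kappa> \<theta> * sin \<theta>)) = \<bar>v z\<bar> * (\<bar>\<kappa> \<theta>\<bar> * sin \<theta>)"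
        using sin by (simp add: abs_mult)
      moreover have "\<bar>\<kappa> \<theta>\<bar> = 2 * max 0 (\<kappa> \<theta>) - \<kappa> \<theta>" by (simp add: max_def abs_if)
      ultimately have "norm (v z * (\<kappa> \<theta> * sin \<theta>)) \<le> S * N z * ((2 * max 0 (\<kappa> \<theta>) - \<kappa> \<theta>) * sin \<theta>)" by simp
      also have "\<dots> = S * (2 * (N z * (max 0 (\<kappa> \<theta>) * sin \<theta>)) - N z * (\<kappa> \<theta> * sin \<theta>))"
        by (simp add: algebra_simps)
      finally show "norm (case t of (\<theta>, \<phi>) \<Rightarrow> v (r *\<^sub>R sph \<theta> \<phi>) * (\<kappa> \<theta> * sin \<theta>))
         \<le> S * (2 * (case t of (\<theta>, \<phi>) \<Rightarrow> N (r *\<^sub>R sph \<theta> \<phi>) * (max 0 (\<kappa> \<theta>) * sin \<theta>)) - (case t of (\<theta>, \<phi>) \<Rightarrow> N (r *\<^sub>R sph \<theta> \<phi>) * (\<kappa> \<theta> * sin \<theta>)))"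
        unfolding t prod.case z_def .
    qed
    also have "\<dots> = S * (2 * integral sphere_box (\<lambda>(\<theta>, \<phi>). N (r *\<^sub>R sph \<theta> \<phi>) * (max 0 (\<kappa> \<theta>) * sin \<theta>)) - integral sphere_box (\<lambda>(\<theta>, \<phi>). N (r *\<^sub>R sph \<theta> \<phi>) * (\<kappa> \<theta> * sin \<theta>)))"
    proof -
      have i1: "(\<lambda>(\<theta>, \<phi>). N (r *\<^sub>R sph \<theta> \<phi>) * (max 0 (\<kappa> \<theta>) * sin \<theta>)) integrable_on sphere_box"
        and i2: "(\<lambda>(\<theta>, \<phi>). N (r *\<^sub>R sph \<theta> \<phi>) * (\<kappa> \<theta> * sin \<theta>)) integrable_on sphere_box"
        unfolding split_beta \<kappa>_def by (intro integrable_continuous continuous_intros contN)+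
      show ?thesis unfolding integral_mult_right
        by (subst integral_diff) (simp_all only: integrable_on_mult_right i1 i2 integral_mult_right)
    qed
    also have "integral sphere_box (\<lambda>(\<theta>, \<phi>). N (r *\<^sub>R sph \<theta> \<phi>) * (max 0 (\<kappa> \<theta>) * sin \<theta>))
      = integral sphere_box (\<lambda>t. \<rho> * (case t of (\<theta>, \<phi>) \<Rightarrow> max 0 (3 * cos \<theta> + \<sigma> * c) * sin \<theta> / sqrt (1 + \<sigma>^2 + 2 * \<sigma> * (c * cos \<theta> - sqrt (1 - c^2) * sin \<theta> * cos \<phi>))))"
    proof (rule integral_cong)
      fix t :: "real \<times> real"
      obtain \<theta> \<phi> where t: "t = (\<theta>, \<phi>)" by force
      let ?Q = "1 + \<sigma>^2 + 2 * \<sigma> * (c * cos \<theta> - sqrt (1 - c^2) * sin \<theta> * cos \<phi>)"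
      have sx: "sph \<theta> \<phi> \<bullet> x = - (\<rho> * c * cos \<theta>) + \<rho> * sqrt (1 - c^2) * sin \<theta> * cos \<phi>"
        using xe xe1 xe2 by (simp add: sph_def inner_add_left inner_commute[of _ x] algebra_simps)
      have "(norm (r *\<^sub>R sph \<theta> \<phi> - p))^2 = r^2 - 2 * r * (sph \<theta> \<phi> \<bullet> x) / \<rho>^2 + 1 / \<rho>^2"
        using np \<rho> unfolding power2_norm_eq_inner[of "_ - _"] inner_diff_left inner_diff_right
        by (simp add: sph_inner_self p_def inner_commute power2_norm_eq_inner[symmetric] \<rho>_def[symmetric] power2_eq_square field_simps)
      also have "\<dots> = ?Q / \<rho>^2" unfolding sx using \<rho> by (simp add: \<sigma>_def power2_eq_square field_simps)
      finally have "norm (r *\<^sub>R sph \<theta> \<phi> - p) = sqrt (?Q / \<rho>^2)"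
        by (metis norm_ge_zero real_sqrt_unique)
      then have "norm (r *\<^sub>R sph \<theta> \<phi> - p) = sqrt ?Q / \<rho>" using \<rho> by (simp add: real_sqrt_divide)
      then show "(case t of (\<theta>, \<phi>) \<Rightarrow> N (r *\<^sub>R sph \<theta> \<phi>) * (max 0 (\<kappa> \<theta>) * sin \<theta>))
        = \<rho> * (case t of (\<theta>, \<phi>) \<Rightarrow> max 0 (3 * cos \<theta> + \<sigma> * c) * sin \<theta> / sqrt (1 + \<sigma>^2 + 2 * \<sigma> * (c * cos \<theta> - sqrt (1 - c^2) * sin \<theta> * cos \<phi>)))"
        unfolding t prod.case by (simp add: N_def \<kappa>_def)
    qed
    also have "\<dots> = \<rho> * integral sphere_box (\<lambda>(\<theta>, \<phi>). max 0 (3 * cos \<theta> + \<sigma> * c) * sin \<theta> / sqrt (1 + \<sigma>^2 + 2 * \<sigma> * (c * cos \<theta> - sqrt (1 - c^2) * sin \<theta> * cos \<phi>)))"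
      by (rule integral_mult_right)
    also have "S * (2 * (\<rho> * integral sphere_box (\<lambda>(\<theta>, \<phi>). max 0 (3 * cos \<theta> + \<sigma> * c) * sin \<theta> / sqrt (1 + \<sigma>^2 + 2 * \<sigma> * (c * cos \<theta> - sqrt (1 - c^2) * sin \<theta> * cos \<phi>)))) - integral sphere_box (\<lambda>(\<theta>, \<phi>). N (r *\<^sub>R sph \<theta> \<phi>) * (\<kappa> \<theta> * sin \<theta>)))
       \<le> S * (2 * (\<rho> * (2 * pi * Tb \<sigma>)) - 0)"
      unfolding IN Tb_def using S0 \<rho> spherical_cap_bound(2)[OF \<sigma> c0 c1]
      by (intro mult_left_mono diff_right_mono) auto
    finally have "\<bar>4 * pi * r * \<rho> * (1 - \<rho>^2) * (Rg \<bullet> e1)\<bar> \<le> S * (2 * (\<rho> * (2 * pi * Tb \<sigma>)))"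
      unfolding Iv by simp
    moreover have "\<bar>4 * pi * r * \<rho> * (1 - \<rho>^2) * (Rg \<bullet> e1)\<bar> = (4 * pi * \<rho>) * (r * ((1 - \<rho>^2) * norm (g x)))"
      using r \<rho> \<rho>2 e1(3) by (simp add: abs_mult)
    moreover have "S * (2 * (\<rho> * (2 * pi * Tb \<sigma>))) = (4 * pi * \<rho>) * (S * Tb \<sigma>)" by simp
    ultimately have "(4 * pi * \<rho>) * (r * ((1 - \<rho>^2) * norm (g x))) \<le> (4 * pi * \<rho>) * (S * Tb \<sigma>)" by linarith
    then show ?thesis using \<rho> by (simp add: \<sigma>_def)
  qed
  have lim: "((\<lambda>r. r * ((1 - \<rho>^2) * norm (g x))) \<longlongrightarrow> 1 * ((1 - \<rho>^2) * norm (g x))) (at_left 1)"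
    by (intro tendsto_intros)
  have "1 + (1 * \<rho>)^2 / 3 \<ge> 0" by simp
  then have ne: "3 * (sqrt (1 + (1 * \<rho>)^2 / 3) + 1) \<noteq> 0" by (smt (verit) real_sqrt_ge_zero)
  have lim2: "((\<lambda>r. S * Tb (r * \<rho>)) \<longlongrightarrow> S * Tb (1 * \<rho>)) (at_left 1)"
    unfolding Tb_def by (intro tendsto_intros ne) simp_all
  have "eventually (\<lambda>r. r * ((1 - \<rho>^2) * norm (g x)) \<le> S * Tb (r * \<rho>)) (at_left 1)"
    unfolding eventually_at_left_field using bound by (intro exI[of _ 0]) auto
  then have "1 * ((1 - \<rho>^2) * norm (g x)) \<le> S * Tb (1 * \<rho>)"
    using tendsto_le[OF _ lim2 lim] by simp
  then show ?thesis by (simp add: Tb_def \<rho>_def)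
qed

section \<open>Partial derivatives against gradient fields, and harmonic functions given by
  integrals\<close>

lemma Basis_real3: "(Basis :: (real^3) set) = range (\<lambda>i. axis i 1)"
  by (auto simp: Basis_vec_def)

lemma sum_Basis_real3: "(\<Sum>b\<in>(Basis :: (real^3) set). f b) = (\<Sum>i\<in>UNIV. f (axis i 1))"
  unfolding Basis_real3 by (subst sum.reindex) (auto simp: inj_on_def axis_eq_axis)

lemma partial_eq:
  assumes "(f has_derivative f') (at x)"
  shows "partial i f x = f' (axis i 1)"
  using frechet_derivative_at[OF assms] by (simp add: partial_def)

lemma harmonic_with_partial:
  assumes S: "open S" and harm: "harmonic_with S u g H" and x: "x \<in> S"
  shows "partial i u x = g x $ i"
    and "(partial i u has_derivative (\<lambda>h. H x h $ i)) (at x)"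
proof -
  have p: "partial i u y = g y $ i" if "y \<in> S" for y
    using harm that by (subst partial_eq[where f' = "\<lambda>h. g y \<bullet> h"]) (auto simp: harmonic_with_def inner_axis)
  then show "partial i u x = g x $ i" using x by blast
  have "((\<lambda>y. g y $ i) has_derivative (\<lambda>h. H x h $ i)) (at x)"
    using harm x by (intro bounded_linear.has_derivative[OF bounded_linear_vec_nth]) (auto simp: harmonic_with_def)
  then show "(partial i u has_derivative (\<lambda>h. H x h $ i)) (at x)"
    by (rule has_derivative_transform_within_open[OF _ S x]) (simp add: p)
qed

lemma harmonic_with_imp_harmonic_on:
  assumes S: "open S" and harm: "harmonic_with S u g H"
  shows "harmonic_on S u" and "\<And>x. x \<in> S \<Longrightarrow> grad u x = g x"
proof -
  note p = harmonic_with_partial[OF S harm]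
  have pp: "partial j (partial i u) x = H x (axis j 1) $ i" if "x \<in> S" for i j x
    by (rule partial_eq[OF p(2)[OF that]])
  have "laplacian u x = 0" if "x \<in> S" for x
  proof -
    have "laplacian u x = (\<Sum>b\<in>Basis. H x b \<bullet> b)"
      unfolding laplacian_def sum_Basis_real3 by (simp add: pp[OF that] inner_axis)
    then show ?thesis using harm that by (simp add: harmonic_with_def)
  qed
  moreover have "continuous_on S (partial j (partial i u))" for i j
  proof -
    have "continuous_on S (\<lambda>x. H x (axis j 1) $ i)"
      using harm by (intro continuous_on_component) (simp add: harmonic_with_def)
    then show ?thesis by (simp add: pp cong: continuous_on_cong)
  qed
  moreover have "u differentiable (at x)" "partial i u differentiable (at x)" if "x \<in> S" for i x
    using harm that p(2)[OF that, of i] by (auto simp: harmonic_with_def differentiable_def)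
  ultimately show "harmonic_on S u" by (simp add: harmonic_on_def)
  show "grad u x = g x" if "x \<in> S" for x
    using p(1)[OF that] by (simp add: grad_def vec_eq_iff)
qed

text \<open>The Hessian is assembled from the derivatives of the partial derivatives. By linearity
  its value in a fixed direction is a finite combination of second partial derivatives, whose
  continuity is part of \<open>harmonic_on\<close>.\<close>

lemma harmonic_on_imp_harmonic_with:
  assumes harm: "harmonic_on S u"
  obtains H where "harmonic_with S u (grad u) H"
proof -
  have lin: "f' h = (\<Sum>i\<in>UNIV. h $ i * f' (axis i 1))" if "linear f'" for f' :: "real^3 \<Rightarrow> real" and h
  proof -
    have "f' h = f' (\<Sum>b\<in>Basis. (h \<bullet> b) *\<^sub>R b)" by (simp add: euclidean_representation)
    also have "\<dots> = (\<Sum>b\<in>Basis. (h \<bullet> b) * f' b)" using that by (simp add: linear_sum linear_scale)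
    finally show ?thesis unfolding sum_Basis_real3 by (simp add: inner_axis)
  qed
  define H where "H x h = (\<chi> i. frechet_derivative (partial i u) (at x) h)" for x h
  have du: "(u has_derivative frechet_derivative u (at x))(at x)"
    and dp: "(partial i u has_derivative frechet_derivative (partial i u) (at x)) (at x)" if "x \<in> S" for x i
    using harm that by (auto simp: harmonic_on_def frechet_derivative_works)
  have "(u has_derivative (\<lambda>h. grad u x \<bullet> h)) (at x)" if "x \<in> S" for x
  proof -
    have "frechet_derivative u (at x) h = grad u x \<bullet> h" for h
      by (subst lin[OF has_derivative_linear[OF du[OF that]]])
         (simp add: inner_vec_def grad_def partial_def mult.commute)
    then have "frechet_derivative u (at x) = (\<lambda>h. grad u x \<bullet> h)" by auto
    then show ?thesis using du[OF that] by simp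
  qed
  moreover have "(grad u has_derivative H x) (at x)" if "x \<in> S" for x
  proof (subst has_derivative_componentwise_within, rule ballI)
    fix b :: "real^3" assume "b \<in> Basis"
    then obtain i where b: "b = axis i 1" unfolding Basis_real3 by auto
    show "((\<lambda>y. grad u y \<bullet> b) has_derivative (\<lambda>h. H x h \<bullet> b)) (at x)"
      using dp[OF that, of i] by (simp add: b grad_def H_def inner_axis)
  qed
  moreover have "continuous_on S (\<lambda>x. H x h)" for h
  proof -
    have "continuous_on S (\<lambda>x. \<chi> i. \<Sum>j\<in>UNIV. h $ j * partial j (partial i u) x)"
      using harm by (intro continuous_on_vec_lambda continuous_intros) (auto simp: harmonic_on_def)
    moreover have "(\<chi> i. \<Sum>j\<in>UNIV. h $ j * partial j (partial i u) x) = H x h" if "x \<in> S" for x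
      unfolding H_def by (subst lin[OF has_derivative_linear[OF dp[OF that]]]) (simp add: partial_def)
    ultimately show ?thesis by (simp cong: continuous_on_cong)
  qed
  moreover have "(\<Sum>b\<in>Basis. H x b \<bullet> b) = 0" if "x \<in> S" for x
    using harm that unfolding sum_Basis_real3
    by (simp add: H_def inner_axis harmonic_on_def laplacian_def partial_def)
  ultimately have "harmonic_with S u (grad u) H" by (simp add: harmonic_with_def)
  then show thesis by (rule that)
qed

text \<open>Differentiation under the integral sign, once for the function and once for its
  gradient; the trace commutes with the integral. It makes Poisson integrals harmonic.\<close>

lemma harmonic_with_integral:
  fixes K :: "'a::euclidean_space \<Rightarrow> 'b::euclidean_space \<Rightarrow> real"
  assumes S: "open S" "convex S"
    and harm: "\<And>t. t \<in> cbox a b \<Longrightarrow> harmonic_with S (\<lambda>y. K y t) (\<lambda>y. G y t) (\<lambda>y. H y t)"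
    and contK: "continuous_on (S \<times> cbox a b) (\<lambda>(y, t). K y t)"
    and contG: "continuous_on (S \<times> cbox a b) (\<lambda>(y, t). G y t)"
    and contH: "\<And>h. continuous_on (S \<times> cbox a b) (\<lambda>(y, t). H y t h)"
  shows "harmonic_with S (\<lambda>y. integral (cbox a b) (K y)) (\<lambda>y. integral (cbox a b) (G y))
    (\<lambda>y h. integral (cbox a b) (\<lambda>t. H y t h))"
proof -
  have slice: "continuous_on (cbox a b) (f y)" if "continuous_on (S \<times> cbox a b) (\<lambda>(y, t). f y t)" "y \<in> S"
    for f :: "'a \<Rightarrow> 'b \<Rightarrow> 'c::real_normed_vector" and y
  proof -
    have "continuous_on (cbox a b) (\<lambda>t. (y, t))" by (intro continuous_intros)
    from continuous_on_compose2[OF that(1) this] that(2) show ?thesis by auto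
  qed
  have intgr: "f y integrable_on cbox a b" if "continuous_on (S \<times> cbox a b) (\<lambda>(y, t). f y t)" "y \<in> S"
    for f :: "'a \<Rightarrow> 'b \<Rightarrow> 'c::banach" and y
    using slice[OF that] by (rule integrable_continuous)
  have deriv: "((\<lambda>y. integral (cbox a b) (f y)) has_derivative (\<lambda>h. integral (cbox a b) (\<lambda>t. f' y t h))) (at y)"
    if y: "y \<in> S" and contf: "continuous_on (S \<times> cbox a b) (\<lambda>(y, t). f y t)"
      and d: "\<And>y t. y \<in> S \<Longrightarrow> t \<in> cbox a b \<Longrightarrow> ((\<lambda>y. f y t) has_derivative f' y t) (at y)"
      and contf': "\<And>h. continuous_on (S \<times> cbox a b) (\<lambda>(y, t). f' y t h)"
    for f :: "'a \<Rightarrow> 'b \<Rightarrow> 'c::euclidean_space" and f' y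
  proof -
    \<comment> \<open>\<open>leibniz_rule\<close> expects the derivative as a continuous family of
      bounded linear operators. In finite dimension continuity in each basis direction is enough for
      that.\<close>
    define F where "F y t = Blinfun (f' y t)" for y t
    have F: "blinfun_apply (F y t) = f' y t" if "y \<in> S" "t \<in> cbox a b" for y t
      unfolding F_def using d[OF that] by (intro bounded_linear_Blinfun_apply) (rule has_derivative_bounded_linear)
    have contF: "continuous_on (S \<times> cbox a b) (\<lambda>(y, t). F y t)"
    proof (rule continuous_on_blinfun_componentwise)
      fix i :: 'a
      have "continuous_on (S \<times> cbox a b) (\<lambda>z. f' (fst z) (snd z) i)"
        using contf'[of i] by (simp add: split_beta)
      then show "continuous_on (S \<times> cbox a b) (\<lambda>z. blinfun_apply (case z of (y, t) \<Rightarrow> F y t) i)"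
        by (rule continuous_on_eq) (auto simp: F)
    qed
    have "((\<lambda>y. integral (cbox a b) (f y)) has_derivative integral (cbox a b) (F y)) (at y within S)"
      using y S contF
    proof (intro leibniz_rule)
      show "((\<lambda>y. f y t) has_derivative blinfun_apply (F y t)) (at y within S)" if "y \<in> S" "t \<in> cbox a b" for y t
        using d[OF that] F[OF that] by (simp add: has_derivative_at_withinI)
      show "f y integrable_on cbox a b" if "y \<in> S" for y by (rule intgr[OF contf that])
    qed
    then have "((\<lambda>y. integral (cbox a b) (f y)) has_derivative integral (cbox a b) (F y)) (at y)"
      by (simp only: at_within_open[OF y S(1)])
    moreover have "blinfun_apply (integral (cbox a b) (F y)) = (\<lambda>h. integral (cbox a b) (\<lambda>t. f' y t h))"
    proof
      fix h
      have "integral (cbox a b) ((\<lambda>L. blinfun_apply L h) \<circ> F y) = blinfun_apply (integral (cbox a b) (F y)) h"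
        by (rule integral_linear[OF intgr[OF contF y] blinfun.bounded_linear_left])
      moreover have "integral (cbox a b) ((\<lambda>L. blinfun_apply L h) \<circ> F y) = integral (cbox a b) (\<lambda>t. f' y t h)"
        by (rule integral_cong) (simp add: F[OF y])
      ultimately show "blinfun_apply (integral (cbox a b) (F y)) h = integral (cbox a b) (\<lambda>t. f' y t h)" by simp
    qed
    ultimately show ?thesis by (simp only:)
  qed
  have inner: "integral (cbox a b) (\<lambda>t. f t \<bullet> h) = integral (cbox a b) f \<bullet> h" if "f integrable_on cbox a b"
    for f :: "'b \<Rightarrow> 'a" and h
    using integral_linear[OF that bounded_linear_inner_left, of h] by (simp add: o_def)
  have "((\<lambda>y. integral (cbox a b) (K y)) has_derivative (\<lambda>h. integral (cbox a b) (G y) \<bullet> h)) (at y)" if y: "y \<in> S" for y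
  proof -
    have "continuous_on (S \<times> cbox a b) (\<lambda>(y, t). G y t \<bullet> h)" for h
      using contG unfolding split_beta by (intro continuous_intros)
    then have "((\<lambda>y. integral (cbox a b) (K y)) has_derivative (\<lambda>h. integral (cbox a b) (\<lambda>t. G y t \<bullet> h))) (at y)"
      using harm by (intro deriv[OF y contK]) (auto simp: harmonic_with_def)
    then show ?thesis by (simp add: inner[OF intgr[OF contG y]])
  qed
  moreover have "((\<lambda>y. integral (cbox a b) (G y)) has_derivative (\<lambda>h. integral (cbox a b) (\<lambda>t. H y t h))) (at y)"
    if y: "y \<in> S" for y
    using harm by (intro deriv[OF y contG _ contH]) (auto simp: harmonic_with_def)
  moreover have "continuous_on S (\<lambda>y. integral (cbox a b) (\<lambda>t. H y t h))" for h
    by (rule integral_continuous_on_param[OF contH])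
  moreover have "(\<Sum>e\<in>Basis. integral (cbox a b) (\<lambda>t. H y t e) \<bullet> e) = 0" if y: "y \<in> S" for y
  proof -
    have i: "(\<lambda>t. H y t e) integrable_on cbox a b" for e by (rule intgr[OF contH y])
    have "(\<Sum>e\<in>Basis. integral (cbox a b) (\<lambda>t. H y t e) \<bullet> e) = (\<Sum>e\<in>Basis. integral (cbox a b) (\<lambda>t. H y t e \<bullet> e))"
      by (simp add: inner[OF i])
    also have "\<dots> = integral (cbox a b) (\<lambda>t. \<Sum>e\<in>Basis. H y t e \<bullet> e)"
      using integrable_linear[OF i bounded_linear_inner_left]
      by (intro integral_sum[symmetric]) (auto simp: o_def)
    also have "\<dots> = integral (cbox a b) (\<lambda>t. 0)"
      using harm y by (intro integral_cong) (auto simp: harmonic_with_def)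
    finally show ?thesis by simp
  qed
  ultimately show ?thesis by (simp add: harmonic_with_def)
qed

text \<open>One form for two uses: with second function 0 it multiplies a kernel by
  \<open>sin \<theta>\<close>, with two cap integrals it forms the extremal function.\<close>

lemma harmonic_with_scaled_diff:
  assumes "harmonic_with S u1 g1 H1" "harmonic_with S u2 g2 H2"
  shows "harmonic_with S (\<lambda>y. c * (u1 y - u2 y)) (\<lambda>y. c *\<^sub>R (g1 y - g2 y)) (\<lambda>y h. c *\<^sub>R (H1 y h - H2 y h))"
proof -
  have "((\<lambda>y. c * (u1 y - u2 y)) has_derivative (\<lambda>h. (c *\<^sub>R (g1 y - g2 y)) \<bullet> h)) (at y)" if "y \<in> S" for y
  proof -
    have "((\<lambda>y. c * (u1 y - u2 y)) has_derivative (\<lambda>h. c * (g1 y \<bullet> h - g2 y \<bullet> h))) (at y)"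
      using assms that by (intro has_derivative_mult_right has_derivative_diff) (auto simp: harmonic_with_def)
    then show ?thesis by (simp add: inner_diff_left)
  qed
  moreover have "(\<Sum>b\<in>Basis. (c *\<^sub>R (H1 y b - H2 y b)) \<bullet> b) = 0" if "y \<in> S" for y
  proof -
    have "(\<Sum>b\<in>Basis. (c *\<^sub>R (H1 y b - H2 y b)) \<bullet> b) = c * ((\<Sum>b\<in>Basis. H1 y b \<bullet> b) - (\<Sum>b\<in>Basis. H2 y b \<bullet> b))"
      by (simp add: inner_diff_left sum_subtractf sum_distrib_left right_diff_distrib)
    then show ?thesis using assms that by (simp add: harmonic_with_def)
  qed
  moreover have "((\<lambda>y. c *\<^sub>R (g1 y - g2 y)) has_derivative (\<lambda>h. c *\<^sub>R (H1 y h - H2 y h))) (at y)" if "y \<in> S" for y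
    using assms that by (intro has_derivative_scaleR_right has_derivative_diff) (auto simp: harmonic_with_def)
  moreover have "continuous_on S (\<lambda>y. c *\<^sub>R (H1 y h - H2 y h))" for h
    using assms by (intro continuous_intros) (auto simp: harmonic_with_def)
  ultimately show ?thesis by (simp add: harmonic_with_def)
qed

section \<open>Sharpness\<close>

text \<open>The Poisson kernel of the unit ball with boundary point \<eta>, up to the factor 1 / (4
  pi). It is written with \<open>inverse\<close>, so that derivatives remain polynomial in the
  inverse distance.\<close>

definition poisson :: "real^3 \<Rightarrow> real^3 \<Rightarrow> real" where
  "poisson \<eta> y = (1 - y \<bullet> y) * inverse (norm (y - \<eta>)) ^ 3"

definition poisson_grad :: "real^3 \<Rightarrow> real^3 \<Rightarrow> real^3" where
  "poisson_grad \<eta> y = (- 2 * inverse (norm (y - \<eta>)) ^ 3) *\<^sub>R y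
     - (3 * (1 - y \<bullet> y) * inverse (norm (y - \<eta>)) ^ 5) *\<^sub>R (y - \<eta>)"

definition poisson_hess :: "real^3 \<Rightarrow> real^3 \<Rightarrow> real^3 \<Rightarrow> real^3" where
  "poisson_hess \<eta> y h = (6 * inverse (norm (y - \<eta>)) ^ 5 * ((y - \<eta>) \<bullet> h)) *\<^sub>R y
     + (6 * inverse (norm (y - \<eta>)) ^ 5 * (y \<bullet> h)
       + 15 * (1 - y \<bullet> y) * inverse (norm (y - \<eta>)) ^ 7 * ((y - \<eta>) \<bullet> h)) *\<^sub>R (y - \<eta>)
     - (2 * inverse (norm (y - \<eta>)) ^ 3 + 3 * (1 - y \<bullet> y) * inverse (norm (y - \<eta>)) ^ 5) *\<^sub>R h"

lemma poisson_harmonic: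
  assumes \<eta>: "norm \<eta> = 1"
  shows "harmonic_with (ball 0 1) (poisson \<eta>) (poisson_grad \<eta>) (poisson_hess \<eta>)"
proof -
  define q where "q y = inverse (norm (y - \<eta>))" for y
  have ne: "y \<noteq> \<eta>" if "y \<in> ball 0 1" for y using that \<eta> by auto
  have dq: "(q has_derivative (\<lambda>h. - ((q y)^3) * ((y - \<eta>) \<bullet> h))) (at y)" if "y \<in> ball 0 1" for y
    unfolding q_def using has_derivative_inverse_norm[OF ne[OF that]] .
  have dyy: "((\<lambda>y. 1 - y \<bullet> y) has_derivative (\<lambda>h. - 2 * (y \<bullet> h))) (at y)" for y :: "real^3"
    by (auto intro!: derivative_eq_intros simp: inner_commute)
  have d3: "((\<lambda>y. (q y)^3) has_derivative (\<lambda>h. - 3 * (q y)^5 * ((y - \<eta>) \<bullet> h))) (at y)" if "y \<in> ball 0 1" for y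
    by (rule derivative_eq_intros dq[OF that] refl)+ (simp add: fun_eq_iff eval_nat_numeral algebra_simps)
  have d5: "((\<lambda>y. (q y)^5) has_derivative (\<lambda>h. - 5 * (q y)^7 * ((y - \<eta>) \<bullet> h))) (at y)" if "y \<in> ball 0 1" for y
    by (rule derivative_eq_intros dq[OF that] refl)+ (simp add: fun_eq_iff eval_nat_numeral algebra_simps)
  have "(poisson \<eta> has_derivative (\<lambda>h. poisson_grad \<eta> y \<bullet> h)) (at y)" if "y \<in> ball 0 1" for y
  proof -
    have "((\<lambda>y. (1 - y \<bullet> y) * (q y)^3) has_derivative (\<lambda>h. (1 - y \<bullet> y) * (- 3 * (q y)^5 * ((y - \<eta>) \<bullet> h)) + - 2 * (y \<bullet> h) * (q y)^3)) (at y)"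
      by (rule has_derivative_mult[OF dyy d3[OF that]])
    moreover have "(1 - y \<bullet> y) * (- 3 * (q y)^5 * ((y - \<eta>) \<bullet> h)) + - 2 * (y \<bullet> h) * (q y)^3 = poisson_grad \<eta> y \<bullet> h" for h
      unfolding poisson_grad_def q_def[symmetric] inner_diff_left[of "_ *\<^sub>R _"] inner_scaleR_left by algebra
    ultimately show ?thesis by (simp add: poisson_def[abs_def] q_def)
  qed
  moreover have "(poisson_grad \<eta> has_derivative poisson_hess \<eta> y) (at y)" if "y \<in> ball 0 1" for y
  proof -
    have dw: "((\<lambda>y. y - \<eta>) has_derivative (\<lambda>h. h)) (at y)" by (auto intro!: derivative_eq_intros)
    have "((\<lambda>y. (- 2 * (q y)^3) *\<^sub>R y - (3 * (1 - y \<bullet> y) * (q y)^5) *\<^sub>R (y - \<eta>)) has_derivative poisson_hess \<eta> y) (at y)"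
      by (rule derivative_eq_intros d3[OF that] d5[OF that] dyy dw refl)+
         (simp add: fun_eq_iff poisson_hess_def q_def[symmetric] algebra_simps inner_commute)
    then show ?thesis by (simp add: poisson_grad_def[abs_def] q_def)
  qed
  moreover have "continuous_on (ball 0 1) (\<lambda>y. poisson_hess \<eta> y h)" for h
    unfolding poisson_hess_def using ne by (intro continuous_intros) auto
  moreover have "(\<Sum>b\<in>Basis. poisson_hess \<eta> y b \<bullet> b) = 0" if "y \<in> ball 0 1" for y
  proof -
    let ?w = "y - \<eta>"
    define L1 where "L1 h = 6 * (q y)^5 * (?w \<bullet> h)" for h
    define L2 where "L2 h = 6 * (q y)^5 * (y \<bullet> h) + 15 * (1 - y \<bullet> y) * (q y)^7 * (?w \<bullet> h)" for h
    define c where "c = 2 * (q y)^3 + 3 * (1 - y \<bullet> y) * (q y)^5"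
    have l: "linear L1" "linear L2" by (rule linearI; simp add: L1_def L2_def inner_add_right algebra_simps)+
    have "(\<Sum>b\<in>Basis. poisson_hess \<eta> y b \<bullet> b) = (\<Sum>b\<in>Basis. (L1 b *\<^sub>R y) \<bullet> b) + (\<Sum>b\<in>Basis. (L2 b *\<^sub>R ?w) \<bullet> b) - c * (\<Sum>b\<in>(Basis :: (real^3) set). b \<bullet> b)"
      by (simp add: poisson_hess_def L1_def L2_def c_def q_def inner_add_left[of "_ + _"] inner_add_left[of "_ *\<^sub>R _"] inner_diff_left[of "_ + _"] sum.distrib sum_subtractf sum_distrib_left)
    also have "\<dots> = L1 y + L2 ?w - c * 3"
      unfolding trace_rank_one[OF l(1)] trace_rank_one[OF l(2)] by (simp add: inner_Basis)
    also have "\<dots> = 0"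
    proof -
      have qw: "(q y)^2 * (?w \<bullet> ?w) = 1"
        using ne[OF that] by (simp add: q_def power2_norm_eq_inner[symmetric] power_inverse)
      have ee: "\<eta> \<bullet> \<eta> = 1" using \<eta> by (simp add: norm_eq_1)
      have ww: "?w \<bullet> ?w = y \<bullet> y - 2 * (y \<bullet> \<eta>) + 1" and yw: "?w \<bullet> y = y \<bullet> y - y \<bullet> \<eta>"
        by (simp_all add: inner_diff_left inner_diff_right ee inner_commute)
      have wy: "y \<bullet> ?w = ?w \<bullet> y" by (rule inner_commute)
      \<comment> \<open>The trace as an identity in Q = inverse distance, W = squared distance, A =
        y \<bullet> y and B = y \<bullet> \<eta>.\<close>
      have id: "(6 * Q^5 * (A - B)) + (6 * Q^5 * (A - B) + 15 * (1 - A) * Q^7 * W) - (2 * Q^3 + 3 * (1 - A) * Q^5) * 3 = 0"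
        if "Q^2 * W = 1" "W = A - 2 * B + 1" for Q W A B :: real
        using that by algebra
      show ?thesis unfolding L1_def L2_def c_def wy yw using id[OF qw ww] by simp
    qed
    finally show ?thesis .
  qed
  ultimately show ?thesis by (simp add: harmonic_with_def)
qed

text \<open>\<open>m\<close> is the Kelvin transform, with respect to the unit sphere, of the Newton
  kernel with pole \<open>y\<close>. It agrees with that kernel on the unit sphere, but its
  singularity is moved outside, so mean values over the unit sphere can be used.\<close>

lemma newton_harmonic:
  fixes y :: "real^3"
  assumes R: "R * norm y < 1" "R > 0"
  defines "m \<equiv> \<lambda>z. inverse (sqrt (1 - 2 * (y \<bullet> z) + (y \<bullet> y) * (z \<bullet> z)))"
  obtains H where "harmonic_with (ball 0 R) m (\<lambda>z. (m z)^3 *\<^sub>R (y - (y \<bullet> y) *\<^sub>R z)) H"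
proof -
  define D where "D z = 1 - 2 * (y \<bullet> z) + (y \<bullet> y) * (z \<bullet> z)" for z
  define a where "a z = y - (y \<bullet> y) *\<^sub>R z" for z
  have Dpos: "D z > 0" if "z \<in> ball 0 R" for z
  proof -
    have "norm y * norm z \<le> norm y * R" using that by (intro mult_left_mono) auto
    then have "norm y * norm z < 1" using R by (simp add: mult.commute)
    then have "(1 - norm y * norm z)^2 > 0" by simp
    moreover have "D z \<ge> (1 - norm y * norm z)^2"
      using norm_cauchy_schwarz[of y z]
      by (simp add: D_def power2_norm_eq_inner[symmetric] power2_eq_square algebra_simps)
    ultimately show ?thesis by linarith
  qed
  have m: "m = (\<lambda>z. inverse (sqrt (D z)))" by (simp add: m_def D_def)
  have mD: "(m z)^2 * D z = 1" if "z \<in> ball 0 R" for z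
    using Dpos[OF that] by (simp add: m power_inverse)
  have dm: "(m has_derivative (\<lambda>h. (m z)^3 * (a z \<bullet> h))) (at z)" if "z \<in> ball 0 R" for z
  proof -
    have "(D has_derivative (\<lambda>h. - 2 * (a z \<bullet> h))) (at z)"
      unfolding D_def[abs_def] a_def
      by (auto intro!: derivative_eq_intros simp: inner_diff_left inner_commute algebra_simps)
    moreover have "((\<lambda>d. inverse (sqrt d)) has_real_derivative - ((m z)^3 / 2)) (at (D z))"
      using Dpos[OF that] unfolding m
      by (auto intro!: derivative_eq_intros simp: power3_eq_cube field_simps)
    ultimately have "((\<lambda>z. inverse (sqrt (D z))) has_derivative (\<lambda>h. - 2 * (a z \<bullet> h) * (- ((m z)^3 / 2)))) (at z)"
      by (rule DERIV_compose_FDERIV[rotated])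
    then show ?thesis unfolding m[symmetric] by (simp add: mult.commute)
  qed
  define H where "H z h = (3 * (m z)^5 * (a z \<bullet> h)) *\<^sub>R a z - ((m z)^3 * (y \<bullet> y)) *\<^sub>R h" for z h
  have "((\<lambda>z. (m z)^3 *\<^sub>R a z) has_derivative H z) (at z)" if "z \<in> ball 0 R" for z
  proof -
    have d3: "((\<lambda>z. (m z)^3) has_derivative (\<lambda>h. 3 * (m z)^5 * (a z \<bullet> h))) (at z)"
      by (rule derivative_eq_intros dm[OF that] refl)+ (simp add: fun_eq_iff eval_nat_numeral algebra_simps)
    have da: "(a has_derivative (\<lambda>h. - ((y \<bullet> y) *\<^sub>R h))) (at z)"
      unfolding a_def[abs_def] by (auto intro!: derivative_eq_intros)
    show ?thesis
      by (rule derivative_eq_intros d3 da refl)+ (simp add: fun_eq_iff H_def algebra_simps)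
  qed
  moreover have "(m has_derivative (\<lambda>h. ((m z)^3 *\<^sub>R a z) \<bullet> h)) (at z)" if "z \<in> ball 0 R" for z
    using dm[OF that] by simp
  moreover have "continuous_on (ball 0 R) (\<lambda>z. H z h)" for h
  proof -
    have "continuous_on (ball 0 R) m"
      using dm by (meson continuous_at_imp_continuous_on has_derivative_continuous)
    then show ?thesis unfolding H_def a_def by (intro continuous_intros)
  qed
  moreover have "(\<Sum>b\<in>Basis. H z b \<bullet> b) = 0" if "z \<in> ball 0 R" for z
  proof -
    define L where "L h = 3 * (m z)^5 * (a z \<bullet> h)" for h
    have l: "linear L" by (rule linearI; simp add: L_def inner_add_right algebra_simps)
    have "(\<Sum>b\<in>Basis. H z b \<bullet> b) = (\<Sum>b\<in>Basis. (L b *\<^sub>R a z) \<bullet> b) - (m z)^3 * (y \<bullet> y) * (\<Sum>b\<in>(Basis :: (real^3) set). b \<bullet> b)"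
      by (simp add: H_def L_def inner_diff_left sum_subtractf sum_distrib_left)
    also have "\<dots> = L (a z) - (m z)^3 * (y \<bullet> y) * 3"
      unfolding trace_rank_one[OF l] by (simp add: inner_Basis)
    also have "a z \<bullet> a z = (y \<bullet> y) * D z"
      by (simp add: a_def D_def inner_diff_left inner_diff_right inner_commute algebra_simps)
    then have "L (a z) = 3 * (m z)^3 * (y \<bullet> y) * ((m z)^2 * D z)"
      by (simp add: L_def eval_nat_numeral)
    finally show ?thesis using mD[OF that] by simp
  qed
  ultimately have "harmonic_with (ball 0 R) m (\<lambda>z. (m z)^3 *\<^sub>R a z) H" by (simp add: harmonic_with_def)
  then show thesis unfolding a_def by (rule that)
qed

context orthonormal_frame
begin

text \<open>On the unit sphere the Poisson kernel equals \<open>m\<close> plus twice the radial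
  derivative of \<open>m\<close>, for the function \<open>m\<close> of
  \<open>newton_harmonic\<close>. The mean value property gives \<open>m 0 = 1\<close> for the first
  term, and the flux of the gradient vanishes.\<close>

lemma poisson_integral_const:
  assumes y: "norm y < 1"
  shows "integral sphere_box (\<lambda>(\<theta>, \<phi>). poisson (sph \<theta> \<phi>) y * sin \<theta>) = 4 * pi"
proof -
  \<comment> \<open>A radius larger than 1 and, unless \<open>y = 0\<close>, smaller than the
    inverse of the norm of \<open>y\<close>; this form also covers \<open>y = 0\<close>.\<close>
  define R where "R = 2 / (1 + norm y)"
  have R: "R * norm y < 1" "R > 0" "1 < R" using y by (auto simp: R_def field_simps add_pos_nonneg)
  define m where "m z = inverse (sqrt (1 - 2 * (y \<bullet> z) + (y \<bullet> y) * (z \<bullet> z)))" for z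
  define G where "G z = (m z)^3 *\<^sub>R (y - (y \<bullet> y) *\<^sub>R z)" for z
  obtain H where H: "harmonic_with (ball 0 R) m G H"
    using newton_harmonic[OF R(1,2)] unfolding m_def[abs_def] G_def[abs_def] by blast
  have inb: "sph \<theta> \<phi> \<in> ball 0 R" for \<theta> \<phi> using R by simp
  have cont: "continuous_on (ball 0 R) m" "continuous_on (ball 0 R) G"
    using H unfolding harmonic_with_def by (meson continuous_at_imp_continuous_on has_derivative_continuous)+
  have cm: "continuous_on sphere_box (\<lambda>t. m (sph (fst t) (snd t)))"
    by (rule continuous_on_compose2[OF cont(1)]) (use inb in \<open>auto intro!: continuous_intros\<close>)
  have cG: "continuous_on sphere_box (\<lambda>t. G (sph (fst t) (snd t)))"
    by (rule continuous_on_compose2[OF cont(2)]) (use inb in \<open>auto intro!: continuous_intros\<close>)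
  have i1: "(\<lambda>(\<theta>, \<phi>). m (sph \<theta> \<phi>) * sin \<theta>) integrable_on sphere_box"
    and i2: "(\<lambda>(\<theta>, \<phi>). (G (sph \<theta> \<phi>) \<bullet> sph \<theta> \<phi>) * sin \<theta>) integrable_on sphere_box"
    unfolding split_beta by (intro integrable_continuous continuous_intros cm cG)+
  have P: "poisson (sph \<theta> \<phi>) y = m (sph \<theta> \<phi>) + 2 * (G (sph \<theta> \<phi>) \<bullet> sph \<theta> \<phi>)" for \<theta> \<phi>
  proof -
    let ?s = "sph \<theta> \<phi>"
    define D where "D = 1 - 2 * (y \<bullet> ?s) + y \<bullet> y"
    have "(norm (y - ?s))^2 = D"
      unfolding power2_norm_eq_inner D_def by (simp add: inner_diff_left inner_diff_right sph_inner_self inner_commute)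
    then have n: "norm (y - ?s) = sqrt D" by (metis norm_ge_zero real_sqrt_unique)
    have m: "m ?s = inverse (sqrt D)" by (simp add: m_def D_def sph_inner_self)
    have "y \<noteq> ?s" using y by auto
    then have "sqrt D > 0" unfolding n[symmetric] by simp
    then have mD: "(m ?s)^2 * D = 1" by (simp add: m power_inverse)
    have "m ?s + 2 * (G ?s \<bullet> ?s) = m ?s + 2 * (m ?s)^3 * (y \<bullet> ?s - y \<bullet> y)"
      by (simp add: G_def inner_diff_left sph_inner_self)
    also have "\<dots> = (m ?s)^3 * (1 - y \<bullet> y)"
      using mD unfolding D_def by algebra
    finally show ?thesis unfolding poisson_def n m by simp
  qed
  have "integral sphere_box (\<lambda>(\<theta>, \<phi>). poisson (sph \<theta> \<phi>) y * sin \<theta>)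
     = integral sphere_box (\<lambda>t. (case t of (\<theta>, \<phi>) \<Rightarrow> m (sph \<theta> \<phi>) * sin \<theta>) + 2 * (case t of (\<theta>, \<phi>) \<Rightarrow> (G (sph \<theta> \<phi>) \<bullet> sph \<theta> \<phi>) * sin \<theta>))"
    by (rule integral_cong) (auto simp: P algebra_simps)
  also have "\<dots> = integral sphere_box (\<lambda>(\<theta>, \<phi>). m (sph \<theta> \<phi>) * sin \<theta>) + 2 * integral sphere_box (\<lambda>(\<theta>, \<phi>). (G (sph \<theta> \<phi>) \<bullet> sph \<theta> \<phi>) * sin \<theta>)"
    by (subst integral_add) (simp_all only: integrable_on_mult_right i1 i2 integral_mult_right)
  also have "\<dots> = 4 * pi"
    using sphere_mean[OF H zero_less_one R(3)] flux_gradient[OF H zero_less_one R(3)] by (simp add: m_def)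
  finally show ?thesis .
qed

end

section \<open>Poisson integrals of spherical zones\<close>

context orthonormal_frame
begin

text \<open>\<open>4 * pi\<close> times the Poisson integral of the indicator function of the zone
  with polar angle between \<alpha> and \<beta>.\<close>

definition cap_integral :: "real \<Rightarrow> real \<Rightarrow> real^3 \<Rightarrow> real" where
  "cap_integral \<alpha> \<beta> y = integral (cbox (\<alpha>, 0) (\<beta>, 2 * pi)) (\<lambda>(\<theta>, \<phi>). poisson (sph \<theta> \<phi>) y * sin \<theta>)"

lemma continuous_poisson:
  fixes f :: "'x::t2_space \<Rightarrow> real^3" and h k :: "'x \<Rightarrow> real"
  assumes "continuous_on T f" "continuous_on T h" "continuous_on T k" "f ` T \<subseteq> ball 0 1"
  shows "continuous_on T (\<lambda>t. poisson (sph (h t) (k t)) (f t))"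
    and "continuous_on T (\<lambda>t. poisson_grad (sph (h t) (k t)) (f t))"
    and "continuous_on T (\<lambda>t. poisson_hess (sph (h t) (k t)) (f t) v)"
proof -
  have "f t \<noteq> sph (h t) (k t)" if "t \<in> T" for t
    using assms(4) that norm_sph[of "h t" "k t"] by (force simp: image_subset_iff)
  then show "continuous_on T (\<lambda>t. poisson (sph (h t) (k t)) (f t))"
    "continuous_on T (\<lambda>t. poisson_grad (sph (h t) (k t)) (f t))"
    "continuous_on T (\<lambda>t. poisson_hess (sph (h t) (k t)) (f t) v)"
    unfolding poisson_def poisson_grad_def poisson_hess_def
    by (auto intro!: continuous_intros assms(1-3))
qed

lemma cap_integral_harmonic:
  obtains g H where "harmonic_with (ball 0 1) (cap_integral \<alpha> \<beta>) g H"
proof -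
  let ?S = "ball 0 1 :: (real^3) set" and ?B = "cbox (\<alpha>, 0) (\<beta>, 2 * pi)"
  let ?K = "\<lambda>y t. sin (fst t) * (poisson (sph (fst t) (snd t)) y - 0)"
  let ?G = "\<lambda>y t. sin (fst t) *\<^sub>R (poisson_grad (sph (fst t) (snd t)) y - 0)"
  let ?H = "\<lambda>y t h. sin (fst t) *\<^sub>R (poisson_hess (sph (fst t) (snd t)) y h - 0)"
  have zero: "harmonic_with ?S (\<lambda>_. 0) (\<lambda>_. 0) (\<lambda>_ _. 0)" by (simp add: harmonic_with_def)
  have "harmonic_with ?S (\<lambda>y. integral ?B (?K y)) (\<lambda>y. integral ?B (?G y)) (\<lambda>y h. integral ?B (\<lambda>t. ?H y t h))"
  proof (rule harmonic_with_integral)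
    show "harmonic_with ?S (\<lambda>y. ?K y t) (\<lambda>y. ?G y t) (\<lambda>y. ?H y t)" for t
      by (rule harmonic_with_scaled_diff[OF poisson_harmonic[OF norm_sph] zero])
    show "continuous_on (?S \<times> ?B) (\<lambda>(y, t). ?K y t)" "continuous_on (?S \<times> ?B) (\<lambda>(y, t). ?G y t)"
      "continuous_on (?S \<times> ?B) (\<lambda>(y, t). ?H y t h)" for h
      unfolding split_beta by (intro continuous_intros continuous_poisson; auto)+
  qed auto
  moreover have "(\<lambda>y. integral ?B (?K y)) = cap_integral \<alpha> \<beta>"
    unfolding cap_integral_def[abs_def] case_prod_unfold by (simp add: mult.commute)
  ultimately show thesis using that by simp
qed

lemma cap_integral_iterated:
  assumes "norm y < 1"
  shows "cap_integral \<alpha> \<beta> y = integral {\<alpha>..\<beta>} (\<lambda>\<theta>. integral {0..2*pi} (\<lambda>\<phi>. poisson (sph \<theta> \<phi>) y * sin \<theta>))"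
    and "(\<lambda>\<theta>. integral {0..2*pi} (\<lambda>\<phi>. poisson (sph \<theta> \<phi>) y * sin \<theta>)) integrable_on {\<alpha>..\<beta>}"
proof -
  have c: "continuous_on S (\<lambda>(\<theta>, \<phi>). poisson (sph \<theta> \<phi>) y * sin \<theta>)" for S
    unfolding split_beta using assms by (intro continuous_intros continuous_poisson) auto
  show "cap_integral \<alpha> \<beta> y = integral {\<alpha>..\<beta>} (\<lambda>\<theta>. integral {0..2*pi} (\<lambda>\<phi>. poisson (sph \<theta> \<phi>) y * sin \<theta>))"
    using integral_prod_continuous[OF c] by (simp add: cap_integral_def)
  have "continuous_on {\<alpha>..\<beta>} (\<lambda>\<theta>. integral (cbox 0 (2*pi)) (\<lambda>\<phi>. poisson (sph \<theta> \<phi>) y * sin \<theta>))"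
    by (rule integral_continuous_on_param[OF c])
  then show "(\<lambda>\<theta>. integral {0..2*pi} (\<lambda>\<phi>. poisson (sph \<theta> \<phi>) y * sin \<theta>)) integrable_on {\<alpha>..\<beta>}"
    by (intro integrable_continuous_real) simp
qed

lemma cap_integral_nonneg:
  assumes y: "norm y < 1" and "0 \<le> \<alpha>" "\<beta> \<le> pi"
  shows "cap_integral \<alpha> \<beta> y \<ge> 0"
  unfolding cap_integral_def
proof (rule integral_nonneg)
  show "(\<lambda>(\<theta>, \<phi>). poisson (sph \<theta> \<phi>) y * sin \<theta>) integrable_on cbox (\<alpha>, 0) (\<beta>, 2 * pi)"
    unfolding split_beta using y by (intro integrable_continuous continuous_intros continuous_poisson) auto
  fix t assume "t \<in> cbox (\<alpha>, 0) (\<beta>, 2 * pi)"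
  then obtain \<theta> \<phi> where t: "t = (\<theta>, \<phi>)" and "\<alpha> \<le> \<theta>" "\<theta> \<le> \<beta>" by (cases t) (auto simp: cbox_Pair_eq)
  then have "sin \<theta> \<ge> 0" using assms by (intro sin_ge_zero) auto
  moreover have "(norm y)^2 \<le> 1" using y by (simp add: power_le_one)
  then have "poisson (sph \<theta> \<phi>) y \<ge> 0" by (simp add: poisson_def power2_norm_eq_inner)
  ultimately show "0 \<le> (case t of (\<theta>, \<phi>) \<Rightarrow> poisson (sph \<theta> \<phi>) y * sin \<theta>)" by (simp add: t)
qed

lemma cap_integral_combine:
  assumes y: "norm y < 1" and "0 \<le> \<beta>" "\<beta> \<le> pi"
  shows "cap_integral 0 \<beta> y + cap_integral \<beta> pi y = 4 * pi"
proof -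
  have "cap_integral 0 \<beta> y + cap_integral \<beta> pi y = cap_integral 0 pi y"
    unfolding cap_integral_iterated(1)[OF y]
    by (rule Henstock_Kurzweil_Integration.integral_combine[OF assms(2,3) cap_integral_iterated(2)[OF y]])
  then show ?thesis using poisson_integral_const[OF y] by (simp add: cap_integral_def)
qed

text \<open>On the axis the kernel is independent of the azimuth and depends on the polar angle only
  through its cosine, so its product with \<open>sin \<theta>\<close> has an elementary
  primitive.\<close>

lemma cap_integral_axis:
  assumes t: "0 < t" "t < 1" and "\<alpha> \<le> \<beta>"
  shows "cap_integral \<alpha> \<beta> (t *\<^sub>R e1) = 2 * pi * (1 - t^2) / t *
    (1 / sqrt (1 + t^2 - 2 * t * cos \<alpha>) - 1 / sqrt (1 + t^2 - 2 * t * cos \<beta>))"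
proof -
  define q where "q \<theta> = 1 + t^2 - 2 * t * cos \<theta>" for \<theta>
  have q: "q \<theta> > 0" for \<theta>
  proof -
    have "2 * t * cos \<theta> \<le> 2 * t * 1" using t by (intro mult_left_mono) auto
    moreover have "(1 - t)^2 > 0" using t by simp
    ultimately show ?thesis by (simp add: q_def power2_eq_square algebra_simps)
  qed
  have n: "norm (t *\<^sub>R e1) < 1" using t unit by (simp add: norm_eq_sqrt_inner)
  have P: "poisson (sph \<theta> \<phi>) (t *\<^sub>R e1) = (1 - t^2) / (sqrt (q \<theta>))^3" for \<theta> \<phi>
  proof -
    have "(norm (t *\<^sub>R e1 - sph \<theta> \<phi>))^2 = q \<theta>"
      unfolding power2_norm_eq_inner q_def
      by (simp add: inner_diff_left inner_diff_right sph_inner_self sph_inner_e1 inner_commute[of e1 "sph \<theta> \<phi>"] unit power2_eq_square algebra_simps)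
    then have "norm (t *\<^sub>R e1 - sph \<theta> \<phi>) = sqrt (q \<theta>)" by (metis norm_ge_zero real_sqrt_unique)
    then show ?thesis by (simp add: poisson_def unit power2_eq_square divide_inverse power_inverse)
  qed
  define F where "F \<theta> = - (2 * pi * (1 - t^2) / t * (1 / sqrt (q \<theta>)))" for \<theta>
  have "((\<lambda>\<theta>. 2 * pi * ((1 - t^2) / (sqrt (q \<theta>))^3 * sin \<theta>)) has_integral F \<beta> - F \<alpha>) {\<alpha>..\<beta>}"
  proof (rule fundamental_theorem_of_calculus)
    fix \<theta> assume "\<theta> \<in> {\<alpha>..\<beta>}"
    have dq: "(q has_real_derivative 2 * t * sin \<theta>) (at \<theta> within {\<alpha>..\<beta>})"
      unfolding q_def[abs_def] by (auto intro!: derivative_eq_intros)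
    have "((\<lambda>d. 1 / sqrt d) has_real_derivative - (1 / (2 * (sqrt (q \<theta>))^3))) (at (q \<theta>))"
      using q[of \<theta>] by (auto intro!: derivative_eq_intros simp: power3_eq_cube field_simps)
    from DERIV_chain2[OF this dq]
    have "((\<lambda>\<theta>. 1 / sqrt (q \<theta>)) has_real_derivative - (1 / (2 * (sqrt (q \<theta>))^3)) * (2 * t * sin \<theta>)) (at \<theta> within {\<alpha>..\<beta>})" .
    then have "(F has_real_derivative - (2 * pi * (1 - t^2) / t * (- (1 / (2 * (sqrt (q \<theta>))^3)) * (2 * t * sin \<theta>)))) (at \<theta> within {\<alpha>..\<beta>})"
      unfolding F_def[abs_def] by (intro DERIV_minus DERIV_cmult)
    moreover have "- (2 * pi * (1 - t^2) / t * (- (1 / (2 * Q)) * (2 * t * s))) = 2 * pi * ((1 - t^2) / Q * s)" for Q s :: real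
      using t by simp
    ultimately show "(F has_vector_derivative 2 * pi * ((1 - t^2) / (sqrt (q \<theta>))^3 * sin \<theta>)) (at \<theta> within {\<alpha>..\<beta>})"
      by (simp only: has_real_derivative_iff_has_vector_derivative)
  qed (rule assms)
  then have "integral {\<alpha>..\<beta>} (\<lambda>\<theta>. 2 * pi * ((1 - t^2) / (sqrt (q \<theta>))^3 * sin \<theta>)) = F \<beta> - F \<alpha>"
    by (rule integral_unique)
  moreover have "cap_integral \<alpha> \<beta> (t *\<^sub>R e1) = integral {\<alpha>..\<beta>} (\<lambda>\<theta>. 2 * pi * ((1 - t^2) / (sqrt (q \<theta>))^3 * sin \<theta>))"
    unfolding cap_integral_iterated(1)[OF n] P by (rule integral_cong) (simp add: mult.assoc)
  ultimately show ?thesis by (simp add: F_def q_def right_diff_distrib)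
qed

end

text \<open>\<open>s\<close> is the root of the equation that the t-derivative of
  \<open>(1 - t^2) / (1 + t^2 - 2 * t * s) powr (3/2)\<close> vanishes at \<open>t = \<rho>\<close>.
  The cap bounded by this circle consists of the boundary points that increase the radial
  derivative, hence its choice in \<open>extremal_harmonic\<close>.\<close>

lemma axis_derivative:
  fixes \<rho> :: real
  assumes \<rho>: "0 < \<rho>" "\<rho> < 1"
  defines "s \<equiv> (5 * \<rho> - \<rho>^3) / (3 + \<rho>^2)" and "Y \<equiv> sqrt (1 + \<rho>^2 / 3)"
  shows "((\<lambda>t. 1 / t - (1 - t^2) / (t * sqrt (1 + t^2 - 2 * t * s))) has_real_derivative
     (1 / \<rho>^2) * (Y^3 / (1 - \<rho>^2) - 1)) (at \<rho>)"
proof -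
  have \<rho>2: "\<rho>^2 < 1" using \<rho> by (simp add: power_less_one_iff)
  have Y: "Y > 0" "Y^2 = 1 + \<rho>^2 / 3" by (simp_all add: Y_def add_pos_nonneg)
  have three: "3 + \<rho>^2 > 0" by (simp add: add_pos_nonneg)
  have Y2: "Y^2 = (3 + \<rho>^2) / 3" using Y by simp
  define q where "q t = 1 + t^2 - 2 * t * s" for t
  define Q where "Q = (1 - \<rho>^2) / Y"
  have Q: "Q > 0" using \<rho>2 Y by (simp add: Q_def)
  \<comment> \<open>For this \<open>s\<close> the distance from the point at radius
    \<open>\<rho>\<close> on the axis to the boundary circle of the cap is
    \<open>(1 - \<rho>^2) / Y\<close>; no root other than \<open>Y\<close> is left.\<close>
  have q\<rho>: "q \<rho> = Q^2"
  proof -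
    have "q \<rho> * (3 + \<rho>^2) = 3 * (1 - \<rho>^2)^2"
      using three by (simp add: q_def s_def field_simps power2_eq_square power3_eq_cube)
    then have "q \<rho> = (1 - \<rho>^2)^2 / Y^2" unfolding Y2 using three by (simp add: field_simps)
    then show ?thesis by (simp add: Q_def power_divide)
  qed
  have sQ: "sqrt (q \<rho>) = Q" using Q by (simp add: q\<rho>)
  have rs: "\<rho> - s = - (2 * \<rho> * (1 - \<rho>^2)) / (3 * Y^2)"
    unfolding Y2 s_def using three by (simp add: field_simps power2_eq_square power3_eq_cube)
  have "(q has_real_derivative 2 * (\<rho> - s)) (at \<rho>)"
    unfolding q_def[abs_def] by (auto intro!: derivative_eq_intros)
  moreover have "(sqrt has_real_derivative 1 / (2 * Q)) (at (q \<rho>))"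
    using DERIV_real_sqrt[of "q \<rho>"] Q sQ by (simp add: q\<rho> field_simps)
  ultimately have "((\<lambda>t. sqrt (q t)) has_real_derivative 1 / (2 * Q) * (2 * (\<rho> - s))) (at \<rho>)"
    by (rule DERIV_chain2[rotated])
  moreover have "1 / (2 * Q) * (2 * (\<rho> - s)) = - (2 * \<rho>) / (3 * Y)"
  proof -
    have "1 / (2 * (d / Y)) * (2 * (- (2 * \<rho> * d) / (3 * Y^2))) = - (2 * \<rho>) / (3 * Y)" if "d > 0" for d
      using that Y(1) by (simp add: field_simps power2_eq_square)
    from this[of "1 - \<rho>^2"] show ?thesis unfolding rs Q_def using \<rho>2 by simp
  qed
  ultimately have dQ: "((\<lambda>t. sqrt (q t)) has_real_derivative - (2 * \<rho>) / (3 * Y)) (at \<rho>)" by simp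
  have d1: "((\<lambda>t. t * sqrt (q t)) has_real_derivative (1 * sqrt (q \<rho>) + - (2 * \<rho>) / (3 * Y) * \<rho>)) (at \<rho>)"
    by (rule DERIV_mult[OF DERIV_ident dQ])
  have d2: "((\<lambda>t. 1 - t^2) has_real_derivative - (2 * \<rho>)) (at \<rho>)" by (auto intro!: derivative_eq_intros)
  have d3: "((\<lambda>t. 1 / t) has_real_derivative - (1 / \<rho>^2)) (at \<rho>)"
    using \<rho> by (auto intro!: derivative_eq_intros simp: power2_eq_square)
  have "\<rho> * sqrt (q \<rho>) \<noteq> 0" using \<rho> Q sQ by simp
  from DERIV_diff[OF d3 DERIV_divide[OF d2 d1 this]]
  have D: "((\<lambda>t. 1 / t - (1 - t^2) / (t * sqrt (q t))) has_real_derivative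
     - (1 / \<rho>^2) - (- (2 * \<rho>) * (\<rho> * Q) - (1 - \<rho>^2) * (1 * Q + - (2 * \<rho>) / (3 * Y) * \<rho>)) / (\<rho> * Q * (\<rho> * Q))) (at \<rho>)"
    unfolding sQ .
  have "- (- (2 * \<rho>) * (\<rho> * Q) - (1 - \<rho>^2) * (1 * Q + - (2 * \<rho>) / (3 * Y) * \<rho>)) / (\<rho> * Q * (\<rho> * Q)) = (1 / \<rho>^2) * (Y^3 / (1 - \<rho>^2))"
  proof -
    define d where "d = 1 - \<rho>^2"
    have d: "d > 0" using \<rho>2 by (simp add: d_def)
    have "- (- (2 * \<rho>) * (\<rho> * Q) - d * (1 * Q + - (2 * \<rho>) / (3 * Y) * \<rho>)) / (\<rho> * Q * (\<rho> * Q))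
       = (1 / \<rho>^2) * (Y / d) * ((2 * \<rho>^2 + d) - 2 * \<rho>^2 / 3)"
      unfolding Q_def d_def[symmetric] using Y(1) d \<rho> by (simp add: field_simps power2_eq_square)
    also have "(2 * \<rho>^2 + d) - 2 * \<rho>^2 / 3 = Y^2" unfolding Y(2) d_def by simp
    also have "(1 / \<rho>^2) * (Y / d) * Y^2 = (1 / \<rho>^2) * (Y^3 / d)" by (simp add: power2_eq_square power3_eq_cube)
    finally show ?thesis unfolding d_def .
  qed
  moreover have "- i - a / b = i * (c - 1)" if "- a / b = i * c" for i a b c :: real
    using that by (simp add: right_diff_distrib)
  ultimately have "- (1 / \<rho>^2) - (- (2 * \<rho>) * (\<rho> * Q) - (1 - \<rho>^2) * (1 * Q + - (2 * \<rho>) / (3 * Y) * \<rho>)) / (\<rho> * Q * (\<rho> * Q))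
     = (1 / \<rho>^2) * (Y^3 / (1 - \<rho>^2) - 1)"
    by blast
  then show ?thesis using D by (simp only: q_def)
qed

theorem extremal_harmonic:
  fixes x :: "real^3"
  assumes x: "norm x < 1" "x \<noteq> 0"
  obtains u where "harmonic_on (ball 0 1) u" "\<And>y. y \<in> ball 0 1 \<Longrightarrow> \<bar>u y\<bar> \<le> 1"
    "(1 / (norm x)^2) * ((sqrt (1 + (norm x)^2 / 3))^3 / (1 - (norm x)^2) - 1) \<le> norm (grad u x)"
proof -
  define \<rho> where "\<rho> = norm x"
  have \<rho>: "0 < \<rho>" "\<rho> < 1" using x by (auto simp: \<rho>_def)
  define e1 where "e1 = sgn x"
  have ne1: "norm e1 = 1" using x by (simp add: e1_def norm_sgn)
  have xe: "x = \<rho> *\<^sub>R e1" using x by (simp add: e1_def \<rho>_def sgn_div_norm)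
  obtain e2 e3 where "orthonormal_frame e1 e2 e3"
    using orthonormal_frame_exists[OF ne1] by blast
  then interpret orthonormal_frame e1 e2 e3 .
  define s where "s = (5 * \<rho> - \<rho>^3) / (3 + \<rho>^2)"
  have three: "3 + \<rho>^2 > 0" by (simp add: add_pos_nonneg)
  have s: "0 \<le> s" "s \<le> 1"
  proof -
    have "\<rho>^2 \<le> 1" using \<rho> by (simp add: power_le_one)
    then have "\<rho> * \<rho>^2 \<le> \<rho> * 5" using \<rho> by (intro mult_left_mono) auto
    then show "0 \<le> s" using three by (simp add: s_def power3_eq_cube power2_eq_square)
    have "3 + \<rho>^2 - (5 * \<rho> - \<rho>^3) = (1 - \<rho>)^2 * (3 + \<rho>)" by algebra
    also have "\<dots> \<ge> 0" using \<rho> by simp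
    finally show "s \<le> 1" using three by (simp add: s_def)
  qed
  define \<theta>0 where "\<theta>0 = arccos s"
  have \<theta>0: "0 \<le> \<theta>0" "\<theta>0 \<le> pi" "cos \<theta>0 = s"
    using s by (auto simp: \<theta>0_def intro: arccos_lbound arccos_ubound cos_arccos)
  obtain g1 H1 where h1: "harmonic_with (ball 0 1) (cap_integral 0 \<theta>0) g1 H1" by (rule cap_integral_harmonic)
  obtain g2 H2 where h2: "harmonic_with (ball 0 1) (cap_integral \<theta>0 pi) g2 H2" by (rule cap_integral_harmonic)
  define u where "u y = 1 / (4 * pi) * (cap_integral 0 \<theta>0 y - cap_integral \<theta>0 pi y)" for y
  define g where "g y = (1 / (4 * pi)) *\<^sub>R (g1 y - g2 y)" for y
  obtain H where h: "harmonic_with (ball 0 1) u g H"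
    using harmonic_with_scaled_diff[OF h1 h2, of "1 / (4 * pi)"] unfolding u_def[abs_def] g_def[abs_def] by blast
  have "\<bar>u y\<bar> \<le> 1" if "y \<in> ball 0 1" for y
  proof -
    have y: "norm y < 1" using that by simp
    \<comment> \<open>The two parts are nonnegative with sum \<open>4 * pi\<close>, so their
      difference is at most \<open>4 * pi\<close> in absolute value.\<close>
    have "\<bar>cap_integral 0 \<theta>0 y - cap_integral \<theta>0 pi y\<bar> \<le> 4 * pi"
      using cap_integral_combine[OF y \<theta>0(1,2)] cap_integral_nonneg[OF y, of 0 \<theta>0] cap_integral_nonneg[OF y, of \<theta>0 pi] \<theta>0
      by simp
    then show ?thesis by (simp add: u_def abs_mult)
  qed
  moreover have "harmonic_on (ball 0 1) u" and gr: "grad u x = g x"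
    using harmonic_with_imp_harmonic_on[OF _ h] x by auto
  moreover have "(1 / (norm x)^2) * ((sqrt (1 + (norm x)^2 / 3))^3 / (1 - (norm x)^2) - 1) \<le> norm (grad u x)"
  proof -
    have ut: "u (t *\<^sub>R e1) = 1 / t - (1 - t^2) / (t * sqrt (1 + t^2 - 2 * t * s))" if t: "0 < t" "t < 1" for t
    proof -
      define Q where "Q = sqrt (1 + t^2 - 2 * t * s)"
      have a: "sqrt (1 + t^2 - 2 * t * cos 0) = 1 - t" "sqrt (1 + t^2 - 2 * t * cos pi) = 1 + t"
      proof -
        have "1 + t^2 - 2 * t * cos 0 = (1 - t)^2" "1 + t^2 - 2 * t * cos pi = (1 + t)^2"
          by (simp_all add: power2_eq_square algebra_simps)
        then show "sqrt (1 + t^2 - 2 * t * cos 0) = 1 - t" "sqrt (1 + t^2 - 2 * t * cos pi) = 1 + t"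
          using t by simp_all
      qed
      have "u (t *\<^sub>R e1) = 1 / (4 * pi) * (2 * pi * (1 - t^2) / t * (1 / (1 - t) - 1 / Q) - 2 * pi * (1 - t^2) / t * (1 / Q - 1 / (1 + t)))"
        unfolding u_def cap_integral_axis[OF t \<theta>0(1)] cap_integral_axis[OF t \<theta>0(2)] a \<theta>0(3) Q_def ..
      also have "\<dots> = (1 - t^2) / (2 * t) * (1 / (1 - t) + 1 / (1 + t)) - (1 - t^2) / t * (1 / Q)"
      proof -
        have "1 / (4 * pi) * (2 * pi * n / t * (a - q) - 2 * pi * n / t * (q - b)) = n / (2 * t) * (a + b) - n / t * q" for n a b q :: real
          using t by (simp add: field_simps)
        then show ?thesis .
      qed
      also have "(1 - t^2) / (2 * t) * (1 / (1 - t) + 1 / (1 + t)) = 1 / t"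
      proof -
        have "1 / (1 - t) + 1 / (1 + t) = 2 / (1 - t^2)"
          using t by (simp add: field_simps power2_eq_square)
        moreover have "1 - t^2 \<noteq> 0" using t by (simp add: power2_eq_1_iff)
        moreover have "n / (2 * t) * (2 / n) = 1 / t" if "n \<noteq> 0" for n
          using t that by simp
        ultimately show ?thesis by (simp only: not_False_eq_True)
      qed
      finally show ?thesis by (simp add: Q_def)
    qed
    define Cc where "Cc = (1 / \<rho>^2) * ((sqrt (1 + \<rho>^2 / 3))^3 / (1 - \<rho>^2) - 1)"
    have "((\<lambda>t. 1 / t - (1 - t^2) / (t * sqrt (1 + t^2 - 2 * t * s))) has_real_derivative Cc) (at \<rho>)"
      using axis_derivative[OF \<rho>] by (simp add: Cc_def s_def)
    then have D1: "((\<lambda>t. u (t *\<^sub>R e1)) has_real_derivative Cc) (at \<rho>)"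
      by (rule has_field_derivative_transform_within_open[where S = "{0<..<1}"]) (use \<rho> ut in auto)
    have "((\<lambda>t. t *\<^sub>R e1) has_derivative (\<lambda>h. h *\<^sub>R e1)) (at \<rho>)" by (auto intro!: derivative_eq_intros)
    moreover have "(u has_derivative (\<lambda>h. g x \<bullet> h)) (at (\<rho> *\<^sub>R e1))"
      using h x unfolding harmonic_with_def xe[symmetric] by simp
    ultimately have "((\<lambda>t. u (t *\<^sub>R e1)) has_derivative (\<lambda>h. g x \<bullet> (h *\<^sub>R e1))) (at \<rho>)"
      by (rule has_derivative_compose)
    then have "((\<lambda>t. u (t *\<^sub>R e1)) has_real_derivative (g x \<bullet> e1)) (at \<rho>)"
      by (simp add: has_field_derivative_def mult_commute_abs)
    then have "Cc = g x \<bullet> e1" using D1 DERIV_unique by blast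
    also have "\<dots> \<le> norm (g x)" using norm_cauchy_schwarz[of "g x" e1] ne1 by simp
    finally show ?thesis by (simp add: gr Cc_def \<rho>_def)
  qed
  ultimately show thesis using that by blast
qed

text \<open>With \<open>\<rho>^2 = 3 * (Y - 1) * (Y + 1)\<close> the numerator
  \<open>Y^3 - (1 - \<rho>^2)\<close> factors as \<open>(Y - 1) * (Y + 2)^2\<close>, and
  \<open>Y - 1\<close> cancels. This links the stated constant, the derivative of the extremal
  function and the bound of the gradient estimate.\<close>

lemma sharp_constant_eq:
  fixes \<rho> :: real
  assumes \<rho>: "0 < \<rho>" "\<rho> < 1"
  defines "Y \<equiv> sqrt (1 + \<rho>^2 / 3)"
  shows "(1 / \<rho>^2) * ((1 + \<rho>^2 / 3) powr (3/2) / (1 - \<rho>^2) - 1) = (1 / \<rho>^2) * (Y^3 / (1 - \<rho>^2) - 1)"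
    and "(1 / \<rho>^2) * (Y^3 / (1 - \<rho>^2) - 1) = (Y + 2)^2 / (3 * (Y + 1)) / (1 - \<rho>^2)"
    and "(1 / \<rho>^2) * (Y^3 / (1 - \<rho>^2) - 1) > 0"
proof -
  have \<rho>2: "0 < 1 - \<rho>^2" using \<rho> by (simp add: power_less_one_iff)
  have pos: "1 + \<rho>^2 / 3 > 0" by (simp add: add_pos_nonneg)
  have Y: "Y > 0" "Y^2 = 1 + \<rho>^2 / 3" using pos by (simp_all add: Y_def)
  have "(1 + \<rho>^2 / 3) powr (3/2) = (Y powr 2) powr (3/2)" using Y by (simp only: powr_numeral)
  also have "\<dots> = Y powr (2 * (3/2))" by (rule powr_powr)
  also have "\<dots> = Y^3" using Y(1) by simp
  finally show "(1 / \<rho>^2) * ((1 + \<rho>^2 / 3) powr (3/2) / (1 - \<rho>^2) - 1) = (1 / \<rho>^2) * (Y^3 / (1 - \<rho>^2) - 1)"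
    by simp
  have Y1: "Y > 1"
  proof -
    have "Y^2 > 1^2" using Y \<rho> by simp
    then show ?thesis using Y by (rule_tac power2_less_imp_less) auto
  qed
  have r: "\<rho>^2 = 3 * (Y - 1) * (Y + 1)" using Y(2) by (simp add: power2_eq_square algebra_simps)
  have "(1 / \<rho>^2) * (Y^3 / (1 - \<rho>^2) - 1) = (Y^3 - (1 - \<rho>^2)) / \<rho>^2 / (1 - \<rho>^2)"
    using \<rho> \<rho>2 by (simp add: field_simps)
  also have "Y^3 - (1 - \<rho>^2) = (Y - 1) * (Y + 2)^2" unfolding r by algebra
  also have "(Y - 1) * (Y + 2)^2 / \<rho>^2 = (Y + 2)^2 / (3 * (Y + 1))"
  proof -
    have "3 * (Y - 1) * (Y + 1) = (Y - 1) * (3 * (Y + 1))" by algebra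
    then show ?thesis unfolding r using Y1 by (simp only: nonzero_mult_divide_mult_cancel_left)
  qed
  finally show e: "(1 / \<rho>^2) * (Y^3 / (1 - \<rho>^2) - 1) = (Y + 2)^2 / (3 * (Y + 1)) / (1 - \<rho>^2)" .
  show "(1 / \<rho>^2) * (Y^3 / (1 - \<rho>^2) - 1) > 0" unfolding e using Y1 \<rho>2 by simp
qed

theorem theorem2:
  fixes x :: "real^3"
  assumes "x \<in> ball 0 1" and "x \<noteq> 0"
  shows "(\<forall>u. harmonic_on (ball 0 1) u \<and> bounded (u ` ball 0 1) \<longrightarrow>
            norm (grad u x) \<le> (1 / (norm x)\<^sup>2) *
              ((1 + (norm x)\<^sup>2 / 3) powr (3/2) / (1 - (norm x)\<^sup>2) - 1) *
              (SUP y\<in>ball 0 1. \<bar>u y\<bar>))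
       \<and> (\<forall>C::real. (\<forall>u. harmonic_on (ball 0 1) u \<and> bounded (u ` ball 0 1) \<longrightarrow>
                          norm (grad u x) \<le> C * (SUP y\<in>ball 0 1. \<bar>u y\<bar>))
              \<longrightarrow> (1 / (norm x)\<^sup>2) *
                    ((1 + (norm x)\<^sup>2 / 3) powr (3/2) / (1 - (norm x)\<^sup>2) - 1) \<le> C)"
proof -
  have x: "norm x < 1" "x \<noteq> 0" using assms by auto
  define \<rho> where "\<rho> = norm x"
  have \<rho>: "0 < \<rho>" "\<rho> < 1" using x by (auto simp: \<rho>_def)
  have \<rho>2: "0 < 1 - \<rho>^2" using \<rho> by (simp add: power_less_one_iff)
  note const = sharp_constant_eq[OF \<rho>]
  have sup: "\<bar>u y\<bar> \<le> (SUP y\<in>ball 0 1. \<bar>u y\<bar>)" if "bounded (u ` ball 0 1)" "y \<in> ball 0 1" for u :: "real^3 \<Rightarrow> real" and y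
  proof (rule cSUP_upper[OF that(2)])
    show "bdd_above ((\<lambda>y. \<bar>u y\<bar>) ` ball 0 1)"
      using that(1) by (auto simp: bounded_iff bdd_above_def)
  qed
  have upper: "norm (grad u x) \<le> (1 / \<rho>\<^sup>2) * ((1 + \<rho>\<^sup>2 / 3) powr (3/2) / (1 - \<rho>\<^sup>2) - 1) * (SUP y\<in>ball 0 1. \<bar>u y\<bar>)"
    if hu: "harmonic_on (ball 0 1) u" and bu: "bounded (u ` ball 0 1)" for u
  proof -
    obtain H where "harmonic_with (ball 0 1) u (grad u) H"
      by (rule harmonic_on_imp_harmonic_with[OF hu])
    from harmonic_gradient_bound[OF this sup[OF bu] x]
    have "(1 - \<rho>^2) * norm (grad u x) \<le> (SUP y\<in>ball 0 1. \<bar>u y\<bar>) * ((sqrt (1 + \<rho>^2 / 3) + 2)^2 / (3 * (sqrt (1 + \<rho>^2 / 3) + 1)))"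
      by (simp add: \<rho>_def)
    moreover have "m \<le> T / d * s" if "d * m \<le> s * T" "d > 0" for d m s T :: real
      using that by (simp add: field_simps)
    ultimately show ?thesis unfolding const(1,2) using \<rho>2 by blast
  qed
  have lower: "(1 / \<rho>\<^sup>2) * ((1 + \<rho>\<^sup>2 / 3) powr (3/2) / (1 - \<rho>\<^sup>2) - 1) \<le> C"
    if C: "\<And>u. harmonic_on (ball 0 1) u \<Longrightarrow> bounded (u ` ball 0 1) \<Longrightarrow> norm (grad u x) \<le> C * (SUP y\<in>ball 0 1. \<bar>u y\<bar>)" for C
  proof -
    obtain u where u: "harmonic_on (ball 0 1) u" "\<And>y. y \<in> ball 0 1 \<Longrightarrow> \<bar>u y\<bar> \<le> 1"
      and l: "(1 / \<rho>^2) * ((sqrt (1 + \<rho>^2 / 3))^3 / (1 - \<rho>^2) - 1) \<le> norm (grad u x)"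
      using extremal_harmonic[OF x] unfolding \<rho>_def by blast
    have b: "bounded (u ` ball 0 1)" using u(2) by (auto simp: bounded_iff intro!: exI[of _ 1])
    have S1: "(SUP y\<in>ball 0 1. \<bar>u y\<bar>) \<le> 1" using u(2) by (intro cSUP_least) auto
    have S0: "0 \<le> (SUP y\<in>ball 0 1. \<bar>u y\<bar>)" using sup[OF b, of 0] by simp
    have le: "(1 / \<rho>^2) * ((sqrt (1 + \<rho>^2 / 3))^3 / (1 - \<rho>^2) - 1) \<le> C * (SUP y\<in>ball 0 1. \<bar>u y\<bar>)"
      using l C[OF u(1) b] by linarith
    \<comment> \<open>The supremum for the extremal function is only known to be at most 1.
      Replacing it by 1 needs a nonnegative \<open>C\<close>, which follows since the constant is
      positive.\<close>
    have "C \<ge> 0"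
    proof (rule ccontr)
      assume "\<not> C \<ge> 0"
      then have "C * (SUP y\<in>ball 0 1. \<bar>u y\<bar>) \<le> 0" using S0 by (simp add: mult_nonpos_nonneg)
      then show False using le const(3) by linarith
    qed
    then have "C * (SUP y\<in>ball 0 1. \<bar>u y\<bar>) \<le> C * 1" using S1 by (intro mult_left_mono)
    then show ?thesis unfolding const(1) using le by linarith
  qed
  show ?thesis using upper lower unfolding \<rho>_def by blast
qed

end
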